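(* Let $W$ be a $3$-dimensional real vector space with a fixed positive Lebesgue measure. For a linear functional $\xi\in W^*$, consider the graphing map $\overline\xi:W\to W\times\mathbb{R}$, $\overline\xi(w)=(w,\xi(w))$. Then for all convex bodies $A_1,A_2,B_1,B_2\subset W$ with $B_1,B_2$ centrally symmetric we have $$V\big(A_1,A_2,\overline\xi(B_1),\overline\xi(B_2)\big)^2\ \ge\ V\big(A_1,A_2,\overline\xi(A_1),\overline\xi(A_2)\big)\,V\big(B_1,B_2,\overline\xi(B_1),\overline\xi(B_2)\big).$$
   Context: A convex body is a non-empty compact convex subset; it is centrally symmetric if it is symmetric about some point. $V$ denotes the usual mixed volume in the $4$-dimensional space $W\times\mathbb{R}$, normalized by the product of the given measure on $W$ and the Lebesgue measure on $\mathbb{R}$, so that $V(A,A,A,A)$ is the volume of $A$. Convex bodies $A_i,B_i\subset W$ are regarded as subsets $A_i\times\{0\}$, $B_i\times\{0\}$ of $W\times\mathbb{R}$. *)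

theory Defs
  imports "HOL-Analysis.Analysis" "HOL-Library.Set_Algebras"
begin

definition convex_body :: "'a::euclidean_space set \<Rightarrow> bool" where
  "convex_body K \<longleftrightarrow> K \<noteq> {} \<and> compact K \<and> convex K"

definition centrally_symmetric :: "'a::real_vector set \<Rightarrow> bool" where
  "centrally_symmetric K \<longleftrightarrow> (\<exists>p. \<forall>x\<in>K. 2 *\<^sub>R p - x \<in> K)"

text \<open>The measure \<open>lborel\<close> is normalised by the inner product of the type; its positive multiples
  are all the translation-invariant Lebesgue measures, and this class depends on the vector space
  structure only.\<close>

definition positive_Lebesgue_measure :: "'a::euclidean_space measure \<Rightarrow> bool" where
  "positive_Lebesgue_measure \<mu> \<longleftrightarrow> (\<exists>c::real. c > 0 \<and> \<mu> = scale_measure (ennreal c) lborel)"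

text \<open>The mixed volume is the polarization of the volume functional:
  \<open>V(K\<^sub>1,\<dots>,K\<^sub>n) = 1/n! \<Sum>\<^sub>I (-1)^(n-|I|) vol(\<Sum>\<^sub>i\<^sub>\<in>\<^sub>I K\<^sub>i)\<close>, where \<open>I\<close> ranges over the nonempty subsets of
  the index set and sums of sets are Minkowski sums. It is meaningful when the length \<open>n\<close> of the
  list is the dimension of the space and \<open>M\<close> is a Lebesgue measure.\<close>

definition mixed_volume :: "'a::euclidean_space measure \<Rightarrow> 'a set list \<Rightarrow> real" where
  "mixed_volume M Ks =
     (\<Sum>I \<in> Pow {..<length Ks} - {{}}.
        (-1) ^ (length Ks - card I) * measure M (\<Sum>i\<in>I. Ks ! i)) / fact (length Ks)"

definition graphing :: "('a \<Rightarrow> real) \<Rightarrow> 'a \<Rightarrow> 'a \<times> real" where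
  "graphing \<xi> w = (w, \<xi> w)"

lemma mixed_volume_4:
  "mixed_volume M [A, B, C, D] =
    (measure M (A + B + C + D)
      - measure M (A + B + C) - measure M (A + B + D) - measure M (A + C + D) - measure M (B + C + D)
      + measure M (A + B) + measure M (A + C) + measure M (A + D)
      + measure M (B + C) + measure M (B + D) + measure M (C + D)
      - measure M A - measure M B - measure M C - measure M D) / 24"
proof -
  have P: "Pow {..<length [A,B,C,D]} - {{}} =
    {{0,1,2,3},{0,1,2},{0,1,3},{0,2,3},{1,2,3},{0,1},{0,2},{0,3},{1,2},{1,3},{2,3},{0},{1},{2},{3}}"
  proof -
    have "{..<length [A,B,C,D]} = {0,1,2,3}" by auto
    then show ?thesis by (simp add: Pow_insert) (auto simp: insert_commute)
  qed
  have neq: "(S::nat set) \<noteq> T" if "\<exists>x\<in>{0,1,2,3}. (x \<in> S) \<noteq> (x \<in> T)" for S T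
    using that by auto
  show ?thesis
    unfolding mixed_volume_def P
    apply (subst sum.insert, simp, simp add: neq)+
    apply (simp add: fact_numeral add.assoc eval_nat_numeral)
    done
qed

lemma convex_body_plus: "convex_body A \<Longrightarrow> convex_body B \<Longrightarrow> convex_body (A + B)"
proof -
  assume A: "convex_body A" and B: "convex_body B"
  have "A + B = {x + y | x y. x \<in> A \<and> y \<in> B}"
    by (auto simp: set_plus_def)
  then show ?thesis
    using A B compact_sums[of A B] convex_set_plus[of A B]
    by (auto simp: convex_body_def)
qed

text \<open>This pins the definition down: it agrees on convex bodies with every symmetric, Minkowski
  additive functional whose diagonal is the volume.\<close>

lemma mixed_volume_unique:
  fixes F :: "'a::euclidean_space set \<Rightarrow> 'a set \<Rightarrow> 'a set \<Rightarrow> 'a set \<Rightarrow> real"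
  assumes sym: "\<And>A B C D. F A B C D = F B A C D" "\<And>A B C D. F A B C D = F A C B D"
      "\<And>A B C D. F A B C D = F A B D C"
    and add: "\<And>A A' B C D. \<lbrakk>convex_body A; convex_body A'; convex_body B; convex_body C; convex_body D\<rbrakk>
      \<Longrightarrow> F (A + A') B C D = F A B C D + F A' B C D"
    and diag: "\<And>A. convex_body A \<Longrightarrow> F A A A A = measure M A"
    and bodies: "convex_body A" "convex_body B" "convex_body C" "convex_body D"
  shows "mixed_volume M [A, B, C, D] = F A B C D"
proof -
  have add2: "F B (A + A') C D = F B A C D + F B A' C D"
    if "convex_body A" "convex_body A'" "convex_body B" "convex_body C" "convex_body D"
    for A A' B C D
    using add[OF that] sym(1) by metis
  have add3: "F B C (A + A') D = F B C A D + F B C A' D"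
    if "convex_body A" "convex_body A'" "convex_body B" "convex_body C" "convex_body D"
    for A A' B C D
    using add2[OF that] sym(2) by metis
  have add4: "F B C D (A + A') = F B C D A + F B C D A'"
    if "convex_body A" "convex_body A'" "convex_body B" "convex_body C" "convex_body D"
    for A A' B C D
    using add3[OF that] sym(3) by metis
  show ?thesis
    unfolding mixed_volume_4
    by (simp add: diag[symmetric] bodies convex_body_plus add add2 add3 add4 sym)
qed

text \<open>Normalization in the four-dimensional space \<open>W \<times> \<real>\<close>.\<close>

lemma mixed_volume_diagonal:
  fixes \<mu> :: "'a::euclidean_space measure" and K :: "('a \<times> real) set"
  assumes dim: "DIM('a) = 3" and \<mu>: "positive_Lebesgue_measure \<mu>" and K: "convex_body K"
  shows "mixed_volume (\<mu> \<Otimes>\<^sub>M lborel) [K, K, K, K] = measure (\<mu> \<Otimes>\<^sub>M lborel) K"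
proof -
  obtain c :: real where c: "c > 0" "\<mu> = scale_measure (ennreal c) lborel"
    using \<mu> unfolding positive_Lebesgue_measure_def by blast
  have vol: "measure (\<mu> \<Otimes>\<^sub>M lborel) X = c * measure lborel X" if "compact X" for X :: "('a \<times> real) set"
  proof -
    have X: "X \<in> sets ((lborel :: 'a measure) \<Otimes>\<^sub>M (lborel :: real measure))"
      unfolding lborel_prod using that by (simp add: borel_compact)
    have "sets (\<mu> \<Otimes>\<^sub>M (lborel::real measure)) = sets ((lborel :: 'a measure) \<Otimes>\<^sub>M (lborel :: real measure))"
      unfolding c(2) by (rule sets_pair_measure_cong) auto
    then have X': "X \<in> sets (\<mu> \<Otimes>\<^sub>M (lborel::real measure))" using X by simp
    have f: "(\<lambda>x. emeasure (lborel::real measure) (Pair x -` X)) \<in> borel_measurable lborel"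
      using X by (rule lborel.measurable_emeasure_Pair)
    have "emeasure (\<mu> \<Otimes>\<^sub>M lborel) X = (\<integral>\<^sup>+x. emeasure lborel (Pair x -` X) \<partial>\<mu>)"
      using X' by (rule lborel.emeasure_pair_measure_alt)
    also have "\<dots> = ennreal c * (\<integral>\<^sup>+x. emeasure lborel (Pair x -` X) \<partial>lborel)"
      unfolding c(2) using f by (simp add: nn_integral_scale_measure)
    also have "\<dots> = ennreal c * emeasure (lborel \<Otimes>\<^sub>M lborel) X"
      using X by (simp add: lborel.emeasure_pair_measure_alt)
    finally show ?thesis
      using c(1) by (simp add: measure_def lborel_prod enn2real_mult)
  qed
  have dbl: "(a *\<^sub>R x + b *\<^sub>R y) \<in> (\<lambda>x. (a + b) *\<^sub>R x) ` K"
    if "x \<in> K" "y \<in> K" "a > 0" "b > 0" for a b x y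
  proof -
    have "(a / (a + b)) *\<^sub>R x + (b / (a + b)) *\<^sub>R y \<in> K"
      using K that unfolding convex_body_def convex_def by (auto simp: add_divide_distrib[symmetric])
    moreover have "(a + b) *\<^sub>R ((a / (a + b)) *\<^sub>R x + (b / (a + b)) *\<^sub>R y) = a *\<^sub>R x + b *\<^sub>R y"
      using that by (simp add: scaleR_right_distrib)
    ultimately show ?thesis by (metis image_eqI)
  qed
  have plus: "(\<lambda>x. a *\<^sub>R x) ` K + K = (\<lambda>x. (a + 1) *\<^sub>R x) ` K" if "a > 0" for a
  proof
    show "(\<lambda>x. a *\<^sub>R x) ` K + K \<subseteq> (\<lambda>x. (a + 1) *\<^sub>R x) ` K"
      using dbl[of _ _ a 1] that by (fastforce simp: set_plus_def)
    show "(\<lambda>x. (a + 1) *\<^sub>R x) ` K \<subseteq> (\<lambda>x. a *\<^sub>R x) ` K + K"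
      by (auto simp: set_plus_def scaleR_left_distrib)
  qed
  have 2: "K + K = (\<lambda>x. 2 *\<^sub>R x) ` K" using plus[of 1] by simp
  have 3: "K + K + K = (\<lambda>x. 3 *\<^sub>R x) ` K" using plus[of 2] 2 by simp
  have 4: "K + K + K + K = (\<lambda>x. 4 *\<^sub>R x) ` K" using plus[of 3] 3 by simp
  have sc: "measure (\<mu> \<Otimes>\<^sub>M lborel) ((\<lambda>x. a *\<^sub>R x) ` K) = a ^ 4 * measure (\<mu> \<Otimes>\<^sub>M lborel) K"
    if "a > 0" for a
  proof -
    have cK: "compact K" using K by (simp add: convex_body_def)
    then have cS: "compact ((\<lambda>x. a *\<^sub>R x) ` K)" by (rule compact_scaling)
    have "measure lebesgue ((\<lambda>x. a *\<^sub>R x) ` K) = \<bar>a\<bar> ^ DIM('a \<times> real) * measure lebesgue K"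
      using measure_lebesgue_affine[of a 0 K] by simp
    then show ?thesis
      using that cK cS by (simp add: vol dim borel_compact measure_completion)
  qed
  show ?thesis
    unfolding mixed_volume_4 by (simp add: 2 plus sc)
qed

end

theory Submission
  imports Defs
begin

text \<open>
  Choose coordinates \<open>W = \<real>\<^sup>2 \<times> \<real>\<close> in which \<open>\<xi>\<close> is the last coordinate (if \<open>\<xi> = 0\<close>, all the bodies
  lie in one hyperplane and every mixed volume vanishes). For \<open>X, Y \<subseteq> W\<close> with planar slices \<open>X\<^sub>s\<close>,
  \<open>Y\<^sub>t\<close> a shear turns the sum of \<open>X \<times> {0}\<close> and the graph over \<open>Y\<close> into the set of all
  \<open>(x + y, s, t)\<close> with \<open>x \<in> X\<^sub>s\<close>, \<open>y \<in> Y\<^sub>t\<close>, so its volume is \<open>\<integral>\<integral> area (X\<^sub>s + Y\<^sub>t) ds dt\<close>. Hence the mixed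
  volumes in question are planar mixed areas of averaged slices, and the claim becomes Minkowski's
  inequality in the plane, for a pair of functions that must first be shown to be support functions.

  The planar theory rests on one exact formula. A planar convex body is its bounding box minus four
  corner regions, and a corner region has area \<open>1/2 \<integral> \<kappa> p\<^sup>2 dp\<close>, where \<open>\<kappa> p\<close> is the distance, from the
  vertical side of the box, of the point in which a line of slope \<open>\<plusminus> p\<close> touches the body
  (\<open>emeasure_corner_region\<close>, \<open>emeasure_box_minus_corners\<close>). Width, height and \<open>\<kappa> p\<close> are additive in
  the support function, so mixed area is the symmetric bilinear form \<open>mixed_form\<close>: a product of two
  linear forms minus an \<open>L\<^sup>2\<close> inner product. Such a form has one positive direction, and this gives
  its reversed Cauchy-Schwarz inequality on support functions at once (\<open>mixed_form_Minkowski\<close>).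

  Being bilinear, \<open>mixed_form\<close> commutes with integration over the slices, by dominated convergence and
  Tonelli's theorem (\<open>mixed_form_slice_integral\<close>). Polarizing, \<open>V(A\<^sub>1, A\<^sub>2, \<xi>B\<^sub>1, \<xi>B\<^sub>2)\<close> is a positive constant times
  \<open>mixed_form m n\<close>, where \<open>m = F(A\<^sub>1 + A\<^sub>2) - F(A\<^sub>1) - F(A\<^sub>2)\<close>, where \<open>F(X)\<close> integrates the support
  functions of the slices of \<open>X\<close>, and where \<open>n\<close> is formed in the same way from \<open>B\<^sub>1, B\<^sub>2\<close>.

  It remains to see that the difference \<open>m\<close> is again sublinear, hence the support function of a
  convex body (twice the mixed fibre body of \<open>A\<^sub>1\<close> and \<open>A\<^sub>2\<close>). In a fixed direction the support function
  of the slices of \<open>A\<^sub>1 + A\<^sub>2\<close> is a supremal convolution of two concave functions, and the optimal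
  splitting \<open>r = \<sigma> r + (r - \<sigma> r)\<close> moves monotonically in both summands (\<open>optimal_splitting\<close>). For
  a monotone contraction \<open>\<sigma>\<close> and \<open>g \<ge> 0\<close> the integral of \<open>g \<circ> \<sigma>\<close> is at least the integral of \<open>g\<close> over
  the image of \<open>\<sigma>\<close>; applied to the defects of subadditivity of the slices, this yields
  \<open>mixed_fiber_fn_subadditive\<close>.
\<close>

section \<open>Sums and linear images of compact sets\<close>

lemma compact_set_plus:
  fixes A B :: "'a::real_normed_vector set"
  assumes "compact A" "compact B" shows "compact (A + B)"
proof -
  have "A + B = {x + y |x y. x \<in> A \<and> y \<in> B}" unfolding set_plus_def by blast
  then show ?thesis using compact_sums[OF assms] by simp
qed

lemma linear_image_compact:
  fixes f :: "'a::euclidean_space \<Rightarrow> 'b::real_normed_vector"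
  assumes "linear f" "compact X" shows "compact (f ` X)"
  using assms by (simp add: linear_conv_bounded_linear linear_continuous_on compact_continuous_image)

lemma linear_image_plus:
  assumes "linear f" shows "f ` (X + Y) = f ` X + f ` Y"
proof (rule equalityI; rule subsetI)
  fix z assume "z \<in> f ` (X + Y)"
  then obtain x y where "x \<in> X" "y \<in> Y" "z = f (x + y)" by (auto elim!: set_plus_elim)
  then show "z \<in> f ` X + f ` Y" by (simp only: linear_add[OF assms]) (intro set_plus_intro imageI)
next
  fix z assume "z \<in> f ` X + f ` Y"
  then obtain x y where "x \<in> X" "y \<in> Y" "z = f (x + y)"
    by (auto elim!: set_plus_elim simp: linear_add[OF assms])
  then show "z \<in> f ` (X + Y)" by (simp only:) (intro imageI set_plus_intro)
qed

section \<open>Corners below a concave function\<close>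

text \<open>
  The limit runs along \<open>1/n\<close> only, so that right slopes are visibly measurable in any parameter on
  which \<open>g\<close> depends measurably, and additive in \<open>g\<close>.
\<close>

definition right_slope :: "(real \<Rightarrow> real) \<Rightarrow> real \<Rightarrow> real" where
  "right_slope g p = lim (\<lambda>n. real (Suc n) * (g (p + 1 / real (Suc n)) - g p))"

text \<open>
  For a corner of a planar body, with \<open>s, t \<ge> 0\<close> the distances from the two sides of the bounding box,
  \<open>g p\<close> will be the least value of \<open>t + p s\<close> on the body. Its right slope is the coordinate \<open>s\<close> of a
  point where that minimum is attained, which is why it lies between \<open>0\<close> and the width \<open>C\<close>.
\<close>

locale concave_increasing =
  fixes g :: "real \<Rightarrow> real" and C :: real
  assumes concave: "concave_on UNIV g"
    and incr: "\<And>p q. p \<le> q \<Longrightarrow> g p \<le> g q"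
    and steep: "\<And>p q. p \<le> q \<Longrightarrow> g q - g p \<le> C * (q - p)"
begin

lemma three_slopes:
  assumes "p < q" "q < r"
  shows "(g r - g q) / (r - q) \<le> (g r - g p) / (r - p)"
    and "(g r - g p) / (r - p) \<le> (g q - g p) / (q - p)"
proof -
  have "convex_on {p..r} (\<lambda>x. - g x)"
    using concave unfolding concave_on_def by (rule convex_on_subset) auto
  then have "(- g p - - g q) / (p - q) \<le> (- g p - - g r) / (p - r)"
    and "(- g p - - g r) / (p - r) \<le> (- g q - - g r) / (q - r)"
    using convex_on_slope_le[of "{p..r}" "\<lambda>x. - g x" p r q] assms by auto
  with assms show "(g r - g q) / (r - q) \<le> (g r - g p) / (r - p)"
    and "(g r - g p) / (r - p) \<le> (g q - g p) / (q - p)"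
    by (simp_all add: field_simps)
qed

lemma slope_mono:
  assumes "p < q" "q \<le> r"
  shows "(g r - g p) / (r - p) \<le> (g q - g p) / (q - p)"
  using three_slopes(2)[OF assms(1), of r] assms by (cases "q = r") auto

lemma quotient_bounds:
  "0 \<le> real (Suc n) * (g (p + 1 / real (Suc n)) - g p)"
  "real (Suc n) * (g (p + 1 / real (Suc n)) - g p) \<le> C"
proof -
  have "g (p + 1 / real (Suc n)) - g p \<le> C * (1 / real (Suc n))"
    using steep[of p "p + 1 / real (Suc n)"] by simp
  then show "real (Suc n) * (g (p + 1 / real (Suc n)) - g p) \<le> C"
    by (simp add: field_simps)
  show "0 \<le> real (Suc n) * (g (p + 1 / real (Suc n)) - g p)"
    using incr[of p "p + 1 / real (Suc n)"] by simp
qed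

lemma quotient_incseq: "incseq (\<lambda>n. real (Suc n) * (g (p + 1 / real (Suc n)) - g p))"
proof (rule incseq_SucI)
  fix n
  have "1 / real (Suc (Suc n)) \<le> 1 / real (Suc n)" by (simp add: field_simps)
  then show "real (Suc n) * (g (p + 1 / real (Suc n)) - g p)
      \<le> real (Suc (Suc n)) * (g (p + 1 / real (Suc (Suc n))) - g p)"
    using slope_mono[of p "p + 1 / real (Suc (Suc n))" "p + 1 / real (Suc n)"]
    by (simp add: mult.commute)
qed

lemma right_slope_lim: 
  "(\<lambda>n. real (Suc n) * (g (p + 1 / real (Suc n)) - g p)) \<longlonglongrightarrow> right_slope g p"
proof -
  have "Bseq (\<lambda>n. real (Suc n) * (g (p + 1 / real (Suc n)) - g p))"
    by (rule BseqI'[of _ C]) (use quotient_bounds[of _ p] in auto)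
  then have "convergent (\<lambda>n. real (Suc n) * (g (p + 1 / real (Suc n)) - g p))"
    using quotient_incseq by (intro Bseq_monoseq_convergent incseq_imp_monoseq) auto
  then show ?thesis
    unfolding right_slope_def by (simp add: convergent_LIMSEQ_iff)
qed

lemma right_slope_bounds: "0 \<le> right_slope g p" "right_slope g p \<le> C"
  using quotient_bounds[of _ p]
  by (auto intro: LIMSEQ_le_const[OF right_slope_lim] LIMSEQ_le_const2[OF right_slope_lim])

lemma right_slope_ge:
  assumes "p < q" shows "g q - g p \<le> right_slope g p * (q - p)"
proof -
  obtain N where N: "1 / real (Suc N) < q - p"
    using assms by (metis diff_gt_0_iff_gt nat_approx_posE)
  have "(g q - g p) / (q - p) \<le> real (Suc N) * (g (p + 1 / real (Suc N)) - g p)"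
    using slope_mono[of p "p + 1 / real (Suc N)" q] N by (simp add: mult.commute)
  also have "\<dots> \<le> right_slope g p"
    using quotient_incseq right_slope_lim by (rule incseq_le)
  finally show ?thesis using assms by (simp add: field_simps)
qed

lemma right_slope_le:
  assumes "p < q" shows "right_slope g q * (q - p) \<le> g q - g p"
proof -
  have "real (Suc n) * (g (q + 1 / real (Suc n)) - g q) \<le> (g q - g p) / (q - p)" for n
    using three_slopes[OF assms, of "q + 1 / real (Suc n)"] by (simp add: mult.commute)
  then have "right_slope g q \<le> (g q - g p) / (q - p)"
    by (intro LIMSEQ_le_const2[OF right_slope_lim]) auto
  then show ?thesis using assms by (simp add: field_simps)
qed

lemma right_slope_antimono:
  assumes "p \<le> q" shows "right_slope g q \<le> right_slope g p"
proof (cases "p = q")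
  case False
  with assms have "right_slope g q * (q - p) \<le> right_slope g p * (q - p)" 
    using right_slope_ge[of p q] right_slope_le[of p q] by linarith
  moreover have "0 < q - p" using False assms by simp
  ultimately show ?thesis by (rule mult_right_le_imp_le)
qed simp

lemma right_slope_measurable [measurable]: "right_slope g \<in> borel_measurable borel"
proof -
  have "mono (\<lambda>x. - right_slope g x)"
    by (rule monoI) (simp add: right_slope_antimono)
  then have "(\<lambda>x. - (- right_slope g x)) \<in> borel_measurable borel"
    by (intro borel_measurable_uminus borel_measurable_mono)
  then show ?thesis by simp
qed

text \<open>
  Both \<open>\<integral> right_slope g\<close> and the increment of \<open>g\<close> over \<open>[x, y]\<close> lie between the values of the
  decreasing function \<open>right_slope g\<close> at the two ends, times \<open>y - x\<close>. Over a partition into \<open>n\<close> equal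
  parts these discrepancies telescope to a quantity of order \<open>1/n\<close>.
\<close>

lemma right_slope_has_integral:
  assumes "p \<le> q" shows "(right_slope g has_integral g q - g p) {p..q}"
proof -
  have int: "right_slope g integrable_on {x..y}" for x y
  proof -
    have "(\<lambda>p. - right_slope g p) integrable_on {x..y}"
      by (rule integrable_on_mono_on) (auto simp: mono_on_def right_slope_antimono)
    from integrable_neg[OF this] show ?thesis by simp
  qed
  define D where "D x y = integral {x..y} (right_slope g) - (g y - g x)" for x y
  have split: "D x y + D y z = D x z" if "x \<le> y" "y \<le> z" for x y z
    using Henstock_Kurzweil_Integration.integral_combine[OF that int] by (simp add: D_def)
  have step: "\<bar>D x y\<bar> \<le> (right_slope g x - right_slope g y) * (y - x)" if "x \<le> y" for x y
  proof (cases "x = y")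
    case False
    with that have xy: "x < y" by simp
    have "integral {x..y} (right_slope g) \<le> integral {x..y} (\<lambda>_. right_slope g x)"
      by (rule integral_le) (auto simp: int right_slope_antimono)
    moreover have "integral {x..y} (\<lambda>_. right_slope g y) \<le> integral {x..y} (right_slope g)"
      by (rule integral_le) (auto simp: int right_slope_antimono)
    ultimately show ?thesis
      using xy right_slope_ge[OF xy] right_slope_le[OF xy] by (simp add: D_def algebra_simps)
  qed (simp add: D_def)
  have steps: "\<bar>D p (p + real k * d)\<bar> \<le> (right_slope g p - right_slope g (p + real k * d)) * d" if "0 \<le> d" for k d
  proof (induction k)
    case (Suc k)
    let ?x = "p + real k * d" and ?y = "p + real (Suc k) * d"
    have xy: "p \<le> ?x" "?x \<le> ?y" "?y - ?x = d" using that by (auto simp: algebra_simps)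
    have "\<bar>D p ?y\<bar> \<le> \<bar>D p ?x\<bar> + \<bar>D ?x ?y\<bar>" using split[OF xy(1,2)] by linarith
    also have "\<dots> \<le> (right_slope g p - right_slope g ?x) * d + (right_slope g ?x - right_slope g ?y) * d"
      using Suc step[OF xy(2)] xy(3) by simp
    finally show ?case by (simp add: algebra_simps)
  qed (simp add: D_def)
  have "\<bar>D p q\<bar> \<le> ((right_slope g p - right_slope g q) * (q - p)) * inverse (real (Suc n))" for n
  proof -
    have "p + real (Suc n) * ((q - p) / real (Suc n)) = q" by simp
    then show ?thesis
      using steps[of "(q - p) / real (Suc n)" "Suc n"] assms by (simp add: divide_inverse mult.assoc)
  qed
  then have "\<bar>D p q\<bar> \<le> ((right_slope g p - right_slope g q) * (q - p)) * 0"
    by (intro LIMSEQ_le_const[OF tendsto_mult_left[OF LIMSEQ_inverse_real_of_nat]]) auto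
  then show ?thesis
    using int[of p q] by (simp add: D_def has_integral_iff)
qed

text \<open>
  Since \<open>right_slope g\<close> decreases, \<open>right_slope g x - s\<close> changes its sign at most once.
\<close>

lemma threshold:
  assumes "0 \<le> p"
  obtains q where "0 \<le> q" "q \<le> p" "\<And>x. 0 < x \<Longrightarrow> x < q \<Longrightarrow> s \<le> right_slope g x"
    "\<And>x. q < x \<Longrightarrow> x < p \<Longrightarrow> right_slope g x \<le> s"
proof
  define T where "T = insert 0 {x \<in> {0..p}. s < right_slope g x}"
  have bdd: "bdd_above T" and T0: "0 \<in> T" and Tp: "\<And>x. x \<in> T \<Longrightarrow> x \<le> p"
    using assms by (auto simp: T_def intro: bdd_aboveI[of _ p])
  show "0 \<le> Sup T" using cSup_upper[OF T0 bdd] .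
  show "Sup T \<le> p" using T0 Tp by (intro cSup_least) auto
  show "s \<le> right_slope g x" if "0 < x" "x < Sup T" for x
  proof -
    obtain y where "y \<in> T" "x < y" using \<open>x < Sup T\<close> less_cSup_iff[OF _ bdd] T0 by auto
    then show ?thesis using \<open>0 < x\<close> right_slope_antimono[of x y] by (auto simp: T_def)
  qed
  show "right_slope g x \<le> s" if "Sup T < x" "x < p" for x
  proof (rule ccontr)
    assume "\<not> right_slope g x \<le> s"
    then have "x \<in> T" using that \<open>0 \<le> Sup T\<close> by (auto simp: T_def)
    then show False using cSup_upper[OF _ bdd, of x] \<open>Sup T < x\<close> by simp
  qed
qed

lemma positive_part_integral_upto:
  assumes "g 0 = 0" "0 \<le> q" "\<And>p. 0 < p \<Longrightarrow> p < q \<Longrightarrow> s \<le> right_slope g p"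
  shows "(\<integral>\<^sup>+p\<in>{0<..<q}. ennreal (right_slope g p - s) \<partial>lborel) = ennreal (g q - q * s)"
proof -
  have "((\<lambda>p. right_slope g p - s) has_integral (g q - g 0) - (q - 0) * s) {0..q}"
    using right_slope_has_integral[of 0 q] has_integral_const_real[of s 0 q] assms(2)
    by (intro has_integral_diff) auto
  then have "((\<lambda>p. if p \<in> {0<..<q} then right_slope g p - s else 0) has_integral (g q - q * s)) UNIV"
    unfolding has_integral_restrict_UNIV has_integral_Icc_iff_Ioo using assms(1) by simp
  then have "(\<integral>\<^sup>+p. ennreal (if p \<in> {0<..<q} then right_slope g p - s else 0) \<partial>lborel) = ennreal (g q - q * s)"
    using assms(3) by (intro nn_integral_has_integral_lborel) auto
  moreover have "(\<integral>\<^sup>+p. ennreal (if p \<in> {0<..<q} then right_slope g p - s else 0) \<partial>lborel)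
      = (\<integral>\<^sup>+p\<in>{0<..<q}. ennreal (right_slope g p - s) \<partial>lborel)"
    by (rule nn_integral_cong) (auto simp: indicator_def)
  ultimately show ?thesis by simp
qed

text \<open>
  The derivative of \<open>g p - p s\<close> is positive up to a threshold and negative beyond it, so the
  supremum is the integral of the positive part of the derivative.
\<close>

lemma positive_part_integral:
  assumes g0: "g 0 = 0"
  shows "(\<integral>\<^sup>+p\<in>{0<..}. ennreal (right_slope g p - s) \<partial>lborel) = (SUP p\<in>{0<..}. ennreal (g p - p * s))"
    (is "?L = ?R")
proof (rule antisym)
  define \<nu> where "\<nu> = density lborel (\<lambda>p. ennreal (right_slope g p - s))"
  have \<nu>: "emeasure \<nu> A = (\<integral>\<^sup>+p\<in>A. ennreal (right_slope g p - s) \<partial>lborel)" if "A \<in> sets borel" for A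
    unfolding \<nu>_def using that by (subst emeasure_density) auto
  have sets: "sets \<nu> = sets borel" by (simp add: \<nu>_def)
  have upto: "emeasure \<nu> {0<..<real n} \<le> ?R" for n
  proof -
    obtain q where q: "0 \<le> q" "q \<le> real n" "\<And>x. 0 < x \<Longrightarrow> x < q \<Longrightarrow> s \<le> right_slope g x"
      "\<And>x. q < x \<Longrightarrow> x < real n \<Longrightarrow> right_slope g x \<le> s"
      using threshold[of "real n" s] by auto
    have "emeasure \<nu> {0<..<real n} = (\<integral>\<^sup>+p\<in>{0<..<real n}. ennreal (right_slope g p - s) \<partial>lborel)"
      by (simp add: \<nu>)
    also have "\<dots> = (\<integral>\<^sup>+p\<in>{0<..<q}. ennreal (right_slope g p - s) \<partial>lborel)"
    proof (rule nn_integral_cong_AE)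
      have "AE p in lborel. p \<noteq> q" by (rule AE_lborel_singleton)
      then show "AE p in lborel. ennreal (right_slope g p - s) * indicator {0<..<real n} p
          = ennreal (right_slope g p - s) * indicator {0<..<q} p"
      proof eventually_elim
        case (elim p)
        then show ?case using q(2) q(4)[of p] by (auto simp: indicator_def ennreal_neg)
      qed
    qed
    also have "\<dots> = ennreal (g q - q * s)"
      by (rule positive_part_integral_upto[OF g0 q(1,3)])
    also have "\<dots> \<le> ?R"
      using q(1) g0 by (cases "q = 0") (auto intro: SUP_upper)
    finally show ?thesis .
  qed
  have "(\<Union>n. {0<..<real n}) = {0<..}"
    by (auto intro: reals_Archimedean2)
  moreover have "(SUP n. emeasure \<nu> {0<..<real n}) = emeasure \<nu> (\<Union>n. {0<..<real n})"
    by (rule SUP_emeasure_incseq) (auto simp: sets incseq_def)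
  ultimately have "?L = (SUP n. emeasure \<nu> {0<..<real n})"
    by (simp add: \<nu>)
  then show "?L \<le> ?R" using upto by (simp add: SUP_least)
  show "?R \<le> ?L"
  proof (rule SUP_least)
    fix p :: real assume "p \<in> {0<..}"
    then have p: "0 \<le> p" by simp
    obtain q where q: "0 \<le> q" "q \<le> p" "\<And>x. 0 < x \<Longrightarrow> x < q \<Longrightarrow> s \<le> right_slope g x"
      "\<And>x. q < x \<Longrightarrow> x < p \<Longrightarrow> right_slope g x \<le> s"
      using threshold[OF p, of s] by auto
    have "(right_slope g has_integral g p - g q) {q<..<p}" "((\<lambda>_. s) has_integral (p - q) * s) {q<..<p}"
      using right_slope_has_integral[OF q(2)] has_integral_const_real[of s q p] q(2)
      by (auto simp: has_integral_Icc_iff_Ioo)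
    then have "g p - g q \<le> (p - q) * s"
      by (rule has_integral_le) (use q(4) in auto)
    then have "ennreal (g p - p * s) \<le> ennreal (g q - q * s)"
      by (intro ennreal_leI) (simp add: algebra_simps)
    also have "\<dots> = (\<integral>\<^sup>+p\<in>{0<..<q}. ennreal (right_slope g p - s) \<partial>lborel)"
      by (rule positive_part_integral_upto[OF g0 q(1,3), symmetric])
    also have "\<dots> \<le> ?L"
      by (intro nn_integral_mono) (auto simp: indicator_def)
    finally show "ennreal (g p - p * s) \<le> ?L" .
  qed
qed

lemma emeasure_below:
  fixes f :: "real \<Rightarrow> real"
  shows "emeasure lborel {t. 0 \<le> t \<and> (\<exists>p>0. t < f p)} = (SUP p\<in>{0<..}. ennreal (f p))"
proof (rule antisym)
  let ?D = "{t. 0 \<le> t \<and> (\<exists>p>0. t < f p)}" and ?M = "SUP p\<in>{0<..}. ennreal (f p)"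
  have D: "?D \<in> sets lborel"
  proof -
    have "?D = {0..} \<inter> (\<Union>p\<in>{0<..}. {..<f p})" by auto
    moreover have "open (\<Union>p\<in>{0<..}. {..<f p})" by (intro open_UN ballI open_lessThan)
    ultimately show ?thesis by (simp only: sets_lborel sets.Int borel_open borel_closed closed_atLeast)
  qed
  show "emeasure lborel ?D \<le> ?M"
  proof (cases ?M)
    case (real m)
    have "t \<in> {0..m}" if t: "t \<in> ?D" for t
    proof -
      obtain p where p: "p > 0" "t < f p" "0 \<le> t" using t by blast
      have "ennreal (f p) \<le> ennreal m" unfolding real(2)[symmetric] using p(1) by (intro SUP_upper) simp
      then have "f p \<le> m" using real(1) by (simp only: ennreal_le_iff)
      then show ?thesis using p(2,3) by simp
    qed
    then have "?D \<subseteq> {0..m}" by (rule subsetI)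
    then have "emeasure lborel ?D \<le> emeasure lborel {0..m}"
      by (intro emeasure_mono) simp_all
    also have "\<dots> = ennreal m" using real(1) by simp
    finally show ?thesis unfolding real(2) .
  next
    case top
    show ?thesis unfolding top by (rule top_greatest)
  qed
  show "?M \<le> emeasure lborel ?D"
  proof (rule SUP_least)
    fix p :: real assume "p \<in> {0<..}"
    then have "emeasure lborel {0..<f p} \<le> emeasure lborel ?D"
      using D by (intro emeasure_mono) auto
    then show "ennreal (f p) \<le> emeasure lborel ?D"
      by (cases "0 \<le> f p") (auto simp: ennreal_neg)
  qed
qed

lemma corner_set_borel:
  "{(s, t). 0 \<le> s \<and> 0 \<le> t \<and> (\<exists>p>0. t + p * s < g p)} \<in> sets (borel :: (real \<times> real) measure)"
    (is "?D \<in> _")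
  proof -
    have "?D = {z. 0 \<le> fst z} \<inter> {z. 0 \<le> snd z} \<inter> (\<Union>p\<in>{0<..}. {z. snd z + p * fst z < g p})"
      by auto
    moreover have "open (\<Union>p\<in>{0<..}. {z :: real \<times> real. snd z + p * fst z < g p})"
      by (intro open_UN ballI open_Collect_less continuous_intros)
    moreover have "closed {z :: real \<times> real. 0 \<le> fst z}" "closed {z :: real \<times> real. 0 \<le> snd z}"
      by (intro closed_Collect_le continuous_intros)+
    ultimately show ?thesis by (simp only: sets.Int borel_open borel_closed)
  qed

text \<open>
  A vertical line at distance \<open>s\<close> meets the corner in a segment of length \<open>sup (g p - p s)\<close>, which by
  \<open>positive_part_integral\<close> is the integral of \<open>(right_slope g p - s)\<^sup>+\<close> over \<open>p > 0\<close>. Integrating over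
  \<open>s\<close> first turns the latter into \<open>(right_slope g p)\<^sup>2 / 2\<close>.
\<close>

lemma emeasure_corner:
  assumes g0: "g 0 = 0"
  shows "emeasure lborel {(s, t). 0 \<le> s \<and> 0 \<le> t \<and> (\<exists>p>0. t + p * s < g p)}
    = (\<integral>\<^sup>+p\<in>{0<..}. ennreal ((right_slope g p)\<^sup>2 / 2) \<partial>lborel)"
proof -
  let ?D = "{(s, t). 0 \<le> s \<and> 0 \<le> t \<and> (\<exists>p>0. t + p * s < g p)}"
  have D: "?D \<in> sets (borel :: (real \<times> real) measure)" by (rule corner_set_borel)
  have slice: "emeasure lborel (Pair s -` ?D) = 
      (\<integral>\<^sup>+p. ennreal (right_slope g p - s) * indicator {0<..} p * indicator {0..} s \<partial>lborel)" for s
  proof (cases "0 \<le> s")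
    case True
    have "Pair s -` ?D = {t. 0 \<le> t \<and> (\<exists>p>0. t < g p - p * s)}"
      using True by (auto simp: algebra_simps)
    then show ?thesis using True by (simp add: emeasure_below positive_part_integral[OF g0])
  qed (auto simp: vimage_def)
  have "emeasure lborel ?D = (\<integral>\<^sup>+s. emeasure lborel (Pair s -` ?D) \<partial>lborel)"
    using D by (simp add: lborel_prod[symmetric] borel_prod[symmetric] lborel.emeasure_pair_measure_alt)
  also have "\<dots> = (\<integral>\<^sup>+p. \<integral>\<^sup>+s. ennreal (right_slope g p - s) * indicator {0<..} p * indicator {0..} s \<partial>lborel \<partial>lborel)"
    unfolding slice by (rule lborel_pair.Fubini') measurable
  also have "\<dots> = (\<integral>\<^sup>+p\<in>{0<..}. ennreal ((right_slope g p)\<^sup>2 / 2) \<partial>lborel)"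
  proof (rule nn_integral_cong)
    fix p
    define x where "x = right_slope g p"
    have x: "0 \<le> x" by (simp add: x_def right_slope_bounds)
    have "((\<lambda>s. x - s) has_integral x\<^sup>2 - x\<^sup>2 / 2) {0..x}"
      using has_integral_const_real[of x 0 x] ident_has_integral[of 0 x] x
      by (intro has_integral_diff) (auto simp: power2_eq_square)
    then have "((\<lambda>s. if s \<in> {0..x} then x - s else 0) has_integral x\<^sup>2 / 2) UNIV"
      unfolding has_integral_restrict_UNIV by simp
    then have "(\<integral>\<^sup>+s. ennreal (if s \<in> {0..x} then x - s else 0) \<partial>lborel) = ennreal (x\<^sup>2 / 2)"
      by (intro nn_integral_has_integral_lborel) auto
    moreover have "(\<integral>\<^sup>+s. ennreal (if s \<in> {0..x} then x - s else 0) \<partial>lborel)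
        = (\<integral>\<^sup>+s. ennreal (x - s) * indicator {0..} s \<partial>lborel)"
      by (rule nn_integral_cong) (auto simp: indicator_def ennreal_neg)
    ultimately show "(\<integral>\<^sup>+s. ennreal (right_slope g p - s) * indicator {0<..} p * indicator {0..} s \<partial>lborel)
      = ennreal ((right_slope g p)\<^sup>2 / 2) * indicator {0<..} p"
      by (cases "0 < p") (auto simp: x_def)
  qed
  finally show ?thesis .
qed

end

section \<open>Sublinear functions on the plane\<close>

type_synonym plane = "real \<times> real"

definition sublinear :: "(plane \<Rightarrow> real) \<Rightarrow> bool" where
  "sublinear h \<longleftrightarrow> (\<forall>u v. h (u + v) \<le> h u + h v) \<and> (\<forall>r u. 0 \<le> r \<longrightarrow> h (r *\<^sub>R u) = r * h u)"

lemma sublinear_add: "sublinear h \<Longrightarrow> h (u + v) \<le> h u + h v"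
  and sublinear_scale: "sublinear h \<Longrightarrow> 0 \<le> r \<Longrightarrow> h (r *\<^sub>R u) = r * h u"
  unfolding sublinear_def by blast+

lemma sublinear_0: "sublinear h \<Longrightarrow> h 0 = 0"
  using sublinear_scale[of h 0 0] by simp

lemma sublinear_zero: "sublinear (\<lambda>_. 0)"
  by (simp add: sublinear_def)

lemma sublinear_plus: "sublinear h \<Longrightarrow> sublinear k \<Longrightarrow> sublinear (\<lambda>u. h u + k u)"
proof -
  assume h: "sublinear h" and k: "sublinear k"
  have "h (u + v) + k (u + v) \<le> (h u + k u) + (h v + k v)" for u v
    using sublinear_add[OF h, of u v] sublinear_add[OF k, of u v] by linarith
  then show ?thesis
    using sublinear_scale[OF h] sublinear_scale[OF k] by (simp add: sublinear_def distrib_left)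
qed

text \<open>
  A corner \<open>(a, b)\<close> of the bounding box is the one where the outer normals are \<open>(a, 0)\<close> and \<open>(0, b)\<close>.
\<close>

definition corners :: "plane set" where "corners = {1, -1} \<times> {1, -1}"

lemma finite_corners [simp]: "finite corners"
  by (simp add: corners_def)

lemma cornersE: 
  assumes "c \<in> corners" obtains a b where "c = (a, b)" "a = 1 \<or> a = -1" "b = 1 \<or> b = -1"
  using assms by (auto simp: corners_def)

definition width :: "(plane \<Rightarrow> real) \<Rightarrow> real" where
  "width h = h (1, 0) + h (-1, 0)"

definition height :: "(plane \<Rightarrow> real) \<Rightarrow> real" where
  "height h = h (0, 1) + h (0, -1)"

text \<open>
  With \<open>h\<close> the support function of \<open>K\<close>, and \<open>s = h (a, 0) - a x\<close> and \<open>t = h (0, b) - b y\<close> the distances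
  of a point from the sides of the box at the corner \<open>c = (a, b)\<close>, this is the minimum of \<open>t + p s\<close>
  over \<open>K\<close>.
\<close>

definition gap :: "plane \<Rightarrow> (plane \<Rightarrow> real) \<Rightarrow> real \<Rightarrow> real" where
  "gap c h p = p * h (fst c, 0) + h (0, snd c) - h (p * fst c, snd c)"

text \<open>
  The distance, from the vertical side at the corner \<open>c\<close>, of a point of contact with the supporting
  line whose outer normal is \<open>(p * fst c, snd c)\<close>.
\<close>

definition contact :: "plane \<Rightarrow> (plane \<Rightarrow> real) \<Rightarrow> real \<Rightarrow> real" where
  "contact c h = right_slope (gap c h)"

lemma gap_concave_increasing:
  assumes h: "sublinear h" and c: "c \<in> corners"
  shows "concave_increasing (gap c h) (width h)"
proof
  obtain a b where ab: "c = (a, b)" "a = 1 \<or> a = -1" "b = 1 \<or> b = -1" using c by (rule cornersE)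
  have "convex_on UNIV (\<lambda>p. - gap c h p)"
  proof (rule convex_onI)
    fix t x y :: real assume t: "0 < t" "t < 1"
    have "h ((1 - t) *\<^sub>R (x * a, b) + t *\<^sub>R (y * a, b)) \<le> (1 - t) * h (x * a, b) + t * h (y * a, b)"
      using sublinear_add[OF h, of "(1 - t) *\<^sub>R (x * a, b)" "t *\<^sub>R (y * a, b)"]
        sublinear_scale[OF h, of "1 - t" "(x * a, b)"] sublinear_scale[OF h, of t "(y * a, b)"] t by linarith
    moreover have "(1 - t) *\<^sub>R (x * a, b) + t *\<^sub>R (y * a, b) = (((1 - t) *\<^sub>R x + t *\<^sub>R y) * a, b)"
      by (simp add: algebra_simps)
    ultimately show "- gap c h ((1 - t) *\<^sub>R x + t *\<^sub>R y) \<le> (1 - t) * - gap c h x + t * - gap c h y"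
      by (simp add: gap_def ab algebra_simps)
  qed simp
  then show "concave_on UNIV (gap c h)" by (simp add: concave_on_def)
  fix p q :: real assume pq: "p \<le> q"
  have "h (q * a, b) \<le> h (p * a, b) + h ((q - p) *\<^sub>R (a, 0))"
    using sublinear_add[OF h, of "(p * a, b)" "(q - p) *\<^sub>R (a, 0)"] by (simp add: algebra_simps)
  then show "gap c h p \<le> gap c h q"
    using sublinear_scale[OF h, of "q - p" "(a, 0)"] pq by (simp add: gap_def ab algebra_simps)
  have "h (p * a, b) \<le> h (q * a, b) + h ((q - p) *\<^sub>R (-a, 0))"
    using sublinear_add[OF h, of "(q * a, b)" "(q - p) *\<^sub>R (-a, 0)"] by (simp add: algebra_simps)
  then have "gap c h q - gap c h p \<le> (h (a, 0) + h (-a, 0)) * (q - p)"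
    using sublinear_scale[OF h, of "q - p" "(-a, 0)"] pq by (simp add: gap_def ab algebra_simps)
  then show "gap c h q - gap c h p \<le> width h * (q - p)"
    using ab(2) by (auto simp: width_def add.commute)
qed

lemma gap_0 [simp]: "gap c h 0 = 0"
  by (simp add: gap_def)

lemma contact_bounds:
  assumes "sublinear h" "c \<in> corners"
  shows "0 \<le> contact c h p" "contact c h p \<le> width h"
  using concave_increasing.right_slope_bounds[OF gap_concave_increasing[OF assms]] by (auto simp: contact_def)

lemma contact_lim:
  assumes "sublinear h" "c \<in> corners"
  shows "(\<lambda>n. real (Suc n) * (gap c h (p + 1 / real (Suc n)) - gap c h p)) \<longlonglongrightarrow> contact c h p"
  using concave_increasing.right_slope_lim[OF gap_concave_increasing[OF assms]] by (simp add: contact_def)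

lemma contact_measurable:
  assumes "sublinear h" "c \<in> corners"
  shows "contact c h \<in> borel_measurable borel"
  using concave_increasing.right_slope_measurable[OF gap_concave_increasing[OF assms]] by (simp add: contact_def)

text \<open>
  Defining the contact function by a limit of expressions linear in \<open>h\<close> makes it additive without any
  choice of contact points.
\<close>

lemma contact_add:
  assumes h: "sublinear h" and k: "sublinear k" and c: "c \<in> corners"
  shows "contact c (\<lambda>u. h u + k u) p = contact c h p + contact c k p"
proof (rule LIMSEQ_unique)
  show "(\<lambda>n. real (Suc n) * (gap c (\<lambda>u. h u + k u) (p + 1 / real (Suc n)) - gap c (\<lambda>u. h u + k u) p))
    \<longlonglongrightarrow> contact c (\<lambda>u. h u + k u) p"
    by (rule contact_lim[OF sublinear_plus[OF h k] c])
  show "(\<lambda>n. real (Suc n) * (gap c (\<lambda>u. h u + k u) (p + 1 / real (Suc n)) - gap c (\<lambda>u. h u + k u) p))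
    \<longlonglongrightarrow> contact c h p + contact c k p"
    using tendsto_add[OF contact_lim[OF h c] contact_lim[OF k c], of p p]
    by (simp add: gap_def algebra_simps)
qed

section \<open>Support functions of planar convex bodies\<close>

text \<open>
  The value \<open>0\<close> for the empty set is again sublinear. With it the support functions of the slices of
  a body form a family over the whole line, vanishing outside the base of the body.
\<close>

definition support_fn :: "plane set \<Rightarrow> plane \<Rightarrow> real" where
  "support_fn K u = (if K = {} then 0 else Sup ((\<lambda>z. inner z u) ` K))"

lemma support_fn_attained:
  assumes "compact K" "K \<noteq> {}"
  obtains z where "z \<in> K" "inner z u = support_fn K u" "\<And>y. y \<in> K \<Longrightarrow> inner y u \<le> support_fn K u"
proof -
  have "continuous_on K (\<lambda>z. inner z u)" by (intro continuous_intros)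
  then obtain z where z: "z \<in> K" "\<And>y. y \<in> K \<Longrightarrow> inner y u \<le> inner z u"
    using continuous_attains_sup[OF assms] by blast
  then have "Sup ((\<lambda>z. inner z u) ` K) = inner z u"
    by (intro cSup_eq_maximum) auto
  then show ?thesis using that[of z] z assms(2) by (simp add: support_fn_def)
qed

lemma support_fn_upper: "compact K \<Longrightarrow> z \<in> K \<Longrightarrow> inner z u \<le> support_fn K u"
proof -
  assume K: "compact K" and z: "z \<in> K"
  then have "K \<noteq> {}" by blast
  from support_fn_attained[OF K this, of u] z show ?thesis by blast
qed

lemma support_fn_leI:
  assumes "compact K" "K \<noteq> {}" "\<And>z. z \<in> K \<Longrightarrow> inner z u \<le> r"
  shows "support_fn K u \<le> r"
proof -
  obtain z where "z \<in> K" "inner z u = support_fn K u" using support_fn_attained[OF assms(1,2)] by blast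
  then show ?thesis using assms(3) by metis
qed

lemma support_fn_eqI:
  assumes "compact K" "z \<in> K" "\<And>y. y \<in> K \<Longrightarrow> inner y u \<le> r" "inner z u = r"
  shows "support_fn K u = r"
proof (rule antisym)
  show "support_fn K u \<le> r" using assms(2,3) by (intro support_fn_leI[OF assms(1)]) auto
  show "r \<le> support_fn K u" using support_fn_upper[OF assms(1,2), of u] assms(4) by simp
qed

lemma sublinear_support_fn:
  assumes "compact K" shows "sublinear (support_fn K)"
proof (cases "K = {}")
  case True
  then show ?thesis by (simp add: support_fn_def[abs_def] sublinear_zero)
next
  case False
  note ne = False
  show ?thesis unfolding sublinear_def
  proof (intro conjI allI impI)
    fix u v
    show "support_fn K (u + v) \<le> support_fn K u + support_fn K v"
      by (rule support_fn_leI[OF assms ne]) (simp add: inner_add_right add_mono support_fn_upper assms)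
  next
    fix r :: real and u :: plane assume r: "0 \<le> r"
    obtain z where z: "z \<in> K" "inner z u = support_fn K u" "\<And>y. y \<in> K \<Longrightarrow> inner y u \<le> support_fn K u"
      using support_fn_attained[OF assms ne] by blast
    show "support_fn K (r *\<^sub>R u) = r * support_fn K u"
      by (rule support_fn_eqI[OF assms z(1)]) (use z r in \<open>auto simp: mult_left_mono\<close>)
  qed
qed

lemma support_fn_plus:
  assumes "compact K" "K \<noteq> {}" "compact L" "L \<noteq> {}"
  shows "support_fn (K + L) u = support_fn K u + support_fn L u"
proof -
  have KL: "compact (K + L)" by (rule compact_set_plus[OF assms(1,3)])
  obtain y where y: "y \<in> K" "inner y u = support_fn K u" 
    using support_fn_attained[OF assms(1,2)] by blast
  obtain z where z: "z \<in> L" "inner z u = support_fn L u" 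
    using support_fn_attained[OF assms(3,4)] by blast
  show ?thesis
  proof (rule support_fn_eqI[OF KL, of "y + z"])
    show "y + z \<in> K + L" using y z by auto
    show "inner (y + z) u = support_fn K u + support_fn L u" by (simp add: inner_add_left y z)
    show "inner w u \<le> support_fn K u + support_fn L u" if "w \<in> K + L" for w
    proof -
      obtain x y where "w = x + y" "x \<in> K" "y \<in> L" using \<open>w \<in> K + L\<close> by (rule set_plus_elim)
      then show ?thesis by (simp only: inner_add_left) (intro add_mono support_fn_upper assms)
    qed
  qed
qed

lemma outside_support_fn:
  assumes "compact K" "convex K" "K \<noteq> {}" "z \<notin> K"
  obtains u where "support_fn K u < inner z u"
proof -
  obtain a b where ab: "inner a z < b" "\<And>x. x \<in> K \<Longrightarrow> b < inner a x"
    using separating_hyperplane_closed_point[of K z] assms compact_imp_closed by blast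
  obtain y where y: "y \<in> K" "inner y (- a) = support_fn K (- a)"
    using support_fn_attained[OF assms(1,3)] by blast
  have "support_fn K (- a) < inner z (- a)"
    using ab(1) ab(2)[OF y(1)] y(2) by (simp add: inner_commute)
  then show ?thesis by (rule that)
qed

section \<open>The area of a planar convex body\<close>

text \<open>
  The points of the quadrant at the corner \<open>c\<close> that are cut off by some supporting line whose outer
  normal points strictly into that corner.
\<close>

definition corner_region :: "plane \<Rightarrow> (plane \<Rightarrow> real) \<Rightarrow> plane set" where
  "corner_region c h = {(x, y). fst c * x \<le> h (fst c, 0) \<and> snd c * y \<le> h (0, snd c) \<and>
     (\<exists>p>0. h (p * fst c, snd c) < p * fst c * x + snd c * y)}"

lemma corner_region_borel: "corner_region c h \<in> sets borel"
proof -
  have "corner_region c h = {z. fst c * fst z \<le> h (fst c, 0)} \<inter> {z. snd c * snd z \<le> h (0, snd c)} \<inter>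
     (\<Union>p\<in>{0<..}. {z. h (p * fst c, snd c) < p * fst c * fst z + snd c * snd z})"
    by (auto simp: corner_region_def)
  moreover have 1: "open (\<Union>p\<in>{0<..}. {z. h (p * fst c, snd c) < p * fst c * fst z + snd c * snd z})"
    by (intro open_UN ballI open_Collect_less continuous_intros)
  moreover have 2: "closed {z. fst c * fst z \<le> h (fst c, 0)}" and 3: "closed {z. snd c * snd z \<le> h (0, snd c)}"
    by (intro closed_Collect_le continuous_intros)+
  ultimately show ?thesis
    using sets.Int[OF sets.Int[OF borel_closed[OF 2] borel_closed[OF 3]] borel_open[OF 1]] by (simp only:)
qed

lemma emeasure_corner_region:
  assumes h: "sublinear h" and c: "c \<in> corners"
  shows "emeasure lborel (corner_region c h) = (\<integral>\<^sup>+p\<in>{0<..}. ennreal ((contact c h p)\<^sup>2 / 2) \<partial>lborel)"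
proof -
  interpret concave_increasing "gap c h" "width h" by (rule gap_concave_increasing[OF h c])
  obtain a b where ab: "c = (a, b)" "a = 1 \<or> a = -1" "b = 1 \<or> b = -1" using c by (rule cornersE)
  let ?D = "{(s, t). 0 \<le> s \<and> 0 \<le> t \<and> (\<exists>p>0. t + p * s < gap c h p)}"
  define T :: "plane \<Rightarrow> plane" where "T = (\<lambda>z. (h (a, 0) - a * fst z, h (0, b) - b * snd z))"
  have aa: "a * a = 1" "b * b = 1" "\<bar>a\<bar> = 1" "\<bar>b\<bar> = 1" using ab by auto
  \<comment> \<open>\<open>T\<close> maps the corner to the origin and the box into the first quadrant\<close>
  have T: "distr lborel borel T = (lborel :: plane measure)"
  proof -
    have T_eq: "T = (\<lambda>x. (h (a, 0), h (0, b)) + (\<Sum>j\<in>Basis. ((if j = (1, 0) then - a else - b) * inner x j) *\<^sub>R j))"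
      by (rule ext) (auto simp: T_def Basis_prod_def sum.union_disjoint sum.reindex inj_on_def)
    have "(lborel :: plane measure) = density (distr lborel borel T) (\<lambda>_. (\<Prod>j\<in>(Basis :: plane set). \<bar>if j = (1, 0) then - a else - b\<bar>))"
      unfolding T_eq using aa by (intro lborel_affine_euclidean) auto
    also have "(\<Prod>j\<in>(Basis :: plane set). \<bar>if j = (1, 0) then - a else - b\<bar>) = 1"
      using aa by (intro prod.neutral) auto
    finally show ?thesis by (simp add: density_1)
  qed
  have vimage: "T -` ?D = corner_region c h"
    by (auto simp: T_def corner_region_def ab(1) gap_def algebra_simps)
  have D: "?D \<in> sets (borel :: plane measure)" by (rule corner_set_borel)
  have "emeasure lborel ?D = emeasure (distr lborel borel T) ?D" by (simp only: T)
  also have "\<dots> = emeasure lborel (T -` ?D \<inter> space lborel)"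
    using D by (intro emeasure_distr) (auto simp: T_def intro!: borel_measurable_continuous_onI continuous_intros)
  finally have "emeasure lborel ?D = emeasure lborel (corner_region c h)"
    by (simp only: vimage space_lborel space_borel Int_UNIV_right)
  then show ?thesis using emeasure_corner[OF gap_0] by (simp add: contact_def)
qed

text \<open>
  For two different corners a suitable positive combination of the two cutting normals is parallel to
  an axis. A point beyond both lines would then lie beyond a side of the bounding box.
\<close>

lemma corner_region_disjoint:
  assumes h: "sublinear h" and cd: "c \<in> corners" "d \<in> corners" "c \<noteq> d"
  shows "corner_region c h \<inter> corner_region d h = {}"
proof -
  obtain a b where ab: "c = (a, b)" "a = 1 \<or> a = -1" "b = 1 \<or> b = -1" using cd(1) by (rule cornersE)
  obtain a' b' where ab': "d = (a', b')" "a' = 1 \<or> a' = -1" "b' = 1 \<or> b' = -1" using cd(2) by (rule cornersE)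
  have False if xy: "(x, y) \<in> corner_region c h" "(x, y) \<in> corner_region d h" for x y
  proof -
    obtain p where p: "0 < p" "h (p * a, b) < p * a * x + b * y" and cx: "a * x \<le> h (a, 0)" "b * y \<le> h (0, b)"
      using xy(1) by (auto simp: corner_region_def ab)
    obtain q where q: "0 < q" "h (q * a', b') < q * a' * x + b' * y" and dx: "a' * x \<le> h (a', 0)" "b' * y \<le> h (0, b')"
      using xy(2) by (auto simp: corner_region_def ab')
    have sum: "h (s * (p * a) + t * (q * a'), s * b + t * b') < (s * (p * a) + t * (q * a')) * x + (s * b + t * b') * y"
      if "0 < s" "0 < t" for s t
    proof -
      have "h (s *\<^sub>R (p * a, b) + t *\<^sub>R (q * a', b')) \<le> s * h (p * a, b) + t * h (q * a', b')"
        using sublinear_add[OF h, of "s *\<^sub>R (p * a, b)" "t *\<^sub>R (q * a', b')"]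
          sublinear_scale[OF h, of s "(p * a, b)"] sublinear_scale[OF h, of t "(q * a', b')"] that by linarith
      also have "\<dots> < s * (p * a * x + b * y) + t * (q * a' * x + b' * y)"
        using that p(2) q(2) by (intro add_strict_mono mult_strict_left_mono)
      finally show ?thesis by (simp add: algebra_simps)
    qed
    have axis1: "s * a * x \<le> h (s * a, 0)" "s * a' * x \<le> h (s * a', 0)" if "0 \<le> s" for s
      using sublinear_scale[OF h that, of "(a, 0)"] sublinear_scale[OF h that, of "(a', 0)"] mult_left_mono[OF cx(1) that] mult_left_mono[OF dx(1) that]
      by (simp_all add: mult.assoc)
    have axis2: "s * b * y \<le> h (0, s * b)" if "0 \<le> s" for s
      using sublinear_scale[OF h that, of "(0, b)"] mult_left_mono[OF cx(2) that]
      by (simp_all add: mult.assoc)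
    consider "a = a'" "b' = - b" | "a' = - a" "b = b'" | "a' = - a" "b' = - b"
      using ab ab' cd(3) by force
    then show False
    proof cases
      case 1
      then show False using sum[of 1 1] axis1(1)[of "p + q"] p(1) q(1) by (simp add: algebra_simps)
    next
      case 2
      then show False using sum[of q p] axis2[of "p + q"] p(1) q(1) by (simp add: algebra_simps)
    next
      case 3
      then show False using sum[of 1 1] axis1(1)[of "p - q"] axis1(2)[of "q - p"] p(1) q(1)
        by (cases "q \<le> p") (simp_all add: algebra_simps)
    qed
  qed
  then show ?thesis by auto
qed

definition bounding_box :: "(plane \<Rightarrow> real) \<Rightarrow> plane set" where
  "bounding_box h = {- h (-1, 0)..h (1, 0)} \<times> {- h (0, -1)..h (0, 1)}"

lemma corner_region_subset_box:
  assumes h: "sublinear h" and c: "c \<in> corners"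
  shows "corner_region c h \<subseteq> bounding_box h"
proof clarify
  fix x y assume xy: "(x, y) \<in> corner_region c h"
  obtain a b where ab: "c = (a, b)" "a = 1 \<or> a = -1" "b = 1 \<or> b = -1" using c by (rule cornersE)
  obtain p where p: "0 < p" "h (p * a, b) < p * a * x + b * y" and cx: "a * x \<le> h (a, 0)" "b * y \<le> h (0, b)"
    using xy by (auto simp: corner_region_def ab)
  have "h (0, b) \<le> h (p * a, b) + p * h (- a, 0)"
    using sublinear_add[OF h, of "(p * a, b)" "p *\<^sub>R (- a, 0)"] sublinear_scale[OF h, of p "(- a, 0)"] p(1) by simp
  then have "p * (- (a * x)) < p * h (- a, 0)" using p(2) cx(2) by (simp add: algebra_simps)
  then have 1: "- (a * x) < h (- a, 0)" using p(1) by (simp only: mult_less_cancel_left_pos)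
  have "p * h (a, 0) \<le> h (p * a, b) + h (0, - b)"
    using sublinear_add[OF h, of "(p * a, b)" "(0, - b)"] sublinear_scale[OF h, of p "(a, 0)"] p(1) by simp
  moreover have "p * (a * x) \<le> p * h (a, 0)" using p(1) cx(1) by (intro mult_left_mono) auto
  ultimately have 2: "- (b * y) < h (0, - b)" using p(2) by (simp add: algebra_simps)
  show "(x, y) \<in> bounding_box h"
    using ab(2,3) cx 1 2 by (auto simp: bounding_box_def)
qed

lemma emeasure_bounding_box:
  assumes "sublinear h"
  shows "0 \<le> width h" "0 \<le> height h" "emeasure lborel (bounding_box h) = ennreal (width h * height h)"
proof -
  show w: "0 \<le> width h" and ht: "0 \<le> height h"
    using sublinear_add[OF assms, of "(1, 0)" "(-1, 0)"] sublinear_add[OF assms, of "(0, 1)" "(0, -1)"]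
      sublinear_0[OF assms] by (simp_all add: width_def height_def zero_prod_def)
  have "emeasure lborel (bounding_box h) = emeasure lborel {- h (-1, 0)..h (1, 0)} * emeasure lborel {- h (0, -1)..h (0, 1)}"
    unfolding bounding_box_def lborel_prod[symmetric] by (rule lborel.emeasure_pair_measure_Times) auto
  also have "\<dots> = ennreal (width h) * ennreal (height h)"
    using w ht by (simp add: width_def height_def add.commute)
  finally show "emeasure lborel (bounding_box h) = ennreal (width h * height h)"
    using w ht by (simp add: ennreal_mult)
qed

text \<open>
  A point of the box outside \<open>K\<close> is separated from \<open>K\<close> by a line. The normal of that line is not
  parallel to an axis, because the sides of the box support \<open>K\<close>; so it points into one of the corners.
\<close>

lemma box_decomposition:
  assumes K: "compact K" "convex K" "K \<noteq> {}"
  defines "h \<equiv> support_fn K"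
  shows "bounding_box h = K \<union> (\<Union>c\<in>corners. corner_region c h)"
    and "c \<in> corners \<Longrightarrow> K \<inter> corner_region c h = {}"
proof -
  have h: "sublinear h" unfolding h_def by (rule sublinear_support_fn[OF K(1)])
  have up: "x * u + y * v \<le> h (u, v)" if "(x, y) \<in> K" for x y u v
    using support_fn_upper[OF K(1) that, of "(u, v)"] by (simp add: h_def)
  show "K \<inter> corner_region c h = {}" if "c \<in> corners"
  proof -
    have False if z: "(x, y) \<in> K" "(x, y) \<in> corner_region c h" for x y
    proof -
      obtain p where "h (p * fst c, snd c) < p * fst c * x + snd c * y"
        using z(2) by (auto simp: corner_region_def)
      then show False using up[OF z(1), of "p * fst c" "snd c"] by (simp add: mult.commute)
    qed
    then show ?thesis by auto
  qed
  show "bounding_box h = K \<union> (\<Union>c\<in>corners. corner_region c h)"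
  proof
    have "K \<subseteq> bounding_box h"
      using up[of _ _ 1 0] up[of _ _ "-1" 0] up[of _ _ 0 1] up[of _ _ 0 "-1"]
      by (force simp: bounding_box_def)
    then show "K \<union> (\<Union>c\<in>corners. corner_region c h) \<subseteq> bounding_box h"
      using corner_region_subset_box[OF h] by blast
    show "bounding_box h \<subseteq> K \<union> (\<Union>c\<in>corners. corner_region c h)"
    proof clarify
      fix x y assume xy: "(x, y) \<in> bounding_box h" and none: "(x, y) \<notin> (\<Union>c\<in>corners. corner_region c h)"
      have box: "a * x \<le> h (a, 0)" "b * y \<le> h (0, b)" if "a = 1 \<or> a = -1" "b = 1 \<or> b = -1" for a b
        using xy that by (auto simp: bounding_box_def)
      show "(x, y) \<in> K"
      proof (rule ccontr)
        assume "(x, y) \<notin> K"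
        then obtain u where "support_fn K u < inner (x, y) u"
          using outside_support_fn[OF K] by blast
        then obtain m n where mn: "h (m, n) < m * x + n * y"
          by (cases u) (auto simp: h_def mult.commute)
        define a :: real where "a = (if 0 \<le> m then 1 else -1)"
        define b :: real where "b = (if 0 \<le> n then 1 else -1)"
        have ab: "a = 1 \<or> a = -1" "b = 1 \<or> b = -1" "m = \<bar>m\<bar> * a" "n = \<bar>n\<bar> * b" "(a, b) \<in> corners"
          by (auto simp: a_def b_def corners_def)
        have m: "m \<noteq> 0"
        proof
          assume "m = 0"
          then have "h (\<bar>n\<bar> *\<^sub>R (0, b)) < \<bar>n\<bar> * (b * y)" using mn ab(4) by simp (metis mult.assoc)
          then have "h (0, b) < b * y" using sublinear_scale[OF h, of "\<bar>n\<bar>" "(0, b)"] by (simp add: mult_less_cancel_left)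
          then show False using box(2)[OF ab(1,2)] by simp
        qed
        have n: "n \<noteq> 0"
        proof
          assume "n = 0"
          then have "h (\<bar>m\<bar> *\<^sub>R (a, 0)) < \<bar>m\<bar> * (a * x)" using mn ab(3) by simp (metis mult.assoc)
          then have "h (a, 0) < a * x" using sublinear_scale[OF h, of "\<bar>m\<bar>" "(a, 0)"] by (simp add: mult_less_cancel_left)
          then show False using box(1)[OF ab(1,2)] by simp
        qed
        define p where "p = \<bar>m\<bar> / \<bar>n\<bar>"
        have p: "0 < p" "\<bar>n\<bar> * p = \<bar>m\<bar>" using m n by (auto simp: p_def)
        have "\<bar>n\<bar> *\<^sub>R (p * a, b) = (m, n)"
          using ab(3,4) p(2) by (simp add: mult.assoc[symmetric])
        then have "\<bar>n\<bar> * h (p * a, b) = h (m, n)"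
          using sublinear_scale[OF h, of "\<bar>n\<bar>" "(p * a, b)"] by simp
        also have "\<dots> < \<bar>m\<bar> * a * x + \<bar>n\<bar> * b * y" using mn ab(3,4) by simp
        also have "\<dots> = \<bar>n\<bar> * (p * a * x + b * y)" by (simp add: p(2)[symmetric] algebra_simps)
        finally have "h (p * a, b) < p * a * x + b * y" by (simp add: mult_less_cancel_left)
        then have "(x, y) \<in> corner_region (a, b) h"
          using box[OF ab(1,2)] p(1) by (auto simp: corner_region_def)
        then show False using none ab(5) by blast
      qed
    qed
  qed
qed

lemma emeasure_box_minus_corners:
  assumes K: "compact K" "convex K" "K \<noteq> {}"
  defines "h \<equiv> support_fn K"
  shows "ennreal (width h * height h) =
    emeasure lborel K + (\<Sum>c\<in>corners. \<integral>\<^sup>+p\<in>{0<..}. ennreal ((contact c h p)\<^sup>2 / 2) \<partial>lborel)"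
proof -
  have h: "sublinear h" unfolding h_def by (rule sublinear_support_fn[OF K(1)])
  note dec = box_decomposition[OF K, folded h_def]
  have "ennreal (width h * height h) = emeasure lborel (K \<union> (\<Union>c\<in>corners. corner_region c h))"
    using emeasure_bounding_box(3)[OF h] dec(1) by simp
  also have "\<dots> = emeasure lborel K + emeasure lborel (\<Union>c\<in>corners. corner_region c h)"
    using dec(2) K(1) by (intro plus_emeasure[symmetric] sets.finite_UN) (auto simp: corner_region_borel borel_compact)
  also have "emeasure lborel (\<Union>c\<in>corners. corner_region c h) = (\<Sum>c\<in>corners. emeasure lborel (corner_region c h))"
    using corner_region_disjoint[OF h]
    by (intro sum_emeasure[symmetric]) (auto simp: corner_region_borel disjoint_family_on_def)
  finally show ?thesis by (simp add: emeasure_corner_region[OF h])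
qed

section \<open>Sublinear functions are support functions\<close>

lemma sublinear_multiple_le:
  assumes "sublinear h" shows "s * h u \<le> h (s *\<^sub>R u)"
proof (cases "0 \<le> s")
  case False
  then have "h (s *\<^sub>R u) = - s * h (- u)"
    using sublinear_scale[OF assms, of "- s" "- u"] by simp
  moreover have "0 \<le> h u + h (- u)"
    using sublinear_add[OF assms, of u "- u"] sublinear_0[OF assms] by simp
  then have "0 \<le> - s * (h u + h (- u))" using False by (intro mult_nonneg_nonneg) auto
  ultimately show ?thesis by (simp add: algebra_simps)
qed (simp add: sublinear_scale[OF assms])

text \<open>
  The Hahn-Banach theorem in the plane: the functional is prescribed on \<open>w\<close> and has to be extended to
  the orthogonal vector \<open>v\<close>.
\<close>

lemma sublinear_supporting_point:
  assumes h: "sublinear h"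
  obtains z where "\<And>u. inner z u \<le> h u" "inner z w = h w"
proof -
  have "\<exists>z. (\<forall>u. inner z u \<le> h u) \<and> inner z w = h w" if w: "w \<noteq> 0" for w
  proof -
    define v :: plane where "v = (- snd w, fst w)"
    define r where "r = inner w w"
    have r: "r > 0" using w by (simp add: r_def)
    have v: "inner v v = r" "inner w v = 0" "inner v w = 0"
      by (simp_all add: v_def r_def inner_prod_def)
    have cross: "s * h w - h (s *\<^sub>R w - v) \<le> h (t *\<^sub>R w + v) - t * h w" for s t
    proof -
      have "(s + t) * h w \<le> h ((s *\<^sub>R w - v) + (t *\<^sub>R w + v))"
        using sublinear_multiple_le[OF h, of "s + t" w] by (simp add: algebra_simps)
      also have "\<dots> \<le> h (s *\<^sub>R w - v) + h (t *\<^sub>R w + v)" by (rule sublinear_add[OF h])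
      finally show ?thesis by (simp add: algebra_simps)
    qed
    \<comment> \<open>the least value at \<open>v\<close> compatible with the bounds at \<open>s w - v\<close>; by \<open>cross\<close> it respects those at \<open>t w + v\<close>\<close>
    define c where "c = (SUP s. s * h w - h (s *\<^sub>R w - v))"
    have "bdd_above (range (\<lambda>s. s * h w - h (s *\<^sub>R w - v)))"
      using cross[of _ 0] by (auto intro!: bdd_aboveI)
    then have lower: "s * h w - h (s *\<^sub>R w - v) \<le> c" for s
      unfolding c_def by (intro cSUP_upper) auto
    have upper: "c \<le> h (t *\<^sub>R w + v) - t * h w" for t
      unfolding c_def using cross by (intro cSUP_least) auto
    have comb: "s * h w + t * c \<le> h (s *\<^sub>R w + t *\<^sub>R v)" for s t
    proof -
      consider "t = 0" | "t > 0" | "t < 0" by linarith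
      then show ?thesis
      proof cases
        case 1
        then show ?thesis using sublinear_multiple_le[OF h] by simp
      next
        case 2
        have "t * (s / t * h w + c) \<le> t * h ((s / t) *\<^sub>R w + v)"
          using 2 upper[of "s / t"] by (intro mult_left_mono) auto
        also have "\<dots> = h (t *\<^sub>R ((s / t) *\<^sub>R w + v))" using 2 sublinear_scale[OF h, of t] by simp
        finally show ?thesis using 2 by (simp add: algebra_simps)
      next
        case 3
        have "- t * (s / - t * h w - c) \<le> - t * h ((s / - t) *\<^sub>R w - v)"
          using 3 lower[of "s / - t"] by (intro mult_left_mono) auto
        also have "\<dots> = h (- t *\<^sub>R ((s / - t) *\<^sub>R w - v))" using 3 sublinear_scale[OF h, of "- t"] by simp
        finally show ?thesis using 3 by (simp add: algebra_simps)
      qed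
    qed
    define z where "z = (h w / r) *\<^sub>R w + (c / r) *\<^sub>R v"
    have zw: "inner z w = h w" using r v by (simp add: z_def inner_add_left r_def[symmetric])
    have zv: "inner z v = c" using r v by (simp add: z_def inner_add_left)
    have "inner z u \<le> h u" for u
    proof -
      have u: "u = (inner u w / r) *\<^sub>R w + (inner u v / r) *\<^sub>R v"
      proof -
        have "r *\<^sub>R u = inner u w *\<^sub>R w + inner u v *\<^sub>R v"
          by (cases u; cases w) (simp add: r_def v_def inner_prod_def algebra_simps)
        then have "(1 / r) *\<^sub>R (r *\<^sub>R u) = (1 / r) *\<^sub>R (inner u w *\<^sub>R w + inner u v *\<^sub>R v)" by simp
        then show ?thesis using r by (simp add: scaleR_add_right)
      qed
      have "inner z u = (inner u w / r) * h w + (inner u v / r) * c"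
        by (subst u) (simp add: inner_add_right zw zv)
      also have "\<dots> \<le> h u" using comb[of "inner u w / r" "inner u v / r"] u by simp
      finally show ?thesis .
    qed
    then show ?thesis using zw by blast
  qed
  then have "\<exists>z. (\<forall>u. inner z u \<le> h u) \<and> inner z w = h w" if "w \<noteq> 0" using that by blast
  moreover have "\<exists>z. (\<forall>u. inner z u \<le> h u) \<and> inner z w = h w" if "w = 0"
    using \<open>\<And>w. w \<noteq> 0 \<Longrightarrow> _\<close>[of "(1, 0)"] that sublinear_0[OF h] by (auto simp: zero_prod_def)
  ultimately show ?thesis using that by blast
qed

text \<open>
  This lets facts about areas be used for sublinear functions that do not come from a given body.
\<close>

lemma sublinear_is_support_fn:
  assumes h: "sublinear h"
  obtains K where "compact K" "convex K" "K \<noteq> {}" "support_fn K = h"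
proof
  define K where "K = {z. \<forall>u. inner z u \<le> h u}"
  have eq: "K = (\<Inter>u. {z. inner z u \<le> h u})" by (auto simp: K_def)
  have "closed K" unfolding eq
    by (intro closed_INT ballI closed_Collect_le continuous_intros)
  moreover have "K \<subseteq> bounding_box h"
  proof clarify
    fix x y assume "(x, y) \<in> K"
    then have "x * u + y * v \<le> h (u, v)" for u v by (auto simp: K_def)
    from this[of 1 0] this[of "-1" 0] this[of 0 1] this[of 0 "-1"]
    show "(x, y) \<in> bounding_box h" by (auto simp: bounding_box_def)
  qed
  then have "bounded K"
    by (rule bounded_subset[rotated]) (auto simp: bounding_box_def intro!: bounded_Times)
  ultimately show c: "compact K" by (simp add: compact_eq_bounded_closed)
  have half: "{z. inner z u \<le> h u} = {z. inner u z \<le> h u}" for u by (simp add: inner_commute)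
  show "convex K" unfolding eq half by (intro convex_INT convex_halfspace_le)
  show "K \<noteq> {}" 
  proof -
    obtain z where "\<And>u. inner z u \<le> h u" using sublinear_supporting_point[OF h, of 0] by blast
    then have "z \<in> K" by (simp add: K_def del: split_paired_All)
    then show ?thesis by blast
  qed
  show "support_fn K = h"
  proof
    fix u
    obtain z where z: "\<And>u. inner z u \<le> h u" "inner z u = h u"
      using sublinear_supporting_point[OF h] by blast
    show "support_fn K u = h u"
    proof (rule support_fn_eqI[OF c, of z])
      show "z \<in> K" unfolding K_def using z(1) by blast
      show "inner y u \<le> h u" if "y \<in> K" for y using that unfolding K_def by blast
    qed (rule z(2))
  qed
qed

section \<open>Mixed area and its Minkowski inequality\<close>

text \<open>
  The four corner regions of a body with support function \<open>h\<close> fit into its bounding box.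
\<close>

lemma contact_square_finite:
  assumes h: "sublinear h" and c: "c \<in> corners"
  shows "(\<integral>\<^sup>+p\<in>{0<..}. ennreal ((contact c h p)\<^sup>2 / 2) \<partial>lborel) < \<infinity>"
proof -
  obtain K where K: "compact K" "convex K" "K \<noteq> {}" "support_fn K = h"
    using sublinear_is_support_fn[OF h] by blast
  have "(\<integral>\<^sup>+p\<in>{0<..}. ennreal ((contact c h p)\<^sup>2 / 2) \<partial>lborel)
      \<le> (\<Sum>c\<in>corners. \<integral>\<^sup>+p\<in>{0<..}. ennreal ((contact c h p)\<^sup>2 / 2) \<partial>lborel)"
    using c by (intro member_le_sum) auto
  also have "\<dots> \<le> ennreal (width h * height h)"
    using emeasure_box_minus_corners[OF K(1-3)] K(4) by simp
  finally show ?thesis by (rule order.strict_trans1) simp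
qed

lemma contact_square_integrable:
  assumes h: "sublinear h" and c: "c \<in> corners"
  shows "set_integrable lborel {0<..} (\<lambda>p. (contact c h p)\<^sup>2)"
proof -
  note [measurable] = contact_measurable[OF h c]
  have "(\<integral>\<^sup>+p. ennreal (norm (indicator {0<..} p *\<^sub>R ((contact c h p)\<^sup>2 / 2))) \<partial>lborel)
    = (\<integral>\<^sup>+p\<in>{0<..}. ennreal ((contact c h p)\<^sup>2 / 2) \<partial>lborel)"
    by (intro nn_integral_cong) (auto simp: indicator_def)
  then have "integrable lborel (\<lambda>p. indicator {0<..} p *\<^sub>R ((contact c h p)\<^sup>2 / 2))"
    using contact_square_finite[OF h c] by (intro integrableI_bounded) auto
  then have "set_integrable lborel {0<..} (\<lambda>p. (contact c h p)\<^sup>2 / 2)"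
    by (simp add: set_integrable_def)
  from set_integrable_mult_right[OF this, of 2] show ?thesis by simp
qed

lemma contact_product_integrable:
  assumes h: "sublinear h" and k: "sublinear k" and c: "c \<in> corners"
  shows "set_integrable lborel {0<..} (\<lambda>p. contact c h p * contact c k p)"
proof -
  note [measurable] = contact_measurable[OF h c] contact_measurable[OF k c]
  have "set_integrable lborel {0<..} (\<lambda>p. (contact c h p)\<^sup>2 + (contact c k p)\<^sup>2)"
    by (intro set_integral_add contact_square_integrable assms)
  then show ?thesis
  proof (rule set_integrable_bound)
    show "set_borel_measurable lborel {0<..} (\<lambda>p. contact c h p * contact c k p)"
      by (simp add: set_borel_measurable_def)
    show "AE p\<in>{0<..} in lborel. norm (contact c h p * contact c k p) \<le> norm ((contact c h p)\<^sup>2 + (contact c k p)\<^sup>2)"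
    proof (intro AE_I2 impI)
      fix p
      have "\<bar>x * y\<bar> \<le> x\<^sup>2 + y\<^sup>2" for x y :: real
      proof -
        have "0 \<le> (\<bar>x\<bar> - \<bar>y\<bar>)\<^sup>2" "0 \<le> x\<^sup>2 + y\<^sup>2" "0 \<le> \<bar>x * y\<bar>" by simp_all
        moreover have "(\<bar>x\<bar> - \<bar>y\<bar>)\<^sup>2 = x\<^sup>2 + y\<^sup>2 - 2 * \<bar>x * y\<bar>" by (simp add: power2_diff abs_mult)
        ultimately show ?thesis by linarith
      qed
      then show "norm (contact c h p * contact c k p) \<le> norm ((contact c h p)\<^sup>2 + (contact c k p)\<^sup>2)"
        by simp
    qed
  qed
qed

definition pairing :: "plane \<Rightarrow> (plane \<Rightarrow> real) \<Rightarrow> (plane \<Rightarrow> real) \<Rightarrow> real" where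
  "pairing c h k = (LINT p:{0<..}|lborel. contact c h p * contact c k p)"

text \<open>
  Twice the mixed area of the bodies with support functions \<open>h\<close> and \<open>k\<close>, by polarization of the formula
  in \<open>emeasure_box_minus_corners\<close>.
\<close>

definition mixed_form :: "(plane \<Rightarrow> real) \<Rightarrow> (plane \<Rightarrow> real) \<Rightarrow> real" where
  "mixed_form h k = width h * height k + width k * height h - (\<Sum>c\<in>corners. pairing c h k)"

lemma pairing_commute: "pairing c h k = pairing c k h"
  by (simp add: pairing_def mult.commute)

lemma mixed_form_commute: "mixed_form h k = mixed_form k h"
  by (simp add: mixed_form_def pairing_commute)

lemma pairing_add:
  assumes "sublinear h" "sublinear h'" "sublinear k" "c \<in> corners"
  shows "pairing c (\<lambda>u. h u + h' u) k = pairing c h k + pairing c h' k"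
  unfolding pairing_def
  by (subst set_integral_add(2)[symmetric])
     (simp_all add: contact_add contact_product_integrable assms distrib_right)

lemma mixed_form_add:
  assumes "sublinear h" "sublinear h'" "sublinear k"
  shows "mixed_form (\<lambda>u. h u + h' u) k = mixed_form h k + mixed_form h' k"
proof -
  have "(\<Sum>c\<in>corners. pairing c (\<lambda>u. h u + h' u) k) = (\<Sum>c\<in>corners. pairing c h k) + (\<Sum>c\<in>corners. pairing c h' k)"
    by (simp add: pairing_add assms sum.distrib[symmetric] cong: sum.cong)
  then show ?thesis by (simp add: mixed_form_def width_def height_def algebra_simps)
qed

lemma mixed_form_add_right:
  assumes "sublinear h" "sublinear h'" "sublinear k"
  shows "mixed_form k (\<lambda>u. h u + h' u) = mixed_form k h + mixed_form k h'"
  using mixed_form_add[OF assms] by (simp only: mixed_form_commute[of k])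

lemma pairing_nn_integral:
  assumes "sublinear h" "sublinear k" "c \<in> corners"
  shows "ennreal (pairing c h k) = (\<integral>\<^sup>+p\<in>{0<..}. ennreal (contact c h p * contact c k p) \<partial>lborel)"
    and "0 \<le> pairing c h k"
proof -
  have nn: "0 \<le> contact c h p * contact c k p" for p
    using contact_bounds assms by (intro mult_nonneg_nonneg) auto
  have "(\<integral>\<^sup>+p. ennreal (indicator {0<..} p *\<^sub>R (contact c h p * contact c k p)) \<partial>lborel) = ennreal (pairing c h k)"
    unfolding pairing_def set_lebesgue_integral_def
    using contact_product_integrable[OF assms] nn
    by (intro nn_integral_eq_integral) (auto simp: set_integrable_def)
  moreover have "(\<integral>\<^sup>+p. ennreal (indicator {0<..} p *\<^sub>R (contact c h p * contact c k p)) \<partial>lborel)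
      = (\<integral>\<^sup>+p\<in>{0<..}. ennreal (contact c h p * contact c k p) \<partial>lborel)"
    by (intro nn_integral_cong) (auto simp: indicator_def)
  ultimately show "ennreal (pairing c h k) = (\<integral>\<^sup>+p\<in>{0<..}. ennreal (contact c h p * contact c k p) \<partial>lborel)"
    by simp
  show "0 \<le> pairing c h k"
    unfolding pairing_def set_lebesgue_integral_def using nn by (intro integral_nonneg_AE) auto
qed

lemma measure_convex_body:
  assumes K: "compact K" "convex K" "K \<noteq> {}"
  shows "measure lborel K = mixed_form (support_fn K) (support_fn K) / 2"
proof -
  define h where "h = support_fn K"
  have h: "sublinear h" unfolding h_def by (rule sublinear_support_fn[OF K(1)])
  have half: "(\<integral>\<^sup>+p\<in>{0<..}. ennreal ((contact c h p)\<^sup>2 / 2) \<partial>lborel) = ennreal (pairing c h h / 2)"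
    if c: "c \<in> corners" for c
  proof -
    note [measurable] = contact_measurable[OF h c]
    have "(\<integral>\<^sup>+p\<in>{0<..}. ennreal ((contact c h p)\<^sup>2 / 2) \<partial>lborel)
      = (\<integral>\<^sup>+p. ennreal (1 / 2) * (ennreal (contact c h p * contact c h p) * indicator {0<..} p) \<partial>lborel)"
    proof (intro nn_integral_cong)
      fix p
      have "ennreal ((contact c h p)\<^sup>2 / 2) = ennreal (1 / 2) * ennreal (contact c h p * contact c h p)"
        by (subst ennreal_mult[symmetric]) (auto simp: power2_eq_square)
      then show "ennreal ((contact c h p)\<^sup>2 / 2) * indicator {0<..} p
          = ennreal (1 / 2) * (ennreal (contact c h p * contact c h p) * indicator {0<..} p)"
        by (simp only: mult.assoc)
    qed
    also have "\<dots> = ennreal (1 / 2) * ennreal (pairing c h h)"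
      by (subst nn_integral_cmult) (auto simp: pairing_nn_integral(1)[OF h h c])
    also have "\<dots> = ennreal (pairing c h h / 2)"
      using pairing_nn_integral(2)[OF h h c] by (subst ennreal_mult[symmetric]) auto
    finally show ?thesis .
  qed
  have eK: "emeasure lborel K = ennreal (measure lborel K)"
    using emeasure_compact_finite[OF K(1)] by (intro emeasure_eq_ennreal_measure) simp
  have "ennreal (width h * height h) = emeasure lborel K + (\<Sum>c\<in>corners. ennreal (pairing c h h / 2))"
    using emeasure_box_minus_corners[OF K] half by (simp add: h_def cong: sum.cong)
  also have "\<dots> = ennreal (measure lborel K) + ennreal (\<Sum>c\<in>corners. pairing c h h / 2)"
    using K(1) pairing_nn_integral(2)[OF h h]
    using eK by (subst sum_ennreal) simp_all
  also have "\<dots> = ennreal (measure lborel K + (\<Sum>c\<in>corners. pairing c h h / 2))"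
    using pairing_nn_integral(2)[OF h h] by (intro ennreal_plus[symmetric] sum_nonneg) auto
  finally have "width h * height h = measure lborel K + (\<Sum>c\<in>corners. pairing c h h / 2)"
    using emeasure_bounding_box(1,2)[OF h] pairing_nn_integral(2)[OF h h]
    by (subst (asm) ennreal_inj) (auto intro!: add_nonneg_nonneg sum_nonneg)
  then show ?thesis by (simp add: mixed_form_def h_def sum_divide_distrib[symmetric] field_simps)
qed

text \<open>
  The form is not positive semidefinite; on a sublinear function its value is twice an area.
\<close>

lemma mixed_form_nonneg:
  assumes "sublinear h" shows "0 \<le> mixed_form h h"
proof -
  obtain K where "compact K" "convex K" "K \<noteq> {}" "support_fn K = h"
    using sublinear_is_support_fn[OF assms] by blast
  then have "measure lborel K = mixed_form h h / 2" using measure_convex_body[of K] by simp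
  moreover have "0 \<le> measure lborel K" by (rule measure_nonneg)
  ultimately show ?thesis by linarith
qed

text \<open>
  Choose \<open>t\<close> so that \<open>h - t k\<close> has width \<open>0\<close>. The product of width and height then drops out, so the
  form is nonpositive on \<open>h - t k\<close>. The quadratic polynomial \<open>t \<mapsto> mixed_form (h - t k) (h - t k)\<close> thus
  takes a nonpositive value while its leading coefficient \<open>mixed_form k k\<close> is nonnegative.
\<close>

lemma mixed_form_Minkowski:
  assumes h: "sublinear h" and k: "sublinear k"
  shows "mixed_form h h * mixed_form k k \<le> (mixed_form h k)\<^sup>2"
proof (cases "width k = 0")
  case True
  have "mixed_form k k = - (\<Sum>c\<in>corners. pairing c k k)" by (simp add: mixed_form_def True)
  also have "\<dots> \<le> 0" using pairing_nn_integral(2)[OF k k] by (simp add: sum_nonneg)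
  finally have "mixed_form k k = 0" using mixed_form_nonneg[OF k] by simp
  then show ?thesis by simp
next
  case False
  define t where "t = width h / width k"
  have "0 \<le> pairing c h h - 2 * t * pairing c h k + t\<^sup>2 * pairing c k k" if c: "c \<in> corners" for c
  proof -
    note ints = contact_product_integrable[OF h h c] contact_product_integrable[OF h k c] contact_product_integrable[OF k k c]
    have "0 \<le> (LINT p:{0<..}|lborel. (contact c h p - t * contact c k p)\<^sup>2)"
      unfolding set_lebesgue_integral_def by (intro integral_nonneg_AE) auto
    also have "\<dots> = (LINT p:{0<..}|lborel. (contact c h p * contact c h p - (2 * t) * (contact c h p * contact c k p))
        + t\<^sup>2 * (contact c k p * contact c k p))"
      by (simp add: power2_eq_square algebra_simps)
    also have "\<dots> = pairing c h h - 2 * t * pairing c h k + t\<^sup>2 * pairing c k k"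
      using ints by (simp add: pairing_def set_integral_add set_integral_diff)
    finally show ?thesis .
  qed
  then have "0 \<le> (\<Sum>c\<in>corners. pairing c h h - 2 * t * pairing c h k + t\<^sup>2 * pairing c k k)"
    by (rule sum_nonneg)
  then have sums: "0 \<le> (\<Sum>c\<in>corners. pairing c h h) - 2 * t * (\<Sum>c\<in>corners. pairing c h k)
      + t\<^sup>2 * (\<Sum>c\<in>corners. pairing c k k)"
    by (simp add: sum.distrib sum_subtractf sum_distrib_left)
  have w: "width h = t * width k" using False by (simp add: t_def)
  have "mixed_form h h - 2 * t * mixed_form h k + t\<^sup>2 * mixed_form k k
    = - ((\<Sum>c\<in>corners. pairing c h h) - 2 * t * (\<Sum>c\<in>corners. pairing c h k)
      + t\<^sup>2 * (\<Sum>c\<in>corners. pairing c k k))"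
    unfolding mixed_form_def w by (simp add: algebra_simps power2_eq_square)
  then have neg: "mixed_form h h - 2 * t * mixed_form h k + t\<^sup>2 * mixed_form k k \<le> 0" using sums by simp
  have "0 \<le> (t * mixed_form k k - mixed_form h k)\<^sup>2
      - mixed_form k k * (mixed_form h h - 2 * t * mixed_form h k + t\<^sup>2 * mixed_form k k)"
    using mult_nonneg_nonpos[OF mixed_form_nonneg[OF k] neg] by (smt (verit) zero_le_power2)
  then show ?thesis by (simp add: power2_eq_square algebra_simps)
qed

section \<open>Slices of three-dimensional bodies\<close>

type_synonym space3 = "plane \<times> real"

definition slice :: "space3 set \<Rightarrow> real \<Rightarrow> plane set" where
  "slice X s = {z. (z, s) \<in> X}"

abbreviation slice_fn :: "space3 set \<Rightarrow> real \<Rightarrow> plane \<Rightarrow> real" where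
  "slice_fn X s \<equiv> support_fn (slice X s)"

lemma slice_compact:
  assumes "compact X" shows "compact (slice X s)"
proof -
  have "slice X s = fst ` (X \<inter> UNIV \<times> {s})" by (force simp: slice_def)
  moreover have "compact (X \<inter> UNIV \<times> {s})" using assms by (intro compact_Int_closed closed_Times) auto
  then have "compact (fst ` (X \<inter> UNIV \<times> {s}))" by (rule compact_continuous_image[rotated]) (intro continuous_intros)
  ultimately show ?thesis by simp
qed

lemma slice_convex:
  assumes "convex X" shows "convex (slice X s)"
proof (rule convexI)
  fix x y and u v :: real assume xy: "x \<in> slice X s" "y \<in> slice X s" "0 \<le> u" "0 \<le> v" "u + v = 1"
  then have "u *\<^sub>R (x, s) + v *\<^sub>R (y, s) \<in> X"
    using assms by (intro convexD) (auto simp: slice_def)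
  moreover have "u *\<^sub>R s + v *\<^sub>R s = s" using xy(5) by (metis scaleR_left_distrib scaleR_one)
  ultimately show "u *\<^sub>R x + v *\<^sub>R y \<in> slice X s" by (simp add: slice_def)
qed

lemma slice_empty_iff: "slice X s = {} \<longleftrightarrow> s \<notin> snd ` X"
  by (force simp: slice_def)

lemma slice_fn_sublinear: "compact X \<Longrightarrow> sublinear (slice_fn X s)"
  by (intro sublinear_support_fn slice_compact)

lemma slice_fn_outside: "s \<notin> snd ` X \<Longrightarrow> slice_fn X s u = 0"
  by (simp add: slice_empty_iff[symmetric] support_fn_def)

lemma slice_fn_ge_iff:
  assumes "compact X" "s \<in> snd ` X"
  shows "a \<le> slice_fn X s u \<longleftrightarrow> (\<exists>z. (z, s) \<in> X \<and> a \<le> inner z u)"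
proof -
  have ne: "slice X s \<noteq> {}" using assms(2) by (simp add: slice_empty_iff)
  obtain z where z: "z \<in> slice X s" "inner z u = slice_fn X s u"
    using support_fn_attained[OF slice_compact[OF assms(1)] ne] by blast
  have up: "inner y u \<le> slice_fn X s u" if "(y, s) \<in> X" for y
    using that by (intro support_fn_upper slice_compact assms) (simp add: slice_def)
  show ?thesis
  proof
    assume "a \<le> slice_fn X s u"
    then show "\<exists>z. (z, s) \<in> X \<and> a \<le> inner z u" using z unfolding slice_def by (intro exI[of _ z]) simp
  next
    assume "\<exists>z. (z, s) \<in> X \<and> a \<le> inner z u"
    then show "a \<le> slice_fn X s u" using up by (elim exE conjE) (rule order_trans)
  qed
qed

text \<open>
  Superlevel sets are closed over the base of the body, by compactness.
\<close>

lemma slice_fn_measurable: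
  assumes X: "compact X"
  shows "(\<lambda>w. slice_fn X (fst w) (snd w)) \<in> borel_measurable borel"
  unfolding borel_measurable_iff_ge
proof
  fix a
  let ?C = "{w. \<exists>z. (z, fst w) \<in> X \<and> a \<le> inner z (snd w)}"
  have "closed ?C"
    unfolding closed_sequential_limits
  proof clarify
    fix w :: "nat \<Rightarrow> real \<times> plane" and s u
    assume w: "\<forall>n. w n \<in> ?C" and lim: "w \<longlonglongrightarrow> (s, u)"
    from w have "\<forall>n. \<exists>z. (z, fst (w n)) \<in> X \<and> a \<le> inner z (snd (w n))" by blast
    from choice[OF this] obtain z where zz: "\<forall>n. (z n, fst (w n)) \<in> X \<and> a \<le> inner (z n) (snd (w n))"
      by (rule exE)
    have z: "(z n, fst (w n)) \<in> X" "a \<le> inner (z n) (snd (w n))" for n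
      by (rule zz[THEN spec, THEN conjunct1], rule zz[THEN spec, THEN conjunct2])
    obtain l r where l: "l \<in> X" "strict_mono r" "((\<lambda>n. (z n, fst (w n))) \<circ> r) \<longlonglongrightarrow> l"
    proof -
      have "seq_compact X" using X by (simp only: compact_eq_seq_compact_metric)
      moreover have "\<forall>n. (z n, fst (w n)) \<in> X" using z(1) by (rule allI)
      ultimately show ?thesis using that by (rule seq_compactE)
    qed
    have z': "(\<lambda>n. z (r n)) \<longlonglongrightarrow> fst l" and "(\<lambda>n. fst (w (r n))) \<longlonglongrightarrow> snd l"
      using tendsto_fst[OF l(3)] tendsto_snd[OF l(3)] by (simp_all add: o_def)
    have w': "(\<lambda>n. w (r n)) \<longlonglongrightarrow> (s, u)"
      using LIMSEQ_subseq_LIMSEQ[OF lim l(2)] by (simp add: o_def)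
    have "(\<lambda>n. fst (w (r n))) \<longlonglongrightarrow> s" "(\<lambda>n. snd (w (r n))) \<longlonglongrightarrow> u"
      using tendsto_fst[OF w'] tendsto_snd[OF w'] by simp_all
    then have "snd l = s" and "(\<lambda>n. inner (z (r n)) (snd (w (r n)))) \<longlonglongrightarrow> inner (fst l) u"
      using \<open>(\<lambda>n. fst (w (r n))) \<longlonglongrightarrow> snd l\<close> z' by (auto intro: LIMSEQ_unique tendsto_inner)
    then have "a \<le> inner (fst l) u"
      using z(2) by (intro LIMSEQ_le_const) auto
    then show "\<exists>z. (z, fst (s, u)) \<in> X \<and> a \<le> inner z (snd (s, u))"
      using l(1) \<open>snd l = s\<close> by (intro exI[of _ "fst l"]) auto
  qed
  moreover have "closed (snd ` X \<times> (UNIV :: plane set))"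
    using X by (intro closed_Times compact_imp_closed compact_continuous_image continuous_intros) auto
  then have "open (- (snd ` X \<times> (UNIV :: plane set)))" by (simp add: open_closed)
  moreover have "{w \<in> space borel. a \<le> slice_fn X (fst w) (snd w)}
     = ?C \<union> (if a \<le> 0 then - (snd ` X \<times> UNIV) else {})" (is "?L = ?R")
  proof (rule set_eqI)
    fix w
    show "w \<in> ?L \<longleftrightarrow> w \<in> ?R"
    proof (cases "fst w \<in> snd ` X")
      case True
      then have "w \<notin> - (snd ` X \<times> UNIV)" by (simp add: mem_Times_iff)
      then show ?thesis using slice_fn_ge_iff[OF X True, of a "snd w"] by simp
    next
      case False
      then have 1: "w \<in> - (snd ` X \<times> UNIV)" by (simp add: mem_Times_iff)
      have 2: "(z, fst w) \<notin> X" for z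
      proof
        assume "(z, fst w) \<in> X"
        then have "snd (z, fst w) \<in> snd ` X" by (rule imageI)
        with False show False by simp
      qed
      show ?thesis using 1 2 slice_fn_outside[OF False, of "snd w"] by simp
    qed
  qed
  ultimately show "{w \<in> space borel. a \<le> slice_fn X (fst w) (snd w)} \<in> sets borel"
    by (simp only: split: if_split) (intro conjI impI sets.Un borel_closed borel_open sets.empty_sets)
qed

lemma slice_fn_measurable' [measurable (raw)]:
  assumes "compact X" "f \<in> borel_measurable M" "g \<in> M \<rightarrow>\<^sub>M borel"
  shows "(\<lambda>x. slice_fn X (f x) (g x)) \<in> borel_measurable M"
proof -
  have "(\<lambda>x. (f x, g x)) \<in> M \<rightarrow>\<^sub>M borel"
    using assms(2,3) by (rule borel_measurable_Pair)
  from measurable_compose[OF this slice_fn_measurable[OF assms(1)]] show ?thesis by simp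
qed

lemma slice_fn_bound:
  assumes "compact X"
  obtains R where "0 \<le> R" "\<And>s u. \<bar>slice_fn X s u\<bar> \<le> R * norm u * indicator (snd ` X) s"
proof -
  have "bounded (fst ` X)" using assms by (intro compact_imp_bounded compact_continuous_image continuous_intros)
  then obtain R where R: "R > 0" "\<And>z. z \<in> fst ` X \<Longrightarrow> norm z \<le> R"
    unfolding bounded_pos by blast
  have "\<bar>slice_fn X s u\<bar> \<le> R * norm u * indicator (snd ` X) s" for s u
  proof (cases "s \<in> snd ` X")
    case True
    then have ne: "slice X s \<noteq> {}" by (simp add: slice_empty_iff)
    obtain z where z: "z \<in> slice X s" "inner z u = slice_fn X s u"
      using support_fn_attained[OF slice_compact[OF assms] ne] by blast
    have "norm z \<le> R" using z(1) by (intro R(2)) (force simp: slice_def)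
    then have "\<bar>inner z u\<bar> \<le> R * norm u"
      using Cauchy_Schwarz_ineq2[of z u] mult_right_mono[of "norm z" R "norm u"] by simp
    then show ?thesis using z(2) True by simp
  qed (simp add: slice_fn_outside)
  then show ?thesis using that[of R] R(1) by simp
qed

lemma indicator_base_integrable:
  assumes "compact X" shows "integrable lborel (indicator (snd ` X) :: real \<Rightarrow> real)"
proof -
  have c: "compact (snd ` X)" using assms by (intro compact_continuous_image continuous_intros)
  show ?thesis
    using emeasure_compact_finite[OF c] borel_compact[OF c] by (simp add: less_top)
qed

lemma slice_fn_integrable:
  assumes X: "compact X" shows "integrable lborel (\<lambda>s. slice_fn X s u)"
proof -
  obtain R where R: "0 \<le> R" "\<And>s u. \<bar>slice_fn X s u\<bar> \<le> R * norm u * indicator (snd ` X) s"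
    using slice_fn_bound[OF X] by blast
  show ?thesis
  proof (rule Bochner_Integration.integrable_bound)
    show "integrable lborel (\<lambda>s. R * norm u * indicator (snd ` X) s :: real)"
      by (intro integrable_mult_right indicator_base_integrable X)
    show "(\<lambda>s. slice_fn X s u) \<in> borel_measurable lborel"
      using X by measurable
    show "AE s in lborel. norm (slice_fn X s u) \<le> norm (R * norm u * indicator (snd ` X) s)"
      using R by (intro AE_I2) (metis abs_ge_self order_trans real_norm_def)
  qed
qed

text \<open>
  The support function of the Minkowski integral of the slices, known as the fibre body of \<open>X\<close>.
\<close>

definition fiber_fn :: "space3 set \<Rightarrow> plane \<Rightarrow> real" where
  "fiber_fn X u = (LINT s|lborel. slice_fn X s u)"

lemma fiber_fn_sublinear:
  assumes X: "compact X" shows "sublinear (fiber_fn X)"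
  unfolding sublinear_def
proof (intro conjI allI impI)
  fix u v
  have "fiber_fn X (u + v) \<le> (LINT s|lborel. slice_fn X s u + slice_fn X s v)"
    unfolding fiber_fn_def
    by (intro integral_mono Bochner_Integration.integrable_add slice_fn_integrable X sublinear_add slice_fn_sublinear)
  also have "\<dots> = fiber_fn X u + fiber_fn X v"
    unfolding fiber_fn_def by (intro Bochner_Integration.integral_add slice_fn_integrable X)
  finally show "fiber_fn X (u + v) \<le> fiber_fn X u + fiber_fn X v" .
next
  fix r :: real and u :: plane assume r: "0 \<le> r"
  show "fiber_fn X (r *\<^sub>R u) = r * fiber_fn X u"
    unfolding fiber_fn_def by (simp only: sublinear_scale[OF slice_fn_sublinear[OF X] r]) simp
qed

lemma width_slice_integral:
  assumes X: "compact X"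
  shows "has_bochner_integral lborel (\<lambda>s. width (slice_fn X s)) (width (fiber_fn X))"
    and "has_bochner_integral lborel (\<lambda>s. height (slice_fn X s)) (height (fiber_fn X))"
  unfolding width_def height_def fiber_fn_def
  by (intro has_bochner_integral_add has_bochner_integral_integrable slice_fn_integrable X)+

lemma contact_slice_measurable:
  assumes X: "compact X"
  shows "(\<lambda>(s, p). contact c (slice_fn X s) p) \<in> borel_measurable (lborel \<Otimes>\<^sub>M lborel)"
  unfolding contact_def right_slope_def gap_def using X by measurable

text \<open>
  The difference quotients that define the contact function are linear in the support function and
  bounded by the width, so dominated convergence lets the limit pass through the integral.
\<close>

lemma contact_slice_integral:
  assumes X: "compact X" and c: "c \<in> corners"
  shows "has_bochner_integral lborel (\<lambda>s. contact c (slice_fn X s) p) (contact c (fiber_fn X) p)"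
proof -
  let ?f = "\<lambda>n s. real (Suc n) * (gap c (slice_fn X s) (p + 1 / real (Suc n)) - gap c (slice_fn X s) p)"
  have meas: "(\<lambda>s. contact c (slice_fn X s) p) \<in> borel_measurable lborel"
    unfolding contact_def right_slope_def gap_def using X by measurable
  have measn: "?f n \<in> borel_measurable lborel" for n
    unfolding gap_def using X by measurable
  have lim: "AE s in lborel. (\<lambda>n. ?f n s) \<longlonglongrightarrow> contact c (slice_fn X s) p"
    by (intro AE_I2 contact_lim slice_fn_sublinear X c)
  have bound: "AE s in lborel. norm (?f n s) \<le> width (slice_fn X s)" for n
  proof (rule AE_I2)
    fix s
    show "norm (?f n s) \<le> width (slice_fn X s)"
      using concave_increasing.quotient_bounds[OF gap_concave_increasing[OF slice_fn_sublinear[OF X, of s] c], of n p]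
      by (simp only: real_norm_def abs_of_nonneg)
  qed
  have w: "integrable lborel (\<lambda>s. width (slice_fn X s))"
    using width_slice_integral(1)[OF X] by (simp add: has_bochner_integral_iff)
  note dom = integrable_dominated_convergence[OF meas measn w lim bound]
    integral_dominated_convergence[OF meas measn w lim bound]
  have "integral\<^sup>L lborel (?f n) = real (Suc n) * (gap c (fiber_fn X) (p + 1 / real (Suc n)) - gap c (fiber_fn X) p)" for n
    unfolding gap_def fiber_fn_def using slice_fn_integrable[OF X] by simp
  then have "(LINT s|lborel. contact c (slice_fn X s) p) = contact c (fiber_fn X) p"
    using dom(2) contact_lim[OF fiber_fn_sublinear[OF X] c, of p] by (intro LIMSEQ_unique) auto
  then show ?thesis using dom(1) by (simp add: has_bochner_integral_iff)
qed

text \<open>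
  Contact functions are nonnegative, so Tonelli's theorem interchanges the integrals over the slices
  and over the directions.
\<close>

lemma pairing_slice_integral:
  assumes X: "compact X" and k: "sublinear k" and c: "c \<in> corners"
  shows "has_bochner_integral lborel (\<lambda>s. pairing c (slice_fn X s) k) (pairing c (fiber_fn X) k)"
proof (rule has_bochner_integral_nn_integral)
  note [measurable] = contact_measurable[OF k c] contact_slice_measurable[OF X, of c]
  have sub: "sublinear (slice_fn X s)" "sublinear (fiber_fn X)" for s
    by (intro slice_fn_sublinear fiber_fn_sublinear X)+
  show "(\<lambda>s. pairing c (slice_fn X s) k) \<in> borel_measurable lborel"
    unfolding pairing_def set_lebesgue_integral_def by measurable
  show "AE s in lborel. 0 \<le> pairing c (slice_fn X s) k"
    by (intro AE_I2 pairing_nn_integral(2) sub k c)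
  show "0 \<le> pairing c (fiber_fn X) k"
    by (intro pairing_nn_integral(2) sub k c)
  have "(\<integral>\<^sup>+s. ennreal (pairing c (slice_fn X s) k) \<partial>lborel)
    = (\<integral>\<^sup>+s. (\<integral>\<^sup>+p. ennreal (contact c (slice_fn X s) p * contact c k p) * indicator {0<..} p \<partial>lborel) \<partial>lborel)"
    by (simp add: pairing_nn_integral(1)[OF sub(1) k c])
  also have "\<dots> = (\<integral>\<^sup>+p. (\<integral>\<^sup>+s. ennreal (contact c (slice_fn X s) p * contact c k p) * indicator {0<..} p \<partial>lborel) \<partial>lborel)"
    by (rule lborel_pair.Fubini'[symmetric]) measurable
  also have "\<dots> = (\<integral>\<^sup>+p. ennreal (contact c (fiber_fn X) p * contact c k p) * indicator {0<..} p \<partial>lborel)"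
  proof (rule nn_integral_cong)
    fix p
    have "has_bochner_integral lborel (\<lambda>s. contact c (slice_fn X s) p * contact c k p) (contact c (fiber_fn X) p * contact c k p)"
      by (intro has_bochner_integral_mult_left contact_slice_integral X c)
    moreover have "0 \<le> contact c (slice_fn X s) p * contact c k p" for s
      by (intro mult_nonneg_nonneg contact_bounds sub k c)
    ultimately have "(\<integral>\<^sup>+s. ennreal (contact c (slice_fn X s) p * contact c k p) \<partial>lborel) = ennreal (contact c (fiber_fn X) p * contact c k p)"
      by (subst nn_integral_eq_integral) (auto simp: has_bochner_integral_iff)
    then show "(\<integral>\<^sup>+s. ennreal (contact c (slice_fn X s) p * contact c k p) * indicator {0<..} p \<partial>lborel)
      = ennreal (contact c (fiber_fn X) p * contact c k p) * indicator {0<..} p"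
      by (cases "p \<in> {0<..}") auto
  qed
  also have "\<dots> = ennreal (pairing c (fiber_fn X) k)"
    by (rule pairing_nn_integral(1)[OF sub(2) k c, symmetric])
  finally show "(\<integral>\<^sup>+s. ennreal (pairing c (slice_fn X s) k) \<partial>lborel) = ennreal (pairing c (fiber_fn X) k)" .
qed

lemma mixed_form_slice_integral:
  assumes X: "compact X" and k: "sublinear k"
  shows "has_bochner_integral lborel (\<lambda>s. mixed_form (slice_fn X s) k) (mixed_form (fiber_fn X) k)"
  unfolding mixed_form_def
  by (intro has_bochner_integral_diff has_bochner_integral_add has_bochner_integral_sum
      has_bochner_integral_mult_left has_bochner_integral_mult_right width_slice_integral pairing_slice_integral X k)

definition slice_volume :: "space3 set \<Rightarrow> real" where
  "slice_volume X = (LINT s|lborel. measure lborel (slice X s))"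

lemma slice_volume_integral:
  assumes X: "compact X"
  shows "has_bochner_integral lborel (\<lambda>s. measure lborel (slice X s)) (slice_volume X)"
proof -
  have Xs: "X \<in> sets (lborel \<Otimes>\<^sub>M lborel)"
    using borel_compact[OF X] by (simp only: lborel_prod sets_lborel)
  have fin: "emeasure lborel (slice X s) < \<infinity>" for s
    by (rule emeasure_compact_finite[OF slice_compact[OF X]])
  have vimage: "(\<lambda>z. (z, s)) -` X = slice X s" for s by (auto simp: slice_def)
  have "(\<lambda>s. emeasure lborel (slice X s)) \<in> borel_measurable lborel"
    using lborel_pair.measurable_emeasure_Pair2[OF Xs] by (simp add: vimage)
  then have meas: "(\<lambda>s. measure lborel (slice X s)) \<in> borel_measurable lborel"
    unfolding measure_def by measurable
  have "(\<integral>\<^sup>+s. ennreal (measure lborel (slice X s)) \<partial>lborel) = (\<integral>\<^sup>+s. emeasure lborel (slice X s) \<partial>lborel)"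
  proof (rule nn_integral_cong)
    fix s
    show "ennreal (measure lborel (slice X s)) = emeasure lborel (slice X s)"
      using fin[of s] by (intro emeasure_eq_ennreal_measure[symmetric]) simp
  qed
  also have "\<dots> = emeasure (lborel \<Otimes>\<^sub>M lborel) X"
    using lborel_pair.emeasure_pair_measure_alt2[OF Xs] by (simp add: vimage)
  also have "\<dots> < \<infinity>" using emeasure_compact_finite[OF X] by (simp add: lborel_prod)
  finally have "integrable lborel (\<lambda>s. measure lborel (slice X s))"
    using meas by (intro integrableI_bounded) auto
  then show ?thesis by (simp add: has_bochner_integral_iff slice_volume_def)
qed

definition base_length :: "space3 set \<Rightarrow> real" where
  "base_length X = measure lborel (snd ` X)"

lemma base_length_integral:
  assumes X: "compact X"
  shows "has_bochner_integral lborel (indicator (snd ` X)) (base_length X)"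
  using indicator_base_integrable[OF X] by (simp add: has_bochner_integral_iff base_length_def)

text \<open>
  For nonempty slices this expands \<open>measure_convex_body\<close> bilinearly. If one of the slices is empty then
  so is the sum, and each of the three terms on the right vanishes.
\<close>

lemma measure_slice_sum:
  assumes X: "compact X" "convex X" and Y: "compact Y" "convex Y"
  shows "measure lborel (slice X s + slice Y t) = indicator (snd ` Y) t * measure lborel (slice X s)
    + mixed_form (slice_fn X s) (slice_fn Y t) + indicator (snd ` X) s * measure lborel (slice Y t)"
proof -
  have zero: "mixed_form (\<lambda>_. 0) h = 0" for h
  proof -
    have "contact c (\<lambda>_. 0) p = 0" for c p
      by (simp add: contact_def right_slope_def gap_def)
    then show ?thesis by (simp add: mixed_form_def width_def height_def pairing_def set_lebesgue_integral_def)
  qed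
  have empty: "support_fn {} = (\<lambda>_. 0)"
    by (rule ext) (simp add: support_fn_def)
  have empty_plus: "{} + S = {}" "S + {} = {}" for S :: "plane set"
    by (auto simp: set_plus_def)
  consider "slice X s = {}" | "slice Y t = {}" | "slice X s \<noteq> {}" "slice Y t \<noteq> {}" by blast
  then show ?thesis
  proof cases
    case 1
    moreover have "indicator (snd ` X) s = (0 :: real)"
      using 1 unfolding slice_empty_iff by (rule indicator_simps(2))
    ultimately show ?thesis by (simp add: empty zero empty_plus)
  next
    case 2
    moreover have "indicator (snd ` Y) t = (0 :: real)"
      using 2 unfolding slice_empty_iff by (rule indicator_simps(2))
    ultimately show ?thesis by (simp add: empty zero mixed_form_commute[of _ "\<lambda>_. 0"] empty_plus)
  next
    case 3
    have ind: "indicator (snd ` X) s = (1 :: real)" "indicator (snd ` Y) t = (1 :: real)"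
      using 3 unfolding slice_empty_iff by (simp_all only: not_not indicator_simps)
    note cc = slice_compact[OF X(1), of s] slice_compact[OF Y(1), of t]
      slice_convex[OF X(2), of s] slice_convex[OF Y(2), of t]
    have body: "convex_body (slice X s + slice Y t)"
      using cc 3 by (intro convex_body_plus) (auto simp: convex_body_def)
    have sum: "support_fn (slice X s + slice Y t) = (\<lambda>u. slice_fn X s u + slice_fn Y t u)"
      by (rule ext) (rule support_fn_plus[OF cc(1) 3(1) cc(2) 3(2)])
    have sub: "sublinear (slice_fn X s)" "sublinear (slice_fn Y t)"
      by (intro slice_fn_sublinear X Y)+
    have "measure lborel (slice X s + slice Y t)
      = mixed_form (\<lambda>u. slice_fn X s u + slice_fn Y t u) (\<lambda>u. slice_fn X s u + slice_fn Y t u) / 2"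
      using measure_convex_body[of "slice X s + slice Y t"] body by (simp add: convex_body_def sum)
    also have "\<dots> = mixed_form (slice_fn X s) (slice_fn X s) / 2 + mixed_form (slice_fn X s) (slice_fn Y t)
        + mixed_form (slice_fn Y t) (slice_fn Y t) / 2"
      using mixed_form_commute[of "slice_fn Y t" "slice_fn X s"]
      by (simp only: mixed_form_add[OF sub sublinear_plus[OF sub]] mixed_form_add_right[OF sub sub(1)]
          mixed_form_add_right[OF sub sub(2)]) (simp add: add_divide_distrib)
    finally show ?thesis
      unfolding ind measure_convex_body[OF cc(1) cc(3) 3(1)] measure_convex_body[OF cc(2) cc(4) 3(2)]
      by simp
  qed
qed

section \<open>Volume as an integral over pairs of slices\<close>

text \<open>
  The Minkowski sum of \<open>X \<times> {0}\<close> and the graph over \<open>Y\<close>, when the functional is the last coordinate.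
\<close>

definition sheared_sum :: "space3 set \<Rightarrow> space3 set \<Rightarrow> (space3 \<times> real) set" where
  "sheared_sum X Y = (\<lambda>w. (fst w + snd w, snd (snd w))) ` (X \<times> Y)"

lemma sheared_sum_compact:
  assumes "compact X" "compact Y" shows "compact (sheared_sum X Y)"
  unfolding sheared_sum_def using assms
  by (intro compact_continuous_image compact_Times continuous_intros)

text \<open>
  The first and the last summand are additive in \<open>Y\<close> and in \<open>X\<close> respectively. Polarization in both
  arguments therefore leaves only the mixed form.
\<close>

lemma measure_sheared_sum:
  assumes X: "compact X" "convex X" and Y: "compact Y" "convex Y"
  shows "measure lborel (sheared_sum X Y) =
    base_length Y * slice_volume X + mixed_form (fiber_fn X) (fiber_fn Y) + base_length X * slice_volume Y"
proof -
  let ?Z = "sheared_sum X Y"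
  define f where "f t s = measure lborel (slice X s + slice Y t)" for t s
  define F where "F t = indicator (snd ` Y) t * slice_volume X + mixed_form (fiber_fn X) (slice_fn Y t)
      + base_length X * measure lborel (slice Y t)" for t
  have f0: "0 \<le> f t s" for t s by (simp add: f_def)
  have inner: "has_bochner_integral lborel (f t) (F t)" for t
    unfolding f_def F_def measure_slice_sum[OF X Y]
    by (intro has_bochner_integral_add has_bochner_integral_mult_left has_bochner_integral_mult_right
        slice_volume_integral mixed_form_slice_integral base_length_integral slice_fn_sublinear X Y)
  have outer: "has_bochner_integral lborel F
      (base_length Y * slice_volume X + mixed_form (fiber_fn X) (fiber_fn Y) + base_length X * slice_volume Y)"
    unfolding F_def mixed_form_commute[of "fiber_fn X"]
    by (intro has_bochner_integral_add has_bochner_integral_mult_left has_bochner_integral_mult_right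
        slice_volume_integral mixed_form_slice_integral base_length_integral fiber_fn_sublinear X Y)
  have F0: "0 \<le> F t" for t
  proof -
    have "F t = integral\<^sup>L lborel (f t)" using inner[of t] by (simp add: has_bochner_integral_iff)
    then show ?thesis using f0 by (simp add: integral_nonneg_AE)
  qed
  have Z: "?Z \<in> sets ((lborel :: space3 measure) \<Otimes>\<^sub>M (lborel :: real measure))"
    using borel_compact[OF sheared_sum_compact[OF X(1) Y(1)]] by (simp only: lborel_prod sets_lborel)
  have slices: "emeasure lborel ((\<lambda>x. (x, t)) -` ?Z) = (\<integral>\<^sup>+s. ennreal (f t s) \<partial>lborel)" for t
  proof -
    let ?W = "(\<lambda>x. (x, t)) -` ?Z"
    have W: "?W \<in> sets ((lborel :: plane measure) \<Otimes>\<^sub>M (lborel :: real measure))"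
      using sets_Pair2[OF Z, of t] by (simp only: lborel_prod)
    have eq: "(\<lambda>x. (x, r)) -` ?W = slice X (r - t) + slice Y t" for r
      by (force simp: sheared_sum_def slice_def set_plus_def image_iff)
    have "emeasure lborel ?W = (\<integral>\<^sup>+r. emeasure lborel (slice X (r - t) + slice Y t) \<partial>lborel)"
      using lborel_pair.emeasure_pair_measure_alt2[OF W] by (simp add: eq lborel_prod)
    also have "\<dots> = (\<integral>\<^sup>+r. ennreal (f t (r - t)) \<partial>lborel)"
    proof (rule nn_integral_cong)
      fix r
      have "compact (slice X (r - t) + slice Y t)"
        by (intro compact_set_plus slice_compact X Y)
      from emeasure_compact_finite[OF this]
      show "emeasure lborel (slice X (r - t) + slice Y t) = ennreal (f t (r - t))"
        unfolding f_def by (intro emeasure_eq_ennreal_measure) simp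
    qed
    also have "\<dots> = (\<integral>\<^sup>+s. ennreal (f t s) \<partial>lborel)"
    proof -
      have [measurable]: "f t \<in> borel_measurable borel" using inner[of t] by (auto simp: has_bochner_integral_iff)
      have "(\<integral>\<^sup>+r. ennreal (f t (r - t)) \<partial>lborel) = (\<integral>\<^sup>+s. ennreal (f t ((t + 1 * s) - t)) \<partial>lborel)"
        by (subst nn_integral_real_affine[where c = 1 and t = t]) auto
      then show ?thesis by simp
    qed
    finally show ?thesis .
  qed
  have "emeasure lborel ?Z = (\<integral>\<^sup>+t. \<integral>\<^sup>+s. ennreal (f t s) \<partial>lborel \<partial>lborel)"
    using lborel_pair.emeasure_pair_measure_alt2[OF Z] by (simp add: slices lborel_prod)
  also have "\<dots> = (\<integral>\<^sup>+t. ennreal (F t) \<partial>lborel)"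
    using inner f0 by (intro nn_integral_cong) (subst nn_integral_eq_integral, auto simp: has_bochner_integral_iff)
  also have "\<dots> = ennreal (integral\<^sup>L lborel F)"
    using outer F0 by (intro nn_integral_eq_integral) (auto simp: has_bochner_integral_iff)
  finally have "measure lborel ?Z = integral\<^sup>L lborel F"
    using F0 by (simp add: measure_def)
  then show ?thesis using outer by (simp add: has_bochner_integral_iff)
qed

section \<open>Monotone contractions of the line\<close>

text \<open>
  A countable cover of \<open>S\<close> by intervals without common interior points is mapped to a cover of \<open>\<sigma> ` S\<close>
  by intervals each of which is at most as long as the original one.
\<close>

lemma measure_monotone_contraction_image:
  fixes \<sigma> :: "real \<Rightarrow> real"
  assumes mono: "\<And>x y. x \<le> y \<Longrightarrow> \<sigma> x \<le> \<sigma> y"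
    and contr: "\<And>x y. x \<le> y \<Longrightarrow> \<sigma> y - \<sigma> x \<le> y - x"
    and S: "S \<in> lmeasurable" "S \<subseteq> {l..r}" and E: "E \<in> lmeasurable" "E \<subseteq> \<sigma> ` S"
  shows "measure lebesgue E \<le> measure lebesgue S"
proof (rule field_le_epsilon)
  fix e :: real assume e: "e > 0"
  have S': "S \<subseteq> cbox l r" using S(2) by simp
  obtain D where D: "countable D"
      "\<And>K. K \<in> D \<Longrightarrow> K \<subseteq> cbox l r \<and> K \<noteq> {} \<and> (\<exists>c d. K = cbox c d)"
      "pairwise (\<lambda>A B. interior A \<inter> interior B = {}) D"
      "S \<subseteq> \<Union>D" "\<Union>D \<in> lmeasurable" "measure lebesgue (\<Union>D) \<le> measure lebesgue S + e"
    by (rule measurable_outer_intervals_bounded[OF S(1) S' e]) blast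
  have box: "\<exists>c d. c \<le> d \<and> K = {c..d}" if K: "K \<in> D" for K
  proof -
    obtain c d where "K = cbox c d" "K \<noteq> {}" using D(2)[OF K] by blast
    then show ?thesis by (intro exI[of _ c] exI[of _ d]) simp
  qed
  define N where "N K = {\<sigma> (Inf K)..\<sigma> (Sup K)}" for K
  have N: "\<sigma> ` K \<subseteq> N K" "N K \<in> lmeasurable" "measure lebesgue (N K) \<le> measure lebesgue K" "K \<in> lmeasurable" "convex K"
    if K: "K \<in> D" for K
  proof -
    obtain c d where cd: "c \<le> d" "K = {c..d}" using box[OF K] by blast
    have "N K = {\<sigma> c..\<sigma> d}" using cd by (simp add: N_def)
    moreover have "\<sigma> c \<le> \<sigma> d" by (rule mono[OF cd(1)])
    moreover have "\<sigma> ` {c..d} \<subseteq> {\<sigma> c..\<sigma> d}" by (intro image_subsetI) (simp add: mono)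
    ultimately show "\<sigma> ` K \<subseteq> N K" "N K \<in> lmeasurable" "measure lebesgue (N K) \<le> measure lebesgue K" "K \<in> lmeasurable" "convex K"
      using contr[OF cd(1)] cd by simp_all
  qed
  have "measure lebesgue (\<Union>K\<in>D. N K) \<le> measure lebesgue (\<Union>D)" and NU: "(\<Union>K\<in>D. N K) \<in> lmeasurable"
  proof -
    have bound: "measure lebesgue (\<Union>K\<in>J. N K) \<le> measure lebesgue (\<Union>D)" if J: "J \<subseteq> D" "finite J" for J
    proof -
      have "measure lebesgue (\<Union>K\<in>J. N K) \<le> (\<Sum>K\<in>J. measure lebesgue (N K))"
        using J N(2) by (intro measure_UNION_le) (auto dest!: subsetD)
      also have "\<dots> \<le> (\<Sum>K\<in>J. measure lebesgue K)"
        using J N(3) by (intro sum_mono) auto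
      also have "\<dots> = measure lebesgue (\<Union>J)"
      proof (rule measure_negligible_finite_Union[symmetric])
        show "pairwise (\<lambda>S T. negligible (S \<inter> T)) J"
        proof (rule pairwiseI)
          fix K L assume KL: "K \<in> J" "L \<in> J" "K \<noteq> L"
          then have "interior (K \<inter> L) = {}" using D(3) J by (auto simp: pairwise_def)
          moreover have "convex (K \<inter> L)" using KL J N(5) by (intro convex_Int) auto
          ultimately show "negligible (K \<inter> L)" by (simp add: negligible_convex_interior)
        qed
      qed (use J N(4) in auto)
      also have "\<dots> \<le> measure lebesgue (\<Union>D)"
        using J N(4) D(5) by (intro measure_mono_fmeasurable) (auto intro!: sets.finite_Union)
      finally show ?thesis .
    qed
    show "measure lebesgue (\<Union>K\<in>D. N K) \<le> measure lebesgue (\<Union>D)"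
      using D(1) N(2) bound by (rule measure_UN_bound)
    show "(\<Union>K\<in>D. N K) \<in> lmeasurable"
      using D(1) N(2) bound by (rule fmeasurable_UN_bound)
  qed
  moreover have "E \<subseteq> (\<Union>K\<in>D. N K)"
  proof
    fix y assume "y \<in> E"
    then obtain x where x: "x \<in> S" "y = \<sigma> x" using E(2) by (elim subsetD[THEN imageE])
    obtain K where "K \<in> D" "x \<in> K" using D(4) x(1) by (elim subsetD[THEN UnionE])
    then show "y \<in> (\<Union>K\<in>D. N K)" using N(1)[of K] x(2) by (intro UN_I[of K]) auto
  qed
  then have "measure lebesgue E \<le> measure lebesgue (\<Union>K\<in>D. N K)"
    using E(1) NU by (intro measure_mono_fmeasurable) auto
  ultimately show "measure lebesgue E \<le> measure lebesgue S + e" using D(6) by linarith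
qed

text \<open>
  By the previous lemma the image under \<open>\<sigma>\<close> of Lebesgue measure on \<open>[l, r]\<close> dominates Lebesgue
  measure on \<open>[\<sigma> l, \<sigma> r]\<close>.
\<close>

lemma nn_integral_monotone_contraction:
  fixes \<sigma> :: "real \<Rightarrow> real" and g :: "real \<Rightarrow> ennreal"
  assumes mono: "\<And>x y. x \<le> y \<Longrightarrow> \<sigma> x \<le> \<sigma> y"
    and contr: "\<And>x y. x \<le> y \<Longrightarrow> \<sigma> y - \<sigma> x \<le> y - x"
    and lr: "l \<le> r" and g: "g \<in> borel_measurable borel"
  shows "(\<integral>\<^sup>+s\<in>{\<sigma> l..\<sigma> r}. g s \<partial>lborel) \<le> (\<integral>\<^sup>+x\<in>{l..r}. g (\<sigma> x) \<partial>lborel)"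
proof -
  note [measurable] = g
  have lip: "\<bar>\<sigma> x - \<sigma> y\<bar> \<le> \<bar>x - y\<bar>" for x y
    using mono[of x y] mono[of y x] contr[of x y] contr[of y x] by (cases "x \<le> y") auto
  have cont: "continuous_on UNIV \<sigma>"
    by (rule lipschitz_on_continuous_on[of 1]) (auto intro!: lipschitz_onI simp: dist_real_def lip)
  then have [measurable]: "\<sigma> \<in> borel_measurable borel" by (rule borel_measurable_continuous_onI)
  have img: "{\<sigma> l..\<sigma> r} \<subseteq> \<sigma> ` {l..r}"
  proof
    fix s assume "s \<in> {\<sigma> l..\<sigma> r}"
    then show "s \<in> \<sigma> ` {l..r}"
      using IVT'[of \<sigma> l s r] lr continuous_on_subset[OF cont] by auto
  qed
  let ?M = "density lborel (indicator {\<sigma> l..\<sigma> r}) :: real measure"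
  let ?N = "distr (density lborel (indicator {l..r})) borel \<sigma> :: real measure"
  have sets: "sets ?M = sets ?N" by simp
  have "emeasure ?M A \<le> emeasure ?N A" if A: "A \<in> sets borel" for A
  proof -
    let ?E = "A \<inter> {\<sigma> l..\<sigma> r}" and ?S = "\<sigma> -` A \<inter> {l..r}"
    have SA: "\<sigma> -` A \<in> sets borel" using measurable_sets[of \<sigma> borel borel A] A by simp
    have E: "?E \<in> sets borel" and S: "?S \<in> sets borel" using A SA by auto
    have fin: "emeasure lborel ?E < \<infinity>" "emeasure lborel ?S < \<infinity>"
      by (intro emeasure_bounded_finite bounded_subset[OF bounded_closed_interval]; blast)+
    have "?E \<subseteq> \<sigma> ` ?S" using img by auto
    then have "measure lebesgue ?E \<le> measure lebesgue ?S"
      using E S fin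
      by (intro measure_monotone_contraction_image[OF mono contr, of _ l r]) (auto simp: fmeasurable_def)
    then have "measure lborel ?E \<le> measure lborel ?S" using E S by simp
    then have le: "emeasure lborel ?E \<le> emeasure lborel ?S"
      using fin by (simp add: emeasure_eq_ennreal_measure)
    have "emeasure ?M A = emeasure lborel ?E"
      using A by (simp add: emeasure_density indicator_inter_arith[symmetric] Int_commute mult.commute)
    moreover have "emeasure ?N A = emeasure lborel ?S"
      using A SA by (simp add: emeasure_distr emeasure_density indicator_inter_arith[symmetric] Int_commute mult.commute)
    ultimately show ?thesis using le by simp
  qed
  then have "?M \<le> ?N" by (subst le_measure[OF sets]) (auto simp: le_fun_def emeasure_notin_sets)
  then have "nn_integral ?M g \<le> nn_integral ?N g"
    by (intro nn_integral_mono_measure sets)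
  then show ?thesis
    by (simp add: nn_integral_density nn_integral_distr mult.commute)
qed

section \<open>Sublinearity of the mixed fibre function\<close>

text \<open>
  This polarizes \<open>fiber_fn\<close>, which is quadratic in the body. It is twice the support function of
  the mixed fibre body.
\<close>

definition mixed_fiber_fn :: "space3 set \<Rightarrow> space3 set \<Rightarrow> plane \<Rightarrow> real" where
  "mixed_fiber_fn A B u = fiber_fn (A + B) u - fiber_fn A u - fiber_fn B u"

lemma slice_fn_attained:
  assumes "compact A" "s \<in> snd ` A"
  obtains z where "(z, s) \<in> A" "inner z u = slice_fn A s u"
proof -
  have "slice A s \<noteq> {}" using assms(2) by (simp only: slice_empty_iff not_not)
  then obtain z where "z \<in> slice A s" "inner z u = slice_fn A s u"
    using support_fn_attained[OF slice_compact[OF assms(1)]] by blast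
  then show ?thesis using that[of z] by (simp only: slice_def mem_Collect_eq)
qed

lemma slice_fn_upper:
  assumes "compact A" "(z, s) \<in> A" shows "inner z u \<le> slice_fn A s u"
  using assms(2) by (intro support_fn_upper slice_compact assms(1)) (simp only: slice_def mem_Collect_eq)

lemma mem_base: "(z, s) \<in> A \<Longrightarrow> s \<in> snd ` A"
  by (metis imageI snd_conv)

lemma slice_fn_sum_ge:
  assumes A: "compact A" and B: "compact B" and st: "s \<in> snd ` A" "t \<in> snd ` B"
  shows "slice_fn A s u + slice_fn B t u \<le> slice_fn (A + B) (s + t) u"
proof -
  obtain y z where y: "(y, s) \<in> A" "inner y u = slice_fn A s u" and z: "(z, t) \<in> B" "inner z u = slice_fn B t u"
    using slice_fn_attained[OF A st(1)] slice_fn_attained[OF B st(2)] by metis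
  have "(y, s) + (z, t) \<in> A + B" using y(1) z(1) by (rule set_plus_intro)
  then have "inner (y + z) u \<le> slice_fn (A + B) (s + t) u"
    by (intro slice_fn_upper compact_set_plus A B) simp
  then show ?thesis using y(2) z(2) by (simp add: inner_add_left)
qed

text \<open>
  Concavity of \<open>s \<mapsto> slice_fn A s u\<close> in the form of an exchange inequality: moving two arguments towards
  each other by the same amount does not decrease the sum of the values.
\<close>

lemma slice_fn_exchange:
  assumes A: "compact A" "convex A" and st: "s \<in> snd ` A" "t \<in> snd ` A"
    and d: "0 \<le> d" "d \<le> t - s"
  shows "slice_fn A s u + slice_fn A t u \<le> slice_fn A (s + d) u + slice_fn A (t - d) u"
    and "s + d \<in> snd ` A" "t - d \<in> snd ` A"
proof -
  obtain y z where y: "(y, s) \<in> A" "inner y u = slice_fn A s u" and z: "(z, t) \<in> A" "inner z u = slice_fn A t u"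
    using slice_fn_attained[OF A(1) st(1)] slice_fn_attained[OF A(1) st(2)] by metis
  \<comment> \<open>weights for which the convex combinations lie over \<open>s + d\<close> and \<open>t - d\<close>\<close>
  define q where "q = (if t = s then 0 else d / (t - s))"
  have q: "0 \<le> q" "q \<le> 1" "q * (t - s) = d" using d by (auto simp: q_def divide_le_eq_1)
  have "(1 - q) *\<^sub>R (y, s) + q *\<^sub>R (z, t) \<in> A" "q *\<^sub>R (y, s) + (1 - q) *\<^sub>R (z, t) \<in> A"
    using convexD[OF A(2) y(1) z(1), of "1 - q" q] convexD[OF A(2) y(1) z(1), of q "1 - q"] q by simp_all
  moreover have "(1 - q) *\<^sub>R (y, s) + q *\<^sub>R (z, t) = ((1 - q) *\<^sub>R y + q *\<^sub>R z, s + d)"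
    "q *\<^sub>R (y, s) + (1 - q) *\<^sub>R (z, t) = (q *\<^sub>R y + (1 - q) *\<^sub>R z, t - d)"
    using q(3) by (simp_all add: algebra_simps)
  ultimately have mem: "((1 - q) *\<^sub>R y + q *\<^sub>R z, s + d) \<in> A" "(q *\<^sub>R y + (1 - q) *\<^sub>R z, t - d) \<in> A" by simp_all
  show "s + d \<in> snd ` A" "t - d \<in> snd ` A" using mem by (blast intro: mem_base)+
  show "slice_fn A s u + slice_fn A t u \<le> slice_fn A (s + d) u + slice_fn A (t - d) u"
    using slice_fn_upper[OF A(1) mem(1), of u] slice_fn_upper[OF A(1) mem(2), of u] y(2) z(2)
    by (simp add: inner_add_left algebra_simps)
qed

text \<open>
  Let \<open>\<sigma> r\<close> be the least optimal position in \<open>A\<close>. If \<open>\<sigma> r\<close> or \<open>r - \<sigma> r\<close> were to decrease somewhere,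
  then by \<open>slice_fn_exchange\<close> a swap of the two splittings involved would produce, at one of the two
  points, an optimal splitting with a smaller position in \<open>A\<close>.
\<close>

lemma optimal_splitting:
  assumes A: "compact A" "convex A" and B: "compact B" "convex B"
  shows "\<exists>\<sigma>. (\<forall>r\<in>snd ` (A + B). \<sigma> r \<in> snd ` A \<and> r - \<sigma> r \<in> snd ` B \<and>
        slice_fn A (\<sigma> r) w + slice_fn B (r - \<sigma> r) w = slice_fn (A + B) r w) \<and>
      (\<forall>r\<in>snd ` (A + B). \<forall>r'\<in>snd ` (A + B). r \<le> r' \<longrightarrow> \<sigma> r \<le> \<sigma> r' \<and> r - \<sigma> r \<le> r' - \<sigma> r')"
proof -
  define S where "S r = {s. s \<in> snd ` A \<and> r - s \<in> snd ` B \<and>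
      slice_fn A s w + slice_fn B (r - s) w = slice_fn (A + B) r w}" for r
  have AB: "compact (A + B)" by (rule compact_set_plus[OF A(1) B(1)])
  have S_eq: "S r = (\<lambda>q. snd (fst q)) ` ((A \<times> B) \<inter> {q. snd (fst q) + snd (snd q) = r \<and>
      inner (fst (fst q) + fst (snd q)) w = slice_fn (A + B) r w})" for r
  proof
    show "S r \<subseteq> (\<lambda>q. snd (fst q)) ` ((A \<times> B) \<inter> {q. snd (fst q) + snd (snd q) = r \<and>
      inner (fst (fst q) + fst (snd q)) w = slice_fn (A + B) r w})"
    proof
      fix s assume s: "s \<in> S r"
      then have sA: "s \<in> snd ` A" and sB: "r - s \<in> snd ` B" 
        and eq: "slice_fn A s w + slice_fn B (r - s) w = slice_fn (A + B) r w" by (simp_all only: S_def mem_Collect_eq)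
      obtain y where y: "(y, s) \<in> A" "inner y w = slice_fn A s w" by (rule slice_fn_attained[OF A(1) sA])
      obtain z where z: "(z, r - s) \<in> B" "inner z w = slice_fn B (r - s) w" by (rule slice_fn_attained[OF B(1) sB])
      show "s \<in> (\<lambda>q. snd (fst q)) ` ((A \<times> B) \<inter> {q. snd (fst q) + snd (snd q) = r \<and>
          inner (fst (fst q) + fst (snd q)) w = slice_fn (A + B) r w})"
        by (rule image_eqI[of _ _ "((y, s), (z, r - s))"]) (use y z eq in \<open>simp_all add: inner_add_left\<close>)
    qed
    show "(\<lambda>q. snd (fst q)) ` ((A \<times> B) \<inter> {q. snd (fst q) + snd (snd q) = r \<and>
      inner (fst (fst q) + fst (snd q)) w = slice_fn (A + B) r w}) \<subseteq> S r"
    proof (rule image_subsetI)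
      fix q assume q: "q \<in> (A \<times> B) \<inter> {q. snd (fst q) + snd (snd q) = r \<and>
        inner (fst (fst q) + fst (snd q)) w = slice_fn (A + B) r w}"
      define y where "y = fst (fst q)"
      define z where "z = fst (snd q)"
      define s where "s = snd (fst q)"
      define t where "t = snd (snd q)"
      have as: "(y, s) \<in> A" "(z, t) \<in> B" "s + t = r" "inner (y + z) w = slice_fn (A + B) r w"
        using q by (simp_all add: y_def z_def s_def t_def mem_Times_iff)
      have st: "s \<in> snd ` A" "t \<in> snd ` B" using as(1,2) by (blast intro: mem_base)+
      have "slice_fn (A + B) r w \<le> slice_fn A s w + slice_fn B t w"
        using slice_fn_upper[OF A(1) as(1), of w] slice_fn_upper[OF B(1) as(2), of w] as(4)
        unfolding inner_add_left by linarith
      then have "slice_fn A s w + slice_fn B t w = slice_fn (A + B) r w"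
        using slice_fn_sum_ge[OF A(1) B(1) st, of w] as(3) by simp
      moreover have "r - s = t" using as(3) by simp
      ultimately show "snd (fst q) \<in> S r"
        using st by (simp add: S_def s_def[symmetric])
    qed
  qed
  have compact: "compact (S r)" for r
  proof -
    have "closed {q :: space3 \<times> space3. snd (fst q) + snd (snd q) = r \<and>
      inner (fst (fst q) + fst (snd q)) w = slice_fn (A + B) r w}"
      by (intro closed_Collect_conj closed_Collect_eq continuous_intros)
    then show ?thesis unfolding S_eq
      by (intro compact_continuous_image compact_Int_closed compact_Times A B continuous_intros)
  qed
  have ne: "S r \<noteq> {}" if r: "r \<in> snd ` (A + B)" for r
  proof -
    obtain x where x: "(x, r) \<in> A + B" "inner x w = slice_fn (A + B) r w" by (rule slice_fn_attained[OF AB r])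
    obtain p q where pq: "(x, r) = p + q" "p \<in> A" "q \<in> B" using x(1) by (rule set_plus_elim)
    have "fst p + fst q = x" "snd p + snd q = r" using pq(1) by (simp_all add: prod_eq_iff)
    then have "(p, q) \<in> (A \<times> B) \<inter> {q. snd (fst q) + snd (snd q) = r \<and>
      inner (fst (fst q) + fst (snd q)) w = slice_fn (A + B) r w}" using pq x(2) by simp
    then show ?thesis unfolding S_eq by blast
  qed
  define \<sigma> where "\<sigma> r = Inf (S r)" for r
  have \<sigma>: "\<sigma> r \<in> S r" and least: "\<And>s. s \<in> S r \<Longrightarrow> \<sigma> r \<le> s" if "r \<in> snd ` (A + B)" for r
  proof -
    show "\<sigma> r \<in> S r" unfolding \<sigma>_def using compact[of r] ne[OF that]
      by (intro closed_contains_Inf bounded_imp_bdd_below compact_imp_bounded compact_imp_closed)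
    show "\<sigma> r \<le> s" if "s \<in> S r" for s
      unfolding \<sigma>_def using that compact[of r] by (intro cInf_lower bounded_imp_bdd_below compact_imp_bounded)
  qed
  show ?thesis
  proof (rule exI[of _ \<sigma>], rule conjI; intro ballI impI)
    show "\<sigma> r \<in> snd ` A \<and> r - \<sigma> r \<in> snd ` B \<and>
      slice_fn A (\<sigma> r) w + slice_fn B (r - \<sigma> r) w = slice_fn (A + B) r w" if "r \<in> snd ` (A + B)" for r
      using \<sigma>[OF that] by (simp only: S_def mem_Collect_eq)
    fix r r' assume r: "r \<in> snd ` (A + B)" and r': "r' \<in> snd ` (A + B)" and le: "r \<le> r'"
    define s where "s = \<sigma> r"
    define t where "t = r - \<sigma> r"
    define s' where "s' = \<sigma> r'"
    define t' where "t' = r' - \<sigma> r'"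
    have st: "s \<in> snd ` A" "t \<in> snd ` B" "slice_fn A s w + slice_fn B t w = slice_fn (A + B) r w" "r = s + t"
      using \<sigma>[OF r] by (simp_all add: S_def s_def t_def)
    have st': "s' \<in> snd ` A" "t' \<in> snd ` B" "slice_fn A s' w + slice_fn B t' w = slice_fn (A + B) r' w" "r' = s' + t'"
      using \<sigma>[OF r'] by (simp_all add: S_def s'_def t'_def)
    have "s \<le> s'"
    proof (rule ccontr)
      assume "\<not> s \<le> s'"
      then have d: "0 \<le> s - s'" "s - s' \<le> t' - t" "s' < s" using le st(4) st'(4) by auto
      note ex = slice_fn_exchange(1)[OF B st(2) st'(2) d(1,2), of w] slice_fn_exchange(2,3)[OF B st(2) st'(2) d(1,2)]
      have "slice_fn A s' w + slice_fn B (t + (s - s')) w \<le> slice_fn (A + B) r w"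
        using slice_fn_sum_ge[OF A(1) B(1) st'(1) ex(2), of w] st(4) by (simp add: add.commute)
      moreover have "slice_fn A s w + slice_fn B (t' - (s - s')) w \<le> slice_fn (A + B) r' w"
        using slice_fn_sum_ge[OF A(1) B(1) st(1) ex(3), of w] st'(4) by (simp add: add.commute)
      ultimately have eq: "slice_fn A s' w + slice_fn B (t + (s - s')) w = slice_fn (A + B) r w"
        using ex(1) st(3) st'(3) by linarith
      have "t + (s - s') = r - s'" using st(4) by simp
      then have "s' \<in> S r" using ex(2) st'(1) eq by (simp only: S_def mem_Collect_eq simp_thms)
      from least[OF r this] show False using d(3) by (simp add: s_def)
    qed
    moreover have "t \<le> t'"
    proof (rule ccontr)
      assume "\<not> t \<le> t'"
      then have d: "0 \<le> t - t'" "t - t' \<le> s' - s" "t' < t" using le st(4) st'(4) by auto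
      note ex = slice_fn_exchange(1)[OF A st(1) st'(1) d(1,2), of w] slice_fn_exchange(2,3)[OF A st(1) st'(1) d(1,2)]
      have "slice_fn A (s + (t - t')) w + slice_fn B t' w \<le> slice_fn (A + B) r w"
        using slice_fn_sum_ge[OF A(1) B(1) ex(2) st'(2), of w] st(4) by (simp add: add.commute)
      moreover have "slice_fn A (s' - (t - t')) w + slice_fn B t w \<le> slice_fn (A + B) r' w"
        using slice_fn_sum_ge[OF A(1) B(1) ex(3) st(2), of w] st'(4) by (simp add: add.commute)
      ultimately have eq: "slice_fn A (s' - (t - t')) w + slice_fn B t w = slice_fn (A + B) r' w"
        using ex(1) st(3) st'(3) by linarith
      have "r' - (s' - (t - t')) = t" using st'(4) by simp
      then have "s' - (t - t') \<in> S r'" using ex(3) st(2) eq by (simp only: S_def mem_Collect_eq simp_thms)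
      from least[OF r' this] show False using d(3) by (simp add: s'_def)
    qed
    ultimately show "\<sigma> r \<le> \<sigma> r' \<and> r - \<sigma> r \<le> r' - \<sigma> r'" by (simp add: s_def t_def s'_def t'_def)
  qed
qed

lemma base_interval:
  assumes "compact A" "convex A" "A \<noteq> {}"
  obtains l r where "l \<le> r" "snd ` (A :: space3 set) = {l..r}"
proof -
  have "compact (snd ` A)" using assms by (intro compact_continuous_image continuous_intros)
  moreover have "connected (snd ` A)" using assms
    by (intro connected_continuous_image convex_connected continuous_intros)
  ultimately have "\<exists>l r. snd ` A = {l..r}" unfolding connected_compact_interval_1[symmetric] by (intro conjI)
  then obtain l r where lr: "snd ` A = {l..r}" by (elim exE)
  have "snd ` A \<noteq> {}" using assms(3) by (simp only: image_is_empty not_False_eq_True)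
  then have "l \<le> r" unfolding lr by simp
  then show ?thesis using lr by (rule that)
qed

lemma base_sum:
  assumes "snd ` A = {l..r}" "snd ` B = {l'..r'}" "l \<le> r" "l' \<le> (r' :: real)"
  shows "snd ` (A + B) = {l + l'..r + r'}"
proof -
  have "snd ` (A + B) = snd ` A + snd ` B"
  proof
    show "snd ` (A + B) \<subseteq> snd ` A + snd ` B"
    proof (rule image_subsetI)
      fix x assume "x \<in> A + B"
      then obtain p q where "p \<in> A" "q \<in> B" "x = p + q" by (elim set_plus_elim)
      then show "snd x \<in> snd ` A + snd ` B" by (simp only: snd_add set_plus_intro imageI)
    qed
    show "snd ` A + snd ` B \<subseteq> snd ` (A + B)"
    proof
      fix x assume "x \<in> snd ` A + snd ` B"
      then obtain p q where "p \<in> A" "q \<in> B" "x = snd (p + q)" by (auto elim!: set_plus_elim)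
      then show "x \<in> snd ` (A + B)" by (blast intro: set_plus_intro)
    qed
  qed
  also have "\<dots> = {l + l'..r + r'}"
  proof (intro equalityI subsetI)
    fix x assume x: "x \<in> {l + l'..r + r'}"
    \<comment> \<open>the least admissible first summand\<close>
    have "max l (x - r') + (x - max l (x - r')) \<in> {l..r} + {l'..r'}"
      using x assms(3,4) by (intro set_plus_intro) auto
    then show "x \<in> snd ` A + snd ` B" by (simp add: assms)
  qed (auto simp: assms elim!: set_plus_elim)
  finally show ?thesis .
qed

definition subadd_defect :: "(plane \<Rightarrow> real) \<Rightarrow> plane \<Rightarrow> plane \<Rightarrow> real" where
  "subadd_defect h u v = h u + h v - h (u + v)"

text \<open>
  Defects of subadditivity are nonnegative, so they can be compared as nonnegative integrals.
\<close>

lemma defect_integral: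
  assumes A: "compact A"
  shows "(\<integral>\<^sup>+s. ennreal (subadd_defect (slice_fn A s) u v) \<partial>lborel) = ennreal (subadd_defect (fiber_fn A) u v)"
    and "0 \<le> subadd_defect (slice_fn A s) u v" "0 \<le> subadd_defect (fiber_fn A) u v"
proof -
  show nn: "0 \<le> subadd_defect (slice_fn A s) u v" for s
    using sublinear_add[OF slice_fn_sublinear[OF A]] by (simp add: subadd_defect_def)
  show "0 \<le> subadd_defect (fiber_fn A) u v"
    using sublinear_add[OF fiber_fn_sublinear[OF A]] by (simp add: subadd_defect_def)
  have "has_bochner_integral lborel (\<lambda>s. subadd_defect (slice_fn A s) u v) (subadd_defect (fiber_fn A) u v)"
    unfolding subadd_defect_def fiber_fn_def
    by (intro has_bochner_integral_diff has_bochner_integral_add has_bochner_integral_integrable slice_fn_integrable A)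
  then show "(\<integral>\<^sup>+s. ennreal (subadd_defect (slice_fn A s) u v) \<partial>lborel) = ennreal (subadd_defect (fiber_fn A) u v)"
    using nn by (subst nn_integral_eq_integral) (auto simp: has_bochner_integral_iff)
qed

text \<open>
  Split \<open>x\<close> optimally in the direction \<open>u + v\<close>. For \<open>u\<close> and for \<open>v\<close> the same splitting is merely
  admissible, so the defect of \<open>A + B\<close> at \<open>x\<close> is at least the sum of the defects of \<open>A\<close> at \<open>\<sigma> x\<close> and
  of \<open>B\<close> at \<open>x - \<sigma> x\<close>. Integrated over \<open>x\<close>, these are at least the defects of the fibre functions of
  \<open>A\<close> and \<open>B\<close>, since both positions are monotone contractions onto the respective bases.
\<close>

lemma mixed_fiber_fn_subadditive:
  assumes A: "compact A" "convex A" "A \<noteq> {}" and B: "compact B" "convex B" "B \<noteq> {}"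
  shows "mixed_fiber_fn A B (u + v) \<le> mixed_fiber_fn A B u + mixed_fiber_fn A B v"
proof -
  define w where "w = u + v"
  obtain \<sigma> where \<sigma>: "\<forall>r\<in>snd ` (A + B). \<sigma> r \<in> snd ` A \<and> r - \<sigma> r \<in> snd ` B \<and>
      slice_fn A (\<sigma> r) w + slice_fn B (r - \<sigma> r) w = slice_fn (A + B) r w"
    and path: "\<forall>r\<in>snd ` (A + B). \<forall>r'\<in>snd ` (A + B). r \<le> r' \<longrightarrow> \<sigma> r \<le> \<sigma> r' \<and> r - \<sigma> r \<le> r' - \<sigma> r'"
    using optimal_splitting[OF A(1,2) B(1,2), of w] by (elim exE conjE)
  obtain a1 a2 where a: "a1 \<le> a2" "snd ` A = {a1..a2}" by (rule base_interval[OF A])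
  obtain b1 b2 where b: "b1 \<le> b2" "snd ` B = {b1..b2}" by (rule base_interval[OF B])
  note ab = base_sum[OF a(2) b(2) a(1) b(1)]
  define l where "l = a1 + b1"
  define r where "r = a2 + b2"
  have lr: "l \<le> r" using a b by (simp add: l_def r_def)
  have base: "snd ` (A + B) = {l..r}" by (simp add: ab l_def r_def)
  have AB: "compact (A + B)" by (rule compact_set_plus[OF A(1) B(1)])
  \<comment> \<open>extends both positions to the whole line, keeping them monotone contractions\<close>
  define clamp where "clamp x = max l (min r x)" for x
  define \<sigma>A where "\<sigma>A x = \<sigma> (clamp x)" for x
  define \<sigma>B where "\<sigma>B x = clamp x - \<sigma> (clamp x)" for x
  have clamp: "clamp x \<in> {l..r}" for x using lr by (auto simp: clamp_def)
  have clamp_mono: "clamp x \<le> clamp y" "clamp y - clamp x \<le> y - x" if "x \<le> y" for x y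
    using that lr by (auto simp: clamp_def max_def min_def)
  have mono: "\<sigma>A x \<le> \<sigma>A y" "\<sigma>B x \<le> \<sigma>B y" if "x \<le> y" for x y
    using path[unfolded base, rule_format, OF clamp clamp clamp_mono(1)[OF that]] by (simp_all add: \<sigma>A_def \<sigma>B_def)
  have contr: "\<sigma>A y - \<sigma>A x \<le> y - x" "\<sigma>B y - \<sigma>B x \<le> y - x" if "x \<le> y" for x y
    using mono[OF that] clamp_mono(2)[OF that] unfolding \<sigma>A_def \<sigma>B_def by linarith+
  \<comment> \<open>on the base of \<open>A + B\<close> the clamp does nothing\<close>
  have on: "\<sigma>A x \<in> {a1..a2}" "\<sigma>B x \<in> {b1..b2}" "\<sigma>A x + \<sigma>B x = x"
    "slice_fn A (\<sigma>A x) w + slice_fn B (\<sigma>B x) w = slice_fn (A + B) x w" if "x \<in> {l..r}" for x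
  proof -
    have "clamp x = x" using that by (auto simp: clamp_def)
    then show "\<sigma>A x \<in> {a1..a2}" "\<sigma>B x \<in> {b1..b2}" "\<sigma>A x + \<sigma>B x = x"
      "slice_fn A (\<sigma>A x) w + slice_fn B (\<sigma>B x) w = slice_fn (A + B) x w"
      using \<sigma>[unfolded base a(2) b(2), rule_format, OF that] that unfolding \<sigma>A_def \<sigma>B_def by simp_all
  qed
  have ends: "\<sigma>A l = a1" "\<sigma>A r = a2" "\<sigma>B l = b1" "\<sigma>B r = b2"
    using on(1-3)[of l] on(1-3)[of r] lr by (auto simp: l_def r_def)
  have meas: "(\<lambda>s. ennreal (subadd_defect (slice_fn Z s) u v)) \<in> borel_measurable borel" if "compact Z" for Z
    unfolding subadd_defect_def using that by measurable
  have outside: "subadd_defect (slice_fn Z s) u v = 0" if "s \<notin> snd ` Z" for Z s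
    by (simp add: subadd_defect_def slice_fn_outside[OF that])
  have restrict: "(\<integral>\<^sup>+s\<in>snd ` Z. ennreal (subadd_defect (slice_fn Z s) u v) \<partial>lborel) = ennreal (subadd_defect (fiber_fn Z) u v)"
    if Z: "compact Z" for Z
  proof -
    have "(\<integral>\<^sup>+s\<in>snd ` Z. ennreal (subadd_defect (slice_fn Z s) u v) \<partial>lborel) = (\<integral>\<^sup>+s. ennreal (subadd_defect (slice_fn Z s) u v) \<partial>lborel)"
    proof (rule nn_integral_cong)
      fix s
      show "ennreal (subadd_defect (slice_fn Z s) u v) * indicator (snd ` Z) s = ennreal (subadd_defect (slice_fn Z s) u v)"
        by (cases "s \<in> snd ` Z") (simp_all only: outside indicator_simps mult_1_right mult_zero_right ennreal_0 not_False_eq_True)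
    qed
    then show ?thesis by (simp only: defect_integral(1)[OF Z])
  qed
  have "ennreal (subadd_defect (fiber_fn A) u v) + ennreal (subadd_defect (fiber_fn B) u v)
    \<le> (\<integral>\<^sup>+x\<in>{l..r}. ennreal (subadd_defect (slice_fn A (\<sigma>A x)) u v) \<partial>lborel)
      + (\<integral>\<^sup>+x\<in>{l..r}. ennreal (subadd_defect (slice_fn B (\<sigma>B x)) u v) \<partial>lborel)"
  proof (rule add_mono)
    show "ennreal (subadd_defect (fiber_fn A) u v) \<le> (\<integral>\<^sup>+x\<in>{l..r}. ennreal (subadd_defect (slice_fn A (\<sigma>A x)) u v) \<partial>lborel)"
      using nn_integral_monotone_contraction[OF mono(1) contr(1) lr meas[OF A(1)]] restrict[OF A(1)]
      by (simp add: ends a(2))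
    show "ennreal (subadd_defect (fiber_fn B) u v) \<le> (\<integral>\<^sup>+x\<in>{l..r}. ennreal (subadd_defect (slice_fn B (\<sigma>B x)) u v) \<partial>lborel)"
      using nn_integral_monotone_contraction[OF mono(2) contr(2) lr meas[OF B(1)]] restrict[OF B(1)]
      by (simp add: ends b(2))
  qed
  also have "\<dots> = (\<integral>\<^sup>+x\<in>{l..r}. (ennreal (subadd_defect (slice_fn A (\<sigma>A x)) u v) + ennreal (subadd_defect (slice_fn B (\<sigma>B x)) u v)) \<partial>lborel)"
  proof -
    have "mono \<sigma>A" "mono \<sigma>B" using mono by (auto intro: monoI)
    then have m: "\<sigma>A \<in> borel_measurable borel" "\<sigma>B \<in> borel_measurable borel"
      by (auto intro: borel_measurable_mono)
    have [measurable]: "(\<lambda>x. ennreal (subadd_defect (slice_fn A (\<sigma>A x)) u v)) \<in> borel_measurable borel"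
      "(\<lambda>x. ennreal (subadd_defect (slice_fn B (\<sigma>B x)) u v)) \<in> borel_measurable borel"
      by (rule measurable_compose[OF m(1) meas[OF A(1)]], rule measurable_compose[OF m(2) meas[OF B(1)]])
    show ?thesis by (subst nn_integral_add[symmetric]) (auto simp: distrib_right)
  qed
  also have "\<dots> \<le> (\<integral>\<^sup>+x\<in>{l..r}. ennreal (subadd_defect (slice_fn (A + B) x) u v) \<partial>lborel)"
  proof (rule nn_integral_mono)
    fix x
    show "(ennreal (subadd_defect (slice_fn A (\<sigma>A x)) u v) + ennreal (subadd_defect (slice_fn B (\<sigma>B x)) u v)) * indicator {l..r} x
      \<le> ennreal (subadd_defect (slice_fn (A + B) x) u v) * indicator {l..r} x"
    proof (cases "x \<in> {l..r}")
      case True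
      note o = on[OF True]
      have "slice_fn A (\<sigma>A x) y + slice_fn B (\<sigma>B x) y \<le> slice_fn (A + B) x y" for y
        using slice_fn_sum_ge[OF A(1) B(1), of "\<sigma>A x" "\<sigma>B x" y] o unfolding a(2) b(2) by simp
      from this[of u] this[of v]
      have "subadd_defect (slice_fn A (\<sigma>A x)) u v + subadd_defect (slice_fn B (\<sigma>B x)) u v \<le> subadd_defect (slice_fn (A + B) x) u v"
        using o(4) by (simp add: subadd_defect_def w_def)
      then show ?thesis
        using True defect_integral(2)[OF A(1)] defect_integral(2)[OF B(1)]
        by (simp add: ennreal_plus[symmetric] ennreal_leI del: ennreal_plus)
    qed simp
  qed
  also have "\<dots> = ennreal (subadd_defect (fiber_fn (A + B)) u v)"
    using restrict[OF AB] by (simp only: base)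
  finally have "subadd_defect (fiber_fn A) u v + subadd_defect (fiber_fn B) u v \<le> subadd_defect (fiber_fn (A + B)) u v"
    using defect_integral(3)[OF A(1)] defect_integral(3)[OF B(1)] defect_integral(3)[OF AB]
    by (simp add: ennreal_plus[symmetric] del: ennreal_plus)
  then show ?thesis by (simp add: mixed_fiber_fn_def subadd_defect_def)
qed

lemma mixed_fiber_fn_sublinear:
  assumes A: "compact A" "convex A" "A \<noteq> {}" and B: "compact B" "convex B" "B \<noteq> {}"
  shows "sublinear (mixed_fiber_fn A B)"
  unfolding sublinear_def
proof (intro conjI allI impI)
  show "mixed_fiber_fn A B (u + v) \<le> mixed_fiber_fn A B u + mixed_fiber_fn A B v" for u v
    by (rule mixed_fiber_fn_subadditive[OF A B])
  fix r :: real and u assume r: "0 \<le> r"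
  show "mixed_fiber_fn A B (r *\<^sub>R u) = r * mixed_fiber_fn A B u"
    unfolding mixed_fiber_fn_def
    by (simp only: sublinear_scale[OF fiber_fn_sublinear r] compact_set_plus A B) (simp add: algebra_simps)
qed

section \<open>Polarization over pairs of bodies\<close>

lemma base_length_sum:
  assumes A: "compact A" "convex A" "A \<noteq> {}" and B: "compact B" "convex B" "B \<noteq> {}"
  shows "base_length (A + B) = base_length A + base_length B"
proof -
  obtain l r where lr: "l \<le> r" "snd ` A = {l..r}" by (rule base_interval[OF A])
  obtain l' r' where lr': "l' \<le> r'" "snd ` B = {l'..r'}" by (rule base_interval[OF B])
  show ?thesis
    using base_sum[OF lr(2) lr'(2) lr(1) lr'(1)] lr lr' by (simp add: base_length_def)
qed

lemma mixed_form_fiber_fn_sum: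
  assumes A: "compact A" "convex A" "A \<noteq> {}" and B: "compact B" "convex B" "B \<noteq> {}" and k: "sublinear k"
  shows "mixed_form (fiber_fn (A + B)) k
    = mixed_form (mixed_fiber_fn A B) k + mixed_form (fiber_fn A) k + mixed_form (fiber_fn B) k"
proof -
  note f = fiber_fn_sublinear[OF A(1)] fiber_fn_sublinear[OF B(1)]
  note m = mixed_fiber_fn_sublinear[OF A B]
  have "fiber_fn (A + B) = (\<lambda>u. (mixed_fiber_fn A B u + fiber_fn A u) + fiber_fn B u)"
    by (rule ext) (simp add: mixed_fiber_fn_def)
  then show ?thesis
    by (simp only: mixed_form_add[OF sublinear_plus[OF m f(1)] f(2) k] mixed_form_add[OF m f(1) k])
qed

lemma sheared_sum_polarization:
  assumes bodies: "convex_body A1" "convex_body A2" "convex_body B1" "convex_body B2"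
  defines "v \<equiv> \<lambda>X Y. measure lborel (sheared_sum X Y)"
  shows "v (A1 + A2) (B1 + B2) - v (A1 + A2) B1 - v (A1 + A2) B2 - v A1 (B1 + B2) - v A2 (B1 + B2)
      + v A1 B1 + v A1 B2 + v A2 B1 + v A2 B2
    = mixed_form (mixed_fiber_fn A1 A2) (mixed_fiber_fn B1 B2)"
proof -
  have A1: "compact A1" "convex A1" "A1 \<noteq> {}" and A2: "compact A2" "convex A2" "A2 \<noteq> {}"
    and B1: "compact B1" "convex B1" "B1 \<noteq> {}" and B2: "compact B2" "convex B2" "B2 \<noteq> {}"
    using bodies by (simp_all add: convex_body_def)
  have A: "compact (A1 + A2)" "convex (A1 + A2)" "A1 + A2 \<noteq> {}" and B: "compact (B1 + B2)" "convex (B1 + B2)" "B1 + B2 \<noteq> {}"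
    using convex_body_plus[OF bodies(1,2)] convex_body_plus[OF bodies(3,4)] by (simp_all add: convex_body_def)
  have v: "v X Y = base_length Y * slice_volume X + mixed_form (fiber_fn X) (fiber_fn Y) + base_length X * slice_volume Y"
    if "compact X" "convex X" "compact Y" "convex Y" for X Y
    unfolding v_def by (rule measure_sheared_sum[OF that])
  note sub = fiber_fn_sublinear[OF A1(1)] fiber_fn_sublinear[OF A2(1)] fiber_fn_sublinear[OF B1(1)] fiber_fn_sublinear[OF B2(1)]
    fiber_fn_sublinear[OF A(1)] fiber_fn_sublinear[OF B(1)]
  have left: "mixed_form (fiber_fn (A1 + A2)) k = mixed_form (mixed_fiber_fn A1 A2) k + mixed_form (fiber_fn A1) k + mixed_form (fiber_fn A2) k"
    if "sublinear k" for k by (rule mixed_form_fiber_fn_sum[OF A1 A2 that])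
  have right: "mixed_form k (fiber_fn (B1 + B2)) = mixed_form k (mixed_fiber_fn B1 B2) + mixed_form k (fiber_fn B1) + mixed_form k (fiber_fn B2)"
    if "sublinear k" for k
    using mixed_form_fiber_fn_sum[OF B1 B2 that] by (simp only: mixed_form_commute[of k])
  note lengths = base_length_sum[OF A1 A2] base_length_sum[OF B1 B2]
  note m = mixed_fiber_fn_sublinear[OF A1 A2]
  show ?thesis
    by (simp only: v[OF A(1,2) B(1,2)] v[OF A(1,2) B1(1,2)] v[OF A(1,2) B2(1,2)] v[OF A1(1,2) B(1,2)] v[OF A2(1,2) B(1,2)]
        v[OF A1(1,2) B1(1,2)] v[OF A1(1,2) B2(1,2)] v[OF A2(1,2) B1(1,2)] v[OF A2(1,2) B2(1,2)]
        left[OF sub(6)] left[OF sub(3)] left[OF sub(4)] right[OF m] right[OF sub(1)] right[OF sub(2)] lengths)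
      (simp add: algebra_simps)
qed

section \<open>Coordinates adapted to a linear functional\<close>

lemma lborel_eq_distr_coordinates:
  fixes b1 b2 b3 :: "'a::euclidean_space"
  assumes basis: "Basis = {b1, b2, b3}" "b1 \<noteq> b2" "b1 \<noteq> b3" "b2 \<noteq> b3"
  defines "J \<equiv> \<lambda>v :: space3. fst (fst v) *\<^sub>R b1 + snd (fst v) *\<^sub>R b2 + snd v *\<^sub>R b3"
  shows "(lborel :: 'a measure) = distr lborel borel J"
proof (rule lborel_eqI)
  have b: "b1 \<in> Basis" "b2 \<in> Basis" "b3 \<in> Basis" using basis(1) by auto
  have ip: "inner b1 b1 = 1" "inner b2 b2 = 1" "inner b3 b3 = 1" "inner b1 b2 = 0" "inner b1 b3 = 0" "inner b2 b3 = 0"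
     "inner b2 b1 = 0" "inner b3 b1 = 0" "inner b3 b2 = 0"
    using b basis(2-4) by (auto simp: inner_Basis)
  have J: "inner (J v) b1 = fst (fst v)" "inner (J v) b2 = snd (fst v)" "inner (J v) b3 = snd v" for v
    by (simp_all add: J_def inner_add_left ip)
  have meas: "J \<in> borel_measurable borel"
    unfolding J_def by (intro borel_measurable_continuous_onI continuous_intros)
  fix l u :: 'a assume le: "\<And>b. b \<in> Basis \<Longrightarrow> inner l b \<le> inner u b"
  have "J -` box l u = ({inner l b1<..<inner u b1} \<times> {inner l b2<..<inner u b2}) \<times> {inner l b3<..<inner u b3}"
    by (auto simp: box_def basis(1) J)
  then have "emeasure (distr lborel borel J) (box l u)
      = emeasure lborel (({inner l b1<..<inner u b1} \<times> {inner l b2<..<inner u b2}) \<times> {inner l b3<..<inner u b3})"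
    using meas by (subst emeasure_distr) auto
  also have "\<dots> = emeasure lborel {inner l b1<..<inner u b1} * emeasure lborel {inner l b2<..<inner u b2} * emeasure lborel {inner l b3<..<inner u b3}"
    unfolding lborel_prod[symmetric] 
    by (subst lborel.emeasure_pair_measure_Times; (subst lborel.emeasure_pair_measure_Times)?) (auto simp: lborel_prod)
  also have "\<dots> = ennreal (\<Prod>b\<in>Basis. inner (u - l) b)"
    using basis(2-4) le b by (simp add: basis(1) ennreal_mult inner_diff_left mult.assoc)
  finally show "emeasure (distr lborel borel J) (box l u) = ennreal (\<Prod>b\<in>Basis. inner (u - l) b)" .
qed simp

text \<open>
  The coordinates with respect to \<open>b1, b2, b3\<close> preserve the measure, and \<open>\<Phi>\<close> differs from them by an affine
  substitution in the last coordinate alone.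
\<close>

lemma emeasure_coordinates:
  fixes \<xi> :: "'a::euclidean_space \<Rightarrow> real"
  assumes \<xi>: "linear \<xi>" and basis: "Basis = {b1, b2, b3}" "b1 \<noteq> b2" "b1 \<noteq> b3" "b2 \<noteq> b3" and b3: "\<xi> b3 \<noteq> 0"
  defines "\<Phi> \<equiv> \<lambda>w. ((inner w b1, inner w b2), \<xi> w)"
  assumes E: "compact E"
  shows "emeasure lborel (\<Phi> ` E) = ennreal \<bar>\<xi> b3\<bar> * emeasure lborel E"
proof -
  define J where "J = (\<lambda>v :: space3. fst (fst v) *\<^sub>R b1 + snd (fst v) *\<^sub>R b2 + snd v *\<^sub>R b3)"
  define c where "c v = fst v * \<xi> b1 + snd v * \<xi> b2" for v :: plane
  have b: "b1 \<in> Basis" "b2 \<in> Basis" "b3 \<in> Basis" using basis(1) by auto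
  have ip: "inner b1 b1 = 1" "inner b2 b2 = 1" "inner b3 b3 = 1" "inner b1 b2 = 0" "inner b1 b3 = 0" "inner b2 b3 = 0"
     "inner b2 b1 = 0" "inner b3 b1 = 0" "inner b3 b2 = 0"
    using b basis(2-4) by (auto simp: inner_Basis)
  have rep: "w = J ((inner w b1, inner w b2), inner w b3)" for w :: 'a
    using euclidean_representation[of w] basis(2-4) by (simp add: basis(1) J_def add.assoc)
  have \<xi>J: "\<xi> (J (v, z)) = c v + \<xi> b3 * z" for v z
    by (simp add: J_def c_def linear_add[OF \<xi>] linear_scale[OF \<xi>])
  have \<Phi>J: "\<Phi> (J (v, z)) = (v, c v + \<xi> b3 * z)" for v z
    by (simp add: \<Phi>_def \<xi>J) (simp add: J_def inner_add_left ip)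
  have J_cont: "continuous_on UNIV J" unfolding J_def by (intro continuous_intros)
  have \<Phi>_cont: "continuous_on S \<Phi>" for S
    unfolding \<Phi>_def using linear_continuous_on[OF \<xi>[unfolded linear_conv_bounded_linear]] by (intro continuous_intros)
  have JE: "J -` E \<in> sets borel"
    using compact_imp_closed[OF E] J_cont by (intro borel_closed closed_vimage) (auto simp: continuous_on_eq_continuous_at)
  have \<Phi>E: "\<Phi> ` E \<in> sets borel"
    by (intro borel_compact compact_continuous_image \<Phi>_cont E)
  have \<Phi>E': "\<Phi> ` E \<in> sets ((lborel :: plane measure) \<Otimes>\<^sub>M (lborel :: real measure))"
    and JE': "J -` E \<in> sets ((lborel :: plane measure) \<Otimes>\<^sub>M (lborel :: real measure))"
    using \<Phi>E JE by (simp_all only: lborel_prod sets_lborel)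
  have slice: "Pair v -` (\<Phi> ` E) = {t. (v, (t - c v) / \<xi> b3) \<in> J -` E}" for v
  proof (intro set_eqI iffI)
    fix t assume "t \<in> Pair v -` (\<Phi> ` E)"
    then obtain w where w: "w \<in> E" "\<Phi> w = (v, t)" by auto
    define z where "z = inner w b3"
    have v: "v = (inner w b1, inner w b2)" using w(2) by (simp add: \<Phi>_def)
    have "J (v, z) = w" using rep[of w] by (simp add: v z_def)
    then have "t = c v + \<xi> b3 * z" using \<Phi>J[of v z] w(2) by simp
    then have "(t - c v) / \<xi> b3 = z" using b3 by simp
    then show "t \<in> {t. (v, (t - c v) / \<xi> b3) \<in> J -` E}" using \<open>J (v, z) = w\<close> w(1) by simp
  next
    fix t assume "t \<in> {t. (v, (t - c v) / \<xi> b3) \<in> J -` E}"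
    then have "\<Phi> (J (v, (t - c v) / \<xi> b3)) \<in> \<Phi> ` E" by auto
    then show "t \<in> Pair v -` (\<Phi> ` E)" using b3 by (simp add: \<Phi>J)
  qed
  have scale: "emeasure lborel {t. (v, (t - c v) / \<xi> b3) \<in> J -` E} = ennreal \<bar>\<xi> b3\<bar> * emeasure lborel (Pair v -` (J -` E))" for v
  proof -
    let ?F = "{t. (v, (t - c v) / \<xi> b3) \<in> J -` E}"
    have F: "?F \<in> sets borel" using sets_Pair1[OF \<Phi>E', of v] unfolding slice by (simp only: sets_lborel)
    have G: "Pair v -` (J -` E) \<in> sets borel" using sets_Pair1[OF JE', of v] by (simp only: sets_lborel)
    have "emeasure lborel ?F = (\<integral>\<^sup>+t. indicator ?F t \<partial>lborel)" using F by simp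
    also have "\<dots> = ennreal \<bar>\<xi> b3\<bar> * (\<integral>\<^sup>+z. indicator ?F (c v + \<xi> b3 * z) \<partial>lborel)"
      using F b3 by (intro nn_integral_real_affine) auto
    also have "(\<integral>\<^sup>+z. indicator ?F (c v + \<xi> b3 * z) \<partial>lborel) = (\<integral>\<^sup>+z. indicator (Pair v -` (J -` E)) z \<partial>lborel)"
      using b3 by (intro nn_integral_cong) (simp add: indicator_def)
    also have "\<dots> = emeasure lborel (Pair v -` (J -` E))" using G by simp
    finally show ?thesis .
  qed
  have m: "(\<lambda>v. emeasure lborel (Pair v -` (J -` E))) \<in> borel_measurable lborel"
    by (rule lborel.measurable_emeasure_Pair[OF JE'])
  have "emeasure lborel (\<Phi> ` E) = (\<integral>\<^sup>+v. emeasure lborel (Pair v -` (\<Phi> ` E)) \<partial>lborel)"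
    using lborel.emeasure_pair_measure_alt[OF \<Phi>E'] by (simp only: lborel_prod)
  also have "\<dots> = ennreal \<bar>\<xi> b3\<bar> * (\<integral>\<^sup>+v. emeasure lborel (Pair v -` (J -` E)) \<partial>lborel)"
    unfolding slice scale using m by (rule nn_integral_cmult)
  also have "(\<integral>\<^sup>+v. emeasure lborel (Pair v -` (J -` E)) \<partial>lborel) = emeasure lborel (J -` E)"
    using lborel.emeasure_pair_measure_alt[OF JE'] by (simp only: lborel_prod)
  also have "emeasure lborel (J -` E) = emeasure (distr lborel borel J) E"
    using borel_compact[OF E] borel_measurable_continuous_onI[OF J_cont] by (subst emeasure_distr) auto
  also have "distr lborel borel J = lborel"
    unfolding J_def by (rule lborel_eq_distr_coordinates[OF basis, symmetric])
  finally show ?thesis .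
qed

lemma emeasure_product_coordinates:
  fixes \<xi> :: "'a::euclidean_space \<Rightarrow> real"
  assumes \<xi>: "linear \<xi>" and basis: "Basis = {b1, b2, b3}" "b1 \<noteq> b2" "b1 \<noteq> b3" "b2 \<noteq> b3" and b3: "\<xi> b3 \<noteq> 0"
  defines "\<Phi> \<equiv> \<lambda>w. ((inner w b1, inner w b2), \<xi> w)"
  assumes Z: "compact (Z :: ('a \<times> real) set)"
  shows "emeasure lborel (map_prod \<Phi> id ` Z) = ennreal \<bar>\<xi> b3\<bar> * emeasure lborel Z"
proof -
  have \<Phi>_cont: "continuous_on S \<Phi>" for S
    unfolding \<Phi>_def using linear_continuous_on[OF \<xi>[unfolded linear_conv_bounded_linear]] by (intro continuous_intros)
  have map: "map_prod \<Phi> id = (\<lambda>z. (\<Phi> (fst z), snd z))" by (auto simp: map_prod_def)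
  have cont: "continuous_on Z (map_prod \<Phi> id)"
    unfolding map by (intro continuous_on_Pair continuous_on_compose2[OF \<Phi>_cont[of UNIV]] continuous_on_fst
        continuous_on_snd continuous_on_id subset_UNIV)
  have Z': "Z \<in> sets ((lborel :: 'a measure) \<Otimes>\<^sub>M (lborel :: real measure))"
    using borel_compact[OF Z] by (simp only: lborel_prod sets_lborel)
  have Y': "map_prod \<Phi> id ` Z \<in> sets ((lborel :: space3 measure) \<Otimes>\<^sub>M (lborel :: real measure))"
    using borel_compact[OF compact_continuous_image[OF cont Z]] by (simp only: lborel_prod sets_lborel)
  have slice: "(\<lambda>x. (x, t)) -` (map_prod \<Phi> id ` Z) = \<Phi> ` ((\<lambda>x. (x, t)) -` Z)" for t
    by force
  have compact: "compact ((\<lambda>x. (x, t)) -` Z)" for t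
  proof -
    have "(\<lambda>x. (x, t)) -` Z = fst ` (Z \<inter> UNIV \<times> {t})" by force
    moreover have "compact (Z \<inter> UNIV \<times> {t})" using Z by (intro compact_Int_closed closed_Times) auto
    then have "compact (fst ` (Z \<inter> UNIV \<times> {t}))" by (rule compact_continuous_image[rotated]) (intro continuous_intros)
    ultimately show ?thesis by simp
  qed
  have m: "(\<lambda>t. emeasure lborel ((\<lambda>x. (x, t)) -` Z)) \<in> borel_measurable lborel"
    by (rule lborel_pair.measurable_emeasure_Pair2[OF Z'])
  have "emeasure lborel (map_prod \<Phi> id ` Z) = (\<integral>\<^sup>+t. emeasure lborel (\<Phi> ` ((\<lambda>x. (x, t)) -` Z)) \<partial>lborel)"
    using lborel_pair.emeasure_pair_measure_alt2[OF Y'] by (simp only: lborel_prod slice)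
  also have "\<dots> = (\<integral>\<^sup>+t. ennreal \<bar>\<xi> b3\<bar> * emeasure lborel ((\<lambda>x. (x, t)) -` Z) \<partial>lborel)"
    unfolding \<Phi>_def by (simp only: emeasure_coordinates[OF \<xi> basis b3 compact])
  also have "\<dots> = ennreal \<bar>\<xi> b3\<bar> * (\<integral>\<^sup>+t. emeasure lborel ((\<lambda>x. (x, t)) -` Z) \<partial>lborel)"
    using m by (rule nn_integral_cmult)
  also have "(\<integral>\<^sup>+t. emeasure lborel ((\<lambda>x. (x, t)) -` Z) \<partial>lborel) = emeasure lborel Z"
    using lborel_pair.emeasure_pair_measure_alt2[OF Z'] by (simp only: lborel_prod)
  finally show ?thesis .
qed

section \<open>Mixed volumes of horizontal bodies and graphs\<close>

lemma measure_scaled_product: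
  fixes \<mu> :: "'a::euclidean_space measure"
  assumes c: "c > 0" "\<mu> = scale_measure (ennreal c) lborel" and X: "compact X"
  shows "measure (\<mu> \<Otimes>\<^sub>M (lborel :: real measure)) X = c * measure lborel X"
proof -
  have X1: "X \<in> sets ((lborel :: 'a measure) \<Otimes>\<^sub>M (lborel :: real measure))"
    using borel_compact[OF X] by (simp only: lborel_prod sets_lborel)
  have "sets (\<mu> \<Otimes>\<^sub>M (lborel :: real measure)) = sets ((lborel :: 'a measure) \<Otimes>\<^sub>M (lborel :: real measure))"
    unfolding c(2) by (rule sets_pair_measure_cong) auto
  then have X2: "X \<in> sets (\<mu> \<Otimes>\<^sub>M (lborel :: real measure))" using X1 by simp
  have "emeasure (\<mu> \<Otimes>\<^sub>M lborel) X = (\<integral>\<^sup>+x. emeasure lborel (Pair x -` X) \<partial>\<mu>)"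
    using X2 by (rule lborel.emeasure_pair_measure_alt)
  also have "\<dots> = ennreal c * (\<integral>\<^sup>+x. emeasure lborel (Pair x -` X) \<partial>lborel)"
    unfolding c(2) using lborel.measurable_emeasure_Pair[OF X1] by (simp add: nn_integral_scale_measure)
  also have "\<dots> = ennreal c * emeasure lborel X"
    using lborel.emeasure_pair_measure_alt[OF X1] by (simp only: lborel_prod)
  finally show ?thesis using c(1) by (simp add: measure_def enn2real_mult)
qed

lemma measure_horizontal: "measure lborel (X \<times> {t :: real}) = 0" if X: "compact X" for X :: "'a::euclidean_space set"
proof -
  have "emeasure (lborel \<Otimes>\<^sub>M lborel) (X \<times> {t}) = emeasure lborel X * emeasure lborel {t}"
    using borel_compact[OF X] by (intro lborel.emeasure_pair_measure_Times) auto
  then show ?thesis by (simp add: measure_def lborel_prod)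
qed

lemma linear_graphing: "linear \<xi> \<Longrightarrow> linear (graphing \<xi>)"
  by (rule linearI) (simp_all add: graphing_def linear_add linear_scale)

lemma graphing_compact:
  fixes \<xi> :: "'a::euclidean_space \<Rightarrow> real"
  shows "linear \<xi> \<Longrightarrow> compact X \<Longrightarrow> compact (graphing \<xi> ` X)"
  by (intro linear_image_compact linear_graphing)

lemma measure_graph:
  fixes \<xi> :: "'a::euclidean_space \<Rightarrow> real"
  assumes \<xi>: "linear \<xi>" and X: "compact X"
  shows "measure lborel (graphing \<xi> ` X) = 0"
proof -
  have S: "graphing \<xi> ` X \<in> sets ((lborel :: 'a measure) \<Otimes>\<^sub>M (lborel :: real measure))"
    using borel_compact[OF graphing_compact[OF \<xi> X]] by (simp only: lborel_prod sets_lborel)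
  have "emeasure lborel (Pair w -` (graphing \<xi> ` X)) = 0" for w
  proof -
    have "Pair w -` (graphing \<xi> ` X) \<subseteq> {\<xi> w}" by (auto simp: graphing_def)
    then have "emeasure lborel (Pair w -` (graphing \<xi> ` X)) \<le> emeasure lborel {\<xi> w}" by (intro emeasure_mono) auto
    then show ?thesis by simp
  qed
  then have "emeasure (lborel \<Otimes>\<^sub>M lborel) (graphing \<xi> ` X) = 0"
    using lborel.emeasure_pair_measure_alt[OF S] by simp
  then show ?thesis by (simp add: measure_def lborel_prod)
qed

lemma horizontal_plus: "X \<times> {0} + Y \<times> {0 :: real} = (X + Y) \<times> {0}"
proof (rule equalityI; rule subsetI)
  fix z assume "z \<in> X \<times> {0} + Y \<times> {0 :: real}"
  then show "z \<in> (X + Y) \<times> {0}" by (elim set_plus_elim) (auto intro: set_plus_intro)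
next
  fix z assume "z \<in> (X + Y) \<times> {0 :: real}"
  then obtain x y where "z = (x, 0) + (y, 0)" "x \<in> X" "y \<in> Y" by (auto elim: set_plus_elim)
  then show "z \<in> X \<times> {0} + Y \<times> {0 :: real}" by (simp only:) (intro set_plus_intro; simp)
qed

text \<open>
  The remaining terms of the polarization formula are sums of bodies from only one of the two
  hyperplanes, which have measure zero.
\<close>

lemma mixed_volume_horizontal_graph:
  fixes \<mu> :: "'a::euclidean_space measure"
  assumes c: "c > 0" "\<mu> = scale_measure (ennreal c) lborel" and \<xi>: "linear \<xi>"
    and bodies: "compact A1" "compact A2" "compact B1" "compact B2"
  defines "v \<equiv> \<lambda>X Y. c * measure lborel (X \<times> {0} + graphing \<xi> ` Y)"
  shows "24 * mixed_volume (\<mu> \<Otimes>\<^sub>M lborel) [A1 \<times> {0}, A2 \<times> {0}, graphing \<xi> ` B1, graphing \<xi> ` B2]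
    = v (A1 + A2) (B1 + B2) - v (A1 + A2) B1 - v (A1 + A2) B2 - v A1 (B1 + B2) - v A2 (B1 + B2)
      + v A1 B1 + v A1 B2 + v A2 B1 + v A2 B2"
proof -
  let ?M = "\<mu> \<Otimes>\<^sub>M (lborel :: real measure)"
  have hc: "compact (X \<times> {0 :: real})" if "compact X" for X :: "'a set"
    using that by (intro compact_Times) auto
  have v: "measure ?M (X \<times> {0} + graphing \<xi> ` Y) = v X Y" if "compact X" "compact Y" for X Y
    unfolding v_def by (intro measure_scaled_product[OF c] compact_set_plus hc graphing_compact \<xi> that)
  have h: "measure ?M (X \<times> {0}) = 0" if "compact X" for X
    using measure_scaled_product[OF c hc[OF that]] measure_horizontal[OF that] by simp
  have g: "measure ?M (graphing \<xi> ` X) = 0" if "compact X" for X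
    using measure_scaled_product[OF c graphing_compact[OF \<xi> that]] measure_graph[OF \<xi> that] by simp
  note AB = compact_set_plus[OF bodies(1,2)] compact_set_plus[OF bodies(3,4)]
  have assoc: "P + Q + R = P + (Q + R)" for P Q R :: "('a \<times> real) set" by (rule add.assoc)
  show ?thesis
    unfolding mixed_volume_4
    by (simp only: horizontal_plus linear_image_plus[OF linear_graphing[OF \<xi>], symmetric] assoc[of _ "graphing \<xi> ` B1" "graphing \<xi> ` B2"]
        v h g bodies AB) simp
qed

lemma map_prod_horizontal_graph:
  assumes "linear \<Phi>" and "\<And>w. snd (\<Phi> w) = \<xi> w"
  shows "map_prod \<Phi> id ` (X \<times> {0} + graphing \<xi> ` Y) = sheared_sum (\<Phi> ` X) (\<Phi> ` Y)"
proof -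
  have "map_prod \<Phi> id ((x, 0) + graphing \<xi> y) = (\<Phi> x + \<Phi> y, snd (\<Phi> y))" for x y
    by (simp add: graphing_def linear_add[OF assms(1)] assms(2))
  then have "map_prod \<Phi> id ` (\<lambda>q. (fst q, 0) + graphing \<xi> (snd q)) ` (X \<times> Y)
    = (\<lambda>w. (fst w + snd w, snd (snd w))) ` (\<lambda>q. (\<Phi> (fst q), \<Phi> (snd q))) ` (X \<times> Y)"
    unfolding image_image by (intro image_cong refl) simp
  moreover have "X \<times> {0} + graphing \<xi> ` Y = (\<lambda>q. (fst q, 0) + graphing \<xi> (snd q)) ` (X \<times> Y)"
  proof (rule equalityI; rule subsetI)
    fix z assume "z \<in> X \<times> {0} + graphing \<xi> ` Y"
    then obtain p q where "p \<in> X \<times> {0}" "q \<in> graphing \<xi> ` Y" "z = p + q" by (elim set_plus_elim)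
    then obtain x y where "x \<in> X" "y \<in> Y" "z = (x, 0) + graphing \<xi> y" by auto
    then show "z \<in> (\<lambda>q. (fst q, 0) + graphing \<xi> (snd q)) ` (X \<times> Y)"
      by (intro image_eqI[of _ _ "(x, y)"]) simp_all
  next
    fix z assume "z \<in> (\<lambda>q. (fst q, 0) + graphing \<xi> (snd q)) ` (X \<times> Y)"
    then obtain x y where "x \<in> X" "y \<in> Y" "z = (x, 0) + graphing \<xi> y" by auto
    then show "z \<in> X \<times> {0} + graphing \<xi> ` Y" by (simp only:) (intro set_plus_intro imageI; simp)
  qed
  moreover have "(\<lambda>q. (\<Phi> (fst q), \<Phi> (snd q))) ` (X \<times> Y) = \<Phi> ` X \<times> \<Phi> ` Y"
    by (force simp: image_iff)
  ultimately show ?thesis by (simp only: sheared_sum_def)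
qed

lemma mixed_volume_eq_mixed_form:
  fixes \<mu> :: "'a::euclidean_space measure"
  assumes c: "c > 0" "\<mu> = scale_measure (ennreal c) lborel" and \<xi>: "linear \<xi>"
    and basis: "Basis = {b1, b2, b3}" "b1 \<noteq> b2" "b1 \<noteq> b3" "b2 \<noteq> b3" and b3: "\<xi> b3 \<noteq> 0"
    and bodies: "convex_body A1" "convex_body A2" "convex_body B1" "convex_body B2"
  defines "\<Phi> \<equiv> \<lambda>w. ((inner w b1, inner w b2), \<xi> w)"
  shows "mixed_volume (\<mu> \<Otimes>\<^sub>M lborel) [A1 \<times> {0}, A2 \<times> {0}, graphing \<xi> ` B1, graphing \<xi> ` B2]
    = c / (24 * \<bar>\<xi> b3\<bar>) * mixed_form (mixed_fiber_fn (\<Phi> ` A1) (\<Phi> ` A2)) (mixed_fiber_fn (\<Phi> ` B1) (\<Phi> ` B2))"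
proof -
  have lin: "linear \<Phi>"
    by (rule linearI) (simp_all add: \<Phi>_def inner_add_left linear_add[OF \<xi>] linear_scale[OF \<xi>])
  have body: "convex_body (\<Phi> ` X)" if "convex_body X" for X
    using that lin convex_linear_image[OF lin, of X]
    by (simp add: convex_body_def linear_conv_bounded_linear linear_continuous_on compact_continuous_image)
  have plus: "\<Phi> ` (X + Y) = \<Phi> ` X + \<Phi> ` Y" for X Y
    by (rule linear_image_plus[OF lin])
  have hc: "compact (X \<times> {0} + graphing \<xi> ` Y)" if "compact X" "compact Y" for X Y
    using that by (intro compact_set_plus compact_Times graphing_compact \<xi>) auto
  have vol: "c * measure lborel (X \<times> {0} + graphing \<xi> ` Y) = c / \<bar>\<xi> b3\<bar> * measure lborel (sheared_sum (\<Phi> ` X) (\<Phi> ` Y))"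
    if "compact X" "compact Y" for X Y
  proof -
    have "emeasure lborel (sheared_sum (\<Phi> ` X) (\<Phi> ` Y)) = ennreal \<bar>\<xi> b3\<bar> * emeasure lborel (X \<times> {0} + graphing \<xi> ` Y)"
    proof -
      have image: "map_prod \<Phi> id ` (X \<times> {0} + graphing \<xi> ` Y) = sheared_sum (\<Phi> ` X) (\<Phi> ` Y)"
        by (rule map_prod_horizontal_graph[OF lin]) (simp add: \<Phi>_def)
      show ?thesis
        unfolding image[symmetric] unfolding \<Phi>_def by (rule emeasure_product_coordinates[OF \<xi> basis b3 hc[OF that]])
    qed
    then have "measure lborel (sheared_sum (\<Phi> ` X) (\<Phi> ` Y)) = \<bar>\<xi> b3\<bar> * measure lborel (X \<times> {0} + graphing \<xi> ` Y)"
      by (simp add: measure_def enn2real_mult)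
    then show ?thesis using b3 by simp
  qed
  have co: "compact A1" "compact A2" "compact B1" "compact B2" using bodies by (simp_all add: convex_body_def)
  note cs = compact_set_plus[OF co(1,2)] compact_set_plus[OF co(3,4)]
  have "24 * mixed_volume (\<mu> \<Otimes>\<^sub>M lborel) [A1 \<times> {0}, A2 \<times> {0}, graphing \<xi> ` B1, graphing \<xi> ` B2]
    = c / \<bar>\<xi> b3\<bar> * mixed_form (mixed_fiber_fn (\<Phi> ` A1) (\<Phi> ` A2)) (mixed_fiber_fn (\<Phi> ` B1) (\<Phi> ` B2))"
    unfolding mixed_volume_horizontal_graph[OF c \<xi> co]
      sheared_sum_polarization[OF body[OF bodies(1)] body[OF bodies(2)] body[OF bodies(3)] body[OF bodies(4)], symmetric]
    by (simp only: vol co cs plus) (simp add: algebra_simps)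
  then show ?thesis using b3 by (simp add: field_simps)
qed

theorem corollary1p5:
  fixes \<mu> :: "'a::euclidean_space measure" and \<xi> :: "'a \<Rightarrow> real"
    and A\<^sub>1 A\<^sub>2 B\<^sub>1 B\<^sub>2 :: "'a set"
  assumes "DIM('a) = 3" and "positive_Lebesgue_measure \<mu>" and "linear \<xi>"
    and "convex_body A\<^sub>1" "convex_body A\<^sub>2" "convex_body B\<^sub>1" "convex_body B\<^sub>2"
    and "centrally_symmetric B\<^sub>1" "centrally_symmetric B\<^sub>2"
  shows "let V = mixed_volume (\<mu> \<Otimes>\<^sub>M lborel) in
    V [A\<^sub>1 \<times> {0}, A\<^sub>2 \<times> {0}, graphing \<xi> ` B\<^sub>1, graphing \<xi> ` B\<^sub>2] ^ 2
    \<ge> V [A\<^sub>1 \<times> {0}, A\<^sub>2 \<times> {0}, graphing \<xi> ` A\<^sub>1, graphing \<xi> ` A\<^sub>2]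
      * V [B\<^sub>1 \<times> {0}, B\<^sub>2 \<times> {0}, graphing \<xi> ` B\<^sub>1, graphing \<xi> ` B\<^sub>2]"
proof -
  obtain c where c: "c > 0" "\<mu> = scale_measure (ennreal c) lborel"
    using assms(2) unfolding positive_Lebesgue_measure_def by blast
  have co: "compact A\<^sub>1" "compact A\<^sub>2" "compact B\<^sub>1" "compact B\<^sub>2" using assms by (simp_all add: convex_body_def)
  let ?V = "mixed_volume (\<mu> \<Otimes>\<^sub>M lborel)"
  show ?thesis
  proof (cases "\<exists>b\<in>Basis. \<xi> b \<noteq> 0")
    case False
    then have "\<xi> = (\<lambda>_. 0)"
      using linear_eq_stdbasis[OF assms(3), of "\<lambda>_. 0"] by (auto simp: linear_zero)
    then have graph: "graphing \<xi> ` X = X \<times> {0}" for X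
      by (auto simp: graphing_def)
    have "24 * ?V [A\<^sub>1 \<times> {0}, A\<^sub>2 \<times> {0}, graphing \<xi> ` A\<^sub>1, graphing \<xi> ` A\<^sub>2] = 0"
      unfolding mixed_volume_horizontal_graph[OF c assms(3) co(1,2,1,2)]
      by (simp add: graph horizontal_plus measure_horizontal compact_set_plus co)
    then show ?thesis by (simp add: Let_def)
  next
    case True
    then obtain b3 where b3: "b3 \<in> Basis" "\<xi> b3 \<noteq> 0" by blast
    then have "card (Basis - {b3}) = 2" using assms(1) by simp
    then obtain b1 b2 where b12: "Basis - {b3} = {b1, b2}" "b1 \<noteq> b2" by (auto simp: card_2_iff)
    then have basis: "Basis = {b1, b2, b3}" "b1 \<noteq> b2" "b1 \<noteq> b3" "b2 \<noteq> b3" using b3(1) by auto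
    \<comment> \<open>\<open>b3\<close> is transversal to the kernel of \<open>\<xi>\<close>, so these are coordinates on the whole space\<close>
    define \<Phi> where "\<Phi> = (\<lambda>w. ((inner w b1, inner w b2), \<xi> w))"
    have lin: "linear \<Phi>"
      by (rule linearI) (simp_all add: \<Phi>_def inner_add_left linear_add[OF assms(3)] linear_scale[OF assms(3)])
    have body: "compact (\<Phi> ` X)" "convex (\<Phi> ` X)" "\<Phi> ` X \<noteq> {}" if "convex_body X" for X
      using that lin convex_linear_image[OF lin, of X]
      by (simp_all add: convex_body_def linear_conv_bounded_linear linear_continuous_on compact_continuous_image)
    define m where "m = mixed_fiber_fn (\<Phi> ` A\<^sub>1) (\<Phi> ` A\<^sub>2)"
    define n where "n = mixed_fiber_fn (\<Phi> ` B\<^sub>1) (\<Phi> ` B\<^sub>2)"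
    have "sublinear m" "sublinear n"
      unfolding m_def n_def by (intro mixed_fiber_fn_sublinear body assms)+
    then have mink: "mixed_form m m * mixed_form n n \<le> (mixed_form m n)\<^sup>2" by (rule mixed_form_Minkowski)
    note V = mixed_volume_eq_mixed_form[OF c assms(3) basis b3(2), folded \<Phi>_def]
    define k where "k = c / (24 * \<bar>\<xi> b3\<bar>)"
    have "k\<^sup>2 * (mixed_form m m * mixed_form n n) \<le> k\<^sup>2 * (mixed_form m n)\<^sup>2"
      using mink by (rule mult_left_mono) simp
    then show ?thesis
      unfolding Let_def V[OF assms(4,5,6,7)] V[OF assms(4,5,4,5)] V[OF assms(6,7,6,7)]
        m_def[symmetric] n_def[symmetric] k_def[symmetric]
      by (simp add: power2_eq_square algebra_simps)
  qed
qed

end
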